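(* Let $r\ge0$. The types $[H]\in\mathcal T$ for which the stratum $S_{[H]}\subseteq\mathbb M^r_2$ is nonempty are exactly: $[O(2)]$; $[D_m]$ for $1\le m\le r-2$; $[K_1]$ if $r\ge4$; and $[K_m]$ for $2\le m\le r-4$. In particular the type $[SO(2)]$ never occurs.
   Context: $\mathbb M^r_2$ is the moduli space of $r$-jets at a point $x_0$ of Riemannian metrics on a smooth surface: the quotient of the manifold of such $r$-jets by the pullback action of the group $\mathrm{Diff}_{x_0}$ of germs of local diffeomorphisms fixing $x_0$. For a jet $j^r_{x_0}g$, $\mathrm{Aut}(j^r_{x_0}g)=\{j^{r+1}_{x_0}\tau: j^r_{x_0}(\tau^*g)=j^r_{x_0}g\}$, identified via $j^{r+1}_{x_0}\tau\mapsto\tau_{*,x_0}$ (injective) with a closed subgroup of $O(T_{x_0}X,g_{x_0})\cong O(2)$, well defined up to conjugacy. $\mathcal T$ is the set of conjugacy classes of closed subgroups of $O(2)$; the type of $[j^r_{x_0}g]$ is $[\mathrm{Aut}(j^r_{x_0}g)]$, and $S_{[H]}$ is the set of points of type $[H]$. Up to conjugacy the closed subgroups of $O(2)$ are $O(2)$, $SO(2)$, $K_m=\langle\sigma_m\rangle$ and $D_m=\langle\sigma_m,\tau\rangle$ ($m\ge1$), where $\sigma_m$ is rotation by $2\pi/m$ and $\tau$ a reflection. *)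

theory Defs
  imports "HOL-Analysis.Analysis"
begin

text \<open>We work in a chart: the surface is modelled near x0 by R^2 (real^2) with x0 = 0.
 Iterated partial derivatives of a scalar function on R^2; the list is applied
 right-to-left (last element differentiated first).\<close>

fun pd :: "2 list \<Rightarrow> (real^2 \<Rightarrow> real) \<Rightarrow> real^2 \<Rightarrow> real" where
  "pd [] f = f"
| "pd (i # is) f = (\<lambda>x. deriv (\<lambda>t. pd is f (x + t *\<^sub>R axis i 1)) 0)"

text \<open>C-infinity: all iterated partial derivatives exist and are continuous.\<close>
definition smooth_fn :: "(real^2 \<Rightarrow> real) \<Rightarrow> bool" where
  "smooth_fn f \<longleftrightarrow> (\<forall>is. continuous_on UNIV (pd is f) \<and>
      (\<forall>i x. (\<lambda>t. pd is f (x + t *\<^sub>R axis i 1)) differentiable (at 0)))"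

text \<open>Equality of r-jets at 0 of scalar functions.\<close>
definition jet_eq :: "nat \<Rightarrow> (real^2 \<Rightarrow> real) \<Rightarrow> (real^2 \<Rightarrow> real) \<Rightarrow> bool" where
  "jet_eq r f h \<longleftrightarrow> (\<forall>is. length is \<le> r \<longrightarrow> pd is f 0 = pd is h 0)"

text \<open>Equality of r-jets at 0 of metric (matrix-valued) fields, componentwise.\<close>
definition metric_jet_eq :: "nat \<Rightarrow> (real^2 \<Rightarrow> real^2^2) \<Rightarrow> (real^2 \<Rightarrow> real^2^2) \<Rightarrow> bool" where
  "metric_jet_eq r g h \<longleftrightarrow> (\<forall>i j. jet_eq r (\<lambda>x. g x $ i $ j) (\<lambda>x. h x $ i $ j))"

text \<open>A Riemannian metric near 0: smooth symmetric matrix field, positive definite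
  on a neighbourhood of 0.\<close>
definition riem_metric :: "(real^2 \<Rightarrow> real^2^2) \<Rightarrow> bool" where
  "riem_metric g \<longleftrightarrow> (\<forall>i j. smooth_fn (\<lambda>x. g x $ i $ j)) \<and>
     (\<forall>x. transpose (g x) = g x) \<and>
     (\<exists>e>0. \<forall>x\<in>ball 0 e. \<forall>v. v \<noteq> 0 \<longrightarrow> v \<bullet> (g x *v v) > 0)"

text \<open>Jacobian matrix of a map: entry (k,i) is the i-th partial of the k-th component.\<close>
definition jac :: "(real^2 \<Rightarrow> real^2) \<Rightarrow> real^2 \<Rightarrow> real^2^2" where
  "jac \<tau> x = (\<chi> k i. pd [i] (\<lambda>y. \<tau> y $ k) x)"

text \<open>Germ of a local diffeomorphism fixing 0 (represented by a smooth map with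
  invertible derivative at 0; only its jet at 0 matters).\<close>
definition diff0 :: "(real^2 \<Rightarrow> real^2) \<Rightarrow> bool" where
  "diff0 \<tau> \<longleftrightarrow> (\<forall>k. smooth_fn (\<lambda>y. \<tau> y $ k)) \<and> \<tau> 0 = 0 \<and> invertible (jac \<tau> 0)"

text \<open>Pullback of a metric: (tau^* g)(x) = D tau(x)^T g(tau x) D tau(x).\<close>
definition pullback :: "(real^2 \<Rightarrow> real^2) \<Rightarrow> (real^2 \<Rightarrow> real^2^2) \<Rightarrow> real^2 \<Rightarrow> real^2^2" where
  "pullback \<tau> g x = transpose (jac \<tau> x) ** g (\<tau> x) ** jac \<tau> x"

text \<open>Aut of the r-jet of g at 0, realised as the set of derivatives tau_{*,0}.\<close>
definition Aut :: "nat \<Rightarrow> (real^2 \<Rightarrow> real^2^2) \<Rightarrow> (real^2^2) set" where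
  "Aut r g = {jac \<tau> 0 | \<tau>. diff0 \<tau> \<and> metric_jet_eq r (pullback \<tau> g) g}"

definition O2 :: "(real^2^2) set" where
  "O2 = {A. transpose A ** A = mat 1}"

definition SO2 :: "(real^2^2) set" where
  "SO2 = {A \<in> O2. det A = 1}"

definition rot :: "real \<Rightarrow> real^2^2" where
  "rot \<theta> = (\<chi> i j. if i = 1 then (if j = 1 then cos \<theta> else - sin \<theta>)
                           else (if j = 1 then sin \<theta> else cos \<theta>))"

definition refl0 :: "real^2^2" where
  "refl0 = (\<chi> i j. if i = j then (if i = 1 then 1 else -1) else 0)"

definition Kgrp :: "nat \<Rightarrow> (real^2^2) set" where
  "Kgrp m = {rot (2 * pi * real k / real m) | k. k < m}"

definition Dgrp :: "nat \<Rightarrow> (real^2^2) set" where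
  "Dgrp m = Kgrp m \<union> (\<lambda>A. refl0 ** A) ` Kgrp m"

definition closed_subgroup_O2 :: "(real^2^2) set \<Rightarrow> bool" where
  "closed_subgroup_O2 H \<longleftrightarrow> H \<subseteq> O2 \<and> closed H \<and> mat 1 \<in> H \<and>
     (\<forall>A\<in>H. \<forall>B\<in>H. A ** B \<in> H) \<and> (\<forall>A\<in>H. matrix_inv A \<in> H)"

text \<open>Conjugacy of subgroups within O(2).\<close>
definition conj_O2 :: "(real^2^2) set \<Rightarrow> (real^2^2) set \<Rightarrow> bool" where
  "conj_O2 H H' \<longleftrightarrow> (\<exists>Q\<in>O2. H' = (\<lambda>A. Q ** A ** transpose Q) ` H)"

text \<open>The r-jet of g at 0 has type [H]: after identifying (T_0, g_0) with standard
  Euclidean R^2 by a linear isometry P, Aut becomes a conjugate of H in O(2).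
  (Varying P over all such isometries absorbs the conjugation.)\<close>
definition has_type :: "nat \<Rightarrow> (real^2 \<Rightarrow> real^2^2) \<Rightarrow> (real^2^2) set \<Rightarrow> bool" where
  "has_type r g H \<longleftrightarrow> (\<exists>P. transpose P ** g 0 ** P = mat 1 \<and>
      (\<lambda>A. matrix_inv P ** A ** P) ` Aut r g = H)"

text \<open>Stratum S_[H] of M^r_2 is nonempty.\<close>
definition stratum_nonempty :: "nat \<Rightarrow> (real^2^2) set \<Rightarrow> bool" where
  "stratum_nonempty r H \<longleftrightarrow> (\<exists>g. riem_metric g \<and> has_type r g H)"

end

theory Submission
  imports Defs
begin

text \<open>In normal coordinates a metric satisfies the Gauss lemma \<open>g(x) x = x\<close>. To finite order such
  coordinates are constructed degree by degree: if \<open>w = g(x) x - x\<close> vanishes to order \<open>k + 1\<close>, then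
  \<open>id + \<xi>\<close> with \<open>\<xi> = - (w + \<nabla>s) / k\<close>, \<open>s = - (w \<bullet> x) / (2 k + 2)\<close> raises this order by one, by
  Euler's identity. The same computation shows that an automorphism of the \<open>r\<close>-jet of a metric in normal
  coordinates is linear up to order \<open>r + 1\<close>. On a surface the Gauss lemma leaves a single free function,
  the trace of \<open>g\<close>, so the automorphism group is the stabiliser in \<open>O(2)\<close> of the Taylor polynomial
  \<open>\<Sum> c a b z^a cnj z^b\<close> (\<open>a, b \<ge> 1\<close>, \<open>a + b \<le> r\<close>) of that trace, and every hermitian array \<open>c\<close>
  occurs. The rotation of angle \<open>\<theta>\<close> fixes the polynomial iff \<open>exp (\<i> \<theta> (a - b)) = 1\<close> whenever
  \<open>c a b \<noteq> 0\<close>; this forces \<open>m \<le> r - 2\<close> for a finite rotation group of order \<open>m\<close>, and a single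
  pair of coefficients always admits a reflection.

  Jets are handled through orders of vanishing at the origin: for smooth functions, equality of
  \<open>r\<close>-jets means that the difference is \<open>O(\<bar>x\<bar>^(r + 1))\<close>.\<close>


section \<open>Smooth functions on the plane\<close>

text \<open>Two obstacles shape the development. \<open>pd\<close> is an iterated limit along
  coordinate lines, while composition, inversion and normalisation need estimates; the analytic core
  is therefore \<open>vanish_pd1\<close>: differentiating a smooth function costs only one order of
  vanishing. And diffeomorphisms are represented by maps smooth on the whole plane, so a local
  inverse is replaced by an inverse to finite order, \<open>jet_inverse\<close>.

  The bounds of the classification come from counting degrees. For a finite rotation group of order
  \<open>m\<close>, every difference \<open>a - b\<close> with \<open>c a b\<close> nonzero is a
  multiple of \<open>m\<close>. A purely cyclic group needs a nonzero coefficient with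
  \<open>a > b\<close> other than the one at \<open>(m + 1, 1)\<close>. The cheapest candidates are
  \<open>(m + 2, 2)\<close> of degree \<open>m + 4\<close> and \<open>(2 * m + 1, 1)\<close> of
  degree \<open>2 * m + 2\<close>; the latter is strictly cheaper only for \<open>m = 1\<close>,
  hence the separate threshold \<open>4\<close> for \<open>Kgrp 1\<close>. An infinite rotation
  group leaves only diagonal coefficients; these are real, so every reflection is a symmetry as
  well, and \<open>SO2\<close> cannot occur.\<close>

lemma pd_append: "pd (is @ js) f = pd is (pd js f)"
  by (induction "is") auto

lemma pd_Cons: "pd (i # is) f = pd [i] (pd is f)"
  by simp

declare pd.simps(2) [simp del]

definition has_partials :: "(real^2 \<Rightarrow> real) \<Rightarrow> bool" where
  "has_partials f \<longleftrightarrow> (\<forall>i x. (\<lambda>t. f (x + t *\<^sub>R axis i 1)) differentiable (at 0))"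

lemma smooth_fn_continuous: "smooth_fn f \<Longrightarrow> continuous_on UNIV f"
  unfolding smooth_fn_def by (metis pd.simps(1))

lemma smooth_fn_has_partials: "smooth_fn f \<Longrightarrow> has_partials f"
  unfolding smooth_fn_def has_partials_def by (metis pd.simps(1))

lemma smooth_fn_pd: "smooth_fn f \<Longrightarrow> smooth_fn (pd is f)"
  unfolding smooth_fn_def by (metis pd_append)

lemma smooth_fn_coinduct:
  assumes "S f"
    and step: "\<And>f. S f \<Longrightarrow> continuous_on UNIV f \<and> has_partials f \<and> (\<forall>i. S (pd [i] f))"
  shows "smooth_fn f"
proof -
  have "S (pd is f)" for "is"
  proof (induction "is")
    case (Cons i "is")
    then show ?case using step by (metis pd_Cons)
  qed (simp add: assms(1))
  then show ?thesis
    using step unfolding smooth_fn_def has_partials_def by blast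
qed

text \<open>\<open>has_partials\<close> only speaks of parameter 0 on each line; re-basing the line
  at its point of parameter \<open>s\<close> gives differentiability all along it.\<close>

lemma has_partials_DERIV:
  assumes "has_partials f"
  shows "((\<lambda>t. f (x + t *\<^sub>R axis i 1)) has_real_derivative pd [i] f (x + s *\<^sub>R axis i 1)) (at s)"
proof -
  have "(\<lambda>t. f ((x + s *\<^sub>R axis i 1) + t *\<^sub>R axis i 1)) differentiable (at 0)"
    using assms unfolding has_partials_def by blast
  then have "((\<lambda>t. f ((x + s *\<^sub>R axis i 1) + t *\<^sub>R axis i 1)) has_real_derivative
      pd [i] f (x + s *\<^sub>R axis i 1)) (at 0)"
    by (simp add: DERIV_deriv_iff_real_differentiable pd.simps(2))
  then show ?thesis
    using DERIV_shift[of "\<lambda>t. f (x + t *\<^sub>R axis i 1)" "pd [i] f (x + s *\<^sub>R axis i 1)" 0 s]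
    by (simp add: algebra_simps)
qed

lemma has_derivative_DERIV_line:
  assumes "(f has_derivative D) (at x)"
  shows "((\<lambda>t. f (x + t *\<^sub>R v)) has_real_derivative D v) (at 0)"
proof -
  interpret D: bounded_linear D using assms by (rule has_derivative_bounded_linear)
  have 1: "((\<lambda>t. x + t *\<^sub>R v) has_derivative (\<lambda>t. t *\<^sub>R v)) (at (0::real))"
    by (auto intro!: derivative_eq_intros)
  have "((\<lambda>t. f (x + t *\<^sub>R v)) has_derivative (\<lambda>t. D (t *\<^sub>R v))) (at 0)"
    using diff_chain_at[OF 1, of f D] assms by (simp add: o_def)
  then show ?thesis
    by (simp add: has_field_derivative_def D.scaleR mult_commute_abs)
qed

lemma differentiableI: "(f has_derivative D) F \<Longrightarrow> f differentiable F"
  unfolding differentiable_def by blast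

lemma pd_eq_derivative:
  "(f has_derivative D) (at x) \<Longrightarrow> pd [i] f x = D (axis i 1)"
  using has_derivative_DERIV_line[of f D x "axis i 1"] by (simp add: DERIV_imp_deriv pd.simps(2))

lemma has_partialsI: "(\<And>x. f differentiable (at x)) \<Longrightarrow> has_partials f"
  unfolding has_partials_def differentiable_def[of f]
  using has_derivative_DERIV_line real_differentiable_def by blast

lemma vec2_decompose: "(x::real^2) = x$1 *\<^sub>R axis 1 1 + x$2 *\<^sub>R axis 2 1"
  by (simp add: vec_eq_iff forall_2 axis_def)

text \<open>Continuity of the partials yields total differentiability:
  \<open>has_derivative_partialsI\<close> is applied to \<open>f\<close> read as a function of a
  pair of reals, and the result is composed with the linear coordinate map.\<close>

lemma C1_has_derivative:
  assumes f: "has_partials f" and c: "\<And>i. continuous_on UNIV (pd [i] f)"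
  shows "(f has_derivative (\<lambda>h. pd [1] f x * h$1 + pd [2] f x * h$2)) (at x)"
proof -
  let ?v = "\<lambda>a b. a *\<^sub>R axis 1 1 + b *\<^sub>R axis 2 1 :: real^2"
  let ?F = "\<lambda>a b. f (?v a b)"
  have "((\<lambda>(a, b). ?F a b) has_derivative
      (\<lambda>(ta, tb). pd [1] f x * ta + blinfun_mult_right (pd [2] f (?v (x$1) (x$2))) tb))
      (at (x$1, x$2) within UNIV \<times> UNIV)"
  proof (rule has_derivative_partialsI[where fy = "\<lambda>a b. blinfun_mult_right (pd [2] f (?v a b))"])
    have "((\<lambda>a. f (x$2 *\<^sub>R axis 2 1 + a *\<^sub>R axis 1 1)) has_real_derivative
       pd [1] f (x$2 *\<^sub>R axis 2 1 + x$1 *\<^sub>R axis 1 1)) (at (x$1))"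
      by (rule has_partials_DERIV[OF f])
    then show "((\<lambda>a. ?F a (x$2)) has_derivative (*) (pd [1] f x)) (at (x$1))"
      by (simp add: has_field_derivative_def add.commute flip: vec2_decompose)
    show "((\<lambda>b. ?F a b) has_derivative blinfun_apply (blinfun_mult_right (pd [2] f (?v a b)))) (at b)"
      for a b
      using has_partials_DERIV[OF f, of "a *\<^sub>R axis 1 1" 2 b] by (simp add: has_field_derivative_def)
    have 1: "isCont (pd [2] f) y" for y
      using c[of 2] by (simp add: continuous_on_eq_continuous_at)
    have "isCont (\<lambda>p. blinfun_mult_right (pd [2] f (?v (fst p) (snd p)))) (x$1, x$2)"
      by (intro bounded_linear.isCont[OF bounded_linear_blinfun_mult_right]
            continuous_within_compose3[OF 1] continuous_intros)
    then show "continuous (at (x$1, x$2) within UNIV \<times> UNIV)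
        (\<lambda>(a, b). blinfun_mult_right (pd [2] f (?v a b)))"
      by (simp add: case_prod_unfold)
  qed auto
  then have 1: "((\<lambda>p. ?F (fst p) (snd p)) has_derivative
      (\<lambda>p. pd [1] f x * fst p + pd [2] f x * snd p)) (at (x$1, x$2))"
    by (simp add: case_prod_unfold flip: vec2_decompose)
  have 2: "((\<lambda>y::real^2. (y$1, y$2)) has_derivative (\<lambda>h. (h$1, h$2))) (at x)"
    by (intro has_derivative_Pair bounded_linear_imp_has_derivative bounded_linear_vec_nth)
  show ?thesis
    using diff_chain_at[OF 2 1] by (simp add: o_def flip: vec2_decompose)
qed

lemma smooth_fn_has_derivative:
  "smooth_fn f \<Longrightarrow> (f has_derivative (\<lambda>h. pd [1] f x * h$1 + pd [2] f x * h$2)) (at x)"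
  by (intro C1_has_derivative smooth_fn_has_partials smooth_fn_continuous smooth_fn_pd)

text \<open>Smoothness of sums, products and compositions is obtained by coinduction: the closure of the
  smooth functions under these operations is stable under partial derivatives.\<close>

inductive smooth_closure :: "(real^2 \<Rightarrow> real) \<Rightarrow> bool" where
  base: "smooth_fn f \<Longrightarrow> smooth_closure f"
| const: "smooth_closure (\<lambda>x. c)"
| coord: "smooth_closure (\<lambda>x. x $ i)"
| add: "smooth_closure f \<Longrightarrow> smooth_closure g \<Longrightarrow> smooth_closure (\<lambda>x. f x + g x)"
| mult: "smooth_closure f \<Longrightarrow> smooth_closure g \<Longrightarrow> smooth_closure (\<lambda>x. f x * g x)"
| comp: "smooth_closure f \<Longrightarrow> (\<And>i::2. smooth_closure (\<lambda>x. \<tau> x $ i)) \<Longrightarrow> smooth_closure (\<lambda>x. f (\<tau> x))"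

lemma smooth_closure_continuous: "smooth_closure f \<Longrightarrow> continuous_on UNIV f"
proof (induction rule: smooth_closure.induct)
  case (comp f \<tau>)
  have "continuous_on UNIV \<tau>"
    unfolding continuous_on_def
    by (intro ballI vec_tendstoI) (use comp.IH(2) in \<open>auto simp: continuous_on_def\<close>)
  then show ?case
    by (rule continuous_on_compose2[OF comp.IH(1)]) auto
qed (auto intro: smooth_fn_continuous continuous_on_add continuous_on_mult continuous_on_component)

lemma smooth_closure_step:
  "smooth_closure f \<Longrightarrow> (\<forall>x. f differentiable (at x)) \<and> (\<forall>i. smooth_closure (pd [i] f))"
proof (induction rule: smooth_closure.induct)
  case (base f)
  then show ?case
    by (intro conjI allI smooth_closure.base smooth_fn_pd differentiableI[OF smooth_fn_has_derivative])
next
  case (const c)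
  have "pd [i] (\<lambda>x. c) = (\<lambda>x. 0)" for i
    using pd_eq_derivative[OF has_derivative_const] by (rule ext)
  then show ?case using smooth_closure.const[of 0] by simp
next
  case (coord j)
  have D: "((\<lambda>x. x $ j) has_derivative (\<lambda>h. h $ j)) (at x)" for x :: "real^2"
    by (rule bounded_linear_imp_has_derivative[OF bounded_linear_vec_nth])
  have "pd [i] (\<lambda>x. x $ j) = (\<lambda>x. axis i 1 $ j)" for i
    using pd_eq_derivative[OF D] by (rule ext)
  then show ?case using differentiableI[OF D] smooth_closure.const by simp
next
  case (add f g)
  then have D: "(f has_derivative frechet_derivative f (at x)) (at x)"
    and E: "(g has_derivative frechet_derivative g (at x)) (at x)" for x
    using frechet_derivative_works by blast+
  have "pd [i] (\<lambda>x. f x + g x) = (\<lambda>x. pd [i] f x + pd [i] g x)" for i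
    by (rule ext)
      (simp add: pd_eq_derivative[OF has_derivative_add[OF D E]] pd_eq_derivative[OF D] pd_eq_derivative[OF E])
  then show ?case
    using add.IH smooth_closure.add by simp
next
  case (mult f g)
  then have D: "(f has_derivative frechet_derivative f (at x)) (at x)"
    and E: "(g has_derivative frechet_derivative g (at x)) (at x)" for x
    using frechet_derivative_works by blast+
  have "pd [i] (\<lambda>x. f x * g x) = (\<lambda>x. f x * pd [i] g x + pd [i] f x * g x)" for i
    by (rule ext)
      (simp add: pd_eq_derivative[OF has_derivative_mult[OF D E]] pd_eq_derivative[OF D] pd_eq_derivative[OF E])
  then show ?case
    using mult.IH mult.hyps smooth_closure.mult smooth_closure.add by simp
next
  case (comp f \<tau>)
  \<comment> \<open>Membership in the closure is not yet smoothness, so the chain rule rests on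
    total derivatives obtained from the continuity of the first partials, which the induction
    hypotheses provide.\<close>
  have Df: "(f has_derivative (\<lambda>h. pd [1] f y * h$1 + pd [2] f y * h$2)) (at y)" for y
    using comp.IH(1) by (intro C1_has_derivative has_partialsI smooth_closure_continuous) auto
  have D\<tau>: "((\<lambda>x. \<tau> x $ k) has_derivative
      (\<lambda>h. pd [1] (\<lambda>x. \<tau> x $ k) y * h$1 + pd [2] (\<lambda>x. \<tau> x $ k) y * h$2)) (at y)" for k y
    using comp.IH(2)[of k] by (intro C1_has_derivative has_partialsI smooth_closure_continuous) auto
  have "(\<tau> has_derivative
      (\<lambda>h. \<chi> k. pd [1] (\<lambda>x. \<tau> x $ k) y * h$1 + pd [2] (\<lambda>x. \<tau> x $ k) y * h$2)) (at y)" for y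
    unfolding has_derivative_componentwise_within[of \<tau>]
    by (auto simp: Basis_vec_def inner_axis intro: D\<tau>)
  from diff_chain_at[OF this Df]
  have F: "((\<lambda>x. f (\<tau> x)) has_derivative (\<lambda>h.
     pd [1] f (\<tau> x) * (pd [1] (\<lambda>x. \<tau> x $ 1) x * h$1 + pd [2] (\<lambda>x. \<tau> x $ 1) x * h$2) +
     pd [2] f (\<tau> x) * (pd [1] (\<lambda>x. \<tau> x $ 2) x * h$1 + pd [2] (\<lambda>x. \<tau> x $ 2) x * h$2))) (at x)" for x
    by (simp add: o_def)
  have "pd [i] (\<lambda>x. f (\<tau> x)) x = pd [1] f (\<tau> x) * pd [i] (\<lambda>x. \<tau> x $ 1) x +
      pd [2] f (\<tau> x) * pd [i] (\<lambda>x. \<tau> x $ 2) x" for i x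
    using pd_eq_derivative[OF F, of i] exhaust_2[of i] by (auto simp: axis_def)
  then have "pd [i] (\<lambda>x. f (\<tau> x)) = (\<lambda>x. pd [1] f (\<tau> x) * pd [i] (\<lambda>x. \<tau> x $ 1) x +
      pd [2] f (\<tau> x) * pd [i] (\<lambda>x. \<tau> x $ 2) x)" for i
    by (rule ext)
  moreover have "smooth_closure (\<lambda>x. pd [k] f (\<tau> x) * pd [i] (\<lambda>x. \<tau> x $ k) x)" for i k
    using smooth_closure.mult[OF smooth_closure.comp[of "pd [k] f" \<tau>]] comp.IH comp.hyps(2) by simp
  ultimately show ?case
    using differentiableI[OF F] smooth_closure.add by simp
qed

lemma smooth_closure_smooth: "smooth_closure f \<Longrightarrow> smooth_fn f"
  by (rule smooth_fn_coinduct[of smooth_closure])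
     (simp_all add: smooth_closure_continuous smooth_closure_step has_partialsI)

lemma smooth_fn_const: "smooth_fn (\<lambda>x. c)"
  and smooth_fn_coord: "smooth_fn (\<lambda>x. x $ i)"
  by (auto intro: smooth_closure_smooth smooth_closure.const smooth_closure.coord)

lemma smooth_fn_add: "smooth_fn f \<Longrightarrow> smooth_fn g \<Longrightarrow> smooth_fn (\<lambda>x. f x + g x)"
  and smooth_fn_mult: "smooth_fn f \<Longrightarrow> smooth_fn g \<Longrightarrow> smooth_fn (\<lambda>x. f x * g x)"
  by (auto intro: smooth_closure_smooth smooth_closure.add smooth_closure.mult smooth_closure.base)

lemma smooth_fn_comp:
  "smooth_fn f \<Longrightarrow> (\<And>i. smooth_fn (\<lambda>x. \<tau> x $ i)) \<Longrightarrow> smooth_fn (\<lambda>x. f (\<tau> x))"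
  by (rule smooth_closure_smooth, rule smooth_closure.comp) (auto intro: smooth_closure.base)

lemma smooth_fn_minus: "smooth_fn f \<Longrightarrow> smooth_fn (\<lambda>x. - f x)"
  using smooth_fn_mult[OF smooth_fn_const[of "-1"], of f] by simp

lemma smooth_fn_diff: "smooth_fn f \<Longrightarrow> smooth_fn g \<Longrightarrow> smooth_fn (\<lambda>x. f x - g x)"
  using smooth_fn_add[OF _ smooth_fn_minus, of f g] by simp

lemma smooth_fn_divide: "smooth_fn f \<Longrightarrow> smooth_fn (\<lambda>x. f x / c)"
  using smooth_fn_mult[OF _ smooth_fn_const[of "1/c"], of f] by simp

lemma smooth_fn_sum: "(\<And>i. i \<in> I \<Longrightarrow> smooth_fn (f i)) \<Longrightarrow> smooth_fn (\<lambda>x. \<Sum>i\<in>I. f i x)"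
  by (induction I rule: infinite_finite_induct) (auto intro: smooth_fn_const smooth_fn_add)

lemma smooth_fn_power: "smooth_fn f \<Longrightarrow> smooth_fn (\<lambda>x. f x ^ n)"
  by (induction n) (auto intro: smooth_fn_const smooth_fn_mult)

lemmas smooth_intros = smooth_fn_const smooth_fn_coord smooth_fn_add smooth_fn_mult smooth_fn_minus
  smooth_fn_diff smooth_fn_divide smooth_fn_sum smooth_fn_power smooth_fn_pd

lemma pd1_add:
  assumes "smooth_fn f" "smooth_fn g"
  shows "pd [i] (\<lambda>x. f x + g x) x = pd [i] f x + pd [i] g x"
  using pd_eq_derivative[OF has_derivative_add[OF assms[THEN smooth_fn_has_derivative]], where i = i] exhaust_2[of i]
  by (auto simp: axis_def)

lemma pd1_diff:
  assumes "smooth_fn f" "smooth_fn g"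
  shows "pd [i] (\<lambda>x. f x - g x) x = pd [i] f x - pd [i] g x"
  using pd_eq_derivative[OF has_derivative_diff[OF assms[THEN smooth_fn_has_derivative]], where i = i] exhaust_2[of i]
  by (auto simp: axis_def)

lemma pd1_mult:
  assumes "smooth_fn f" "smooth_fn g"
  shows "pd [i] (\<lambda>x. f x * g x) x = f x * pd [i] g x + pd [i] f x * g x"
  using pd_eq_derivative[OF has_derivative_mult[OF assms[THEN smooth_fn_has_derivative]], where i = i] exhaust_2[of i]
  by (auto simp: axis_def)

lemma pd1_const: "pd [i] (\<lambda>x. c) x = 0"
  by (simp add: pd.simps(2))

lemma pd1_coord: "pd [i] (\<lambda>x. x $ j) x = (if i = j then 1 else 0)"
  using pd_eq_derivative[OF bounded_linear_imp_has_derivative[OF bounded_linear_vec_nth[of j]], of i x]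
  by (simp add: axis_def)

lemma pd_diff: "smooth_fn f \<Longrightarrow> smooth_fn g \<Longrightarrow> pd is (\<lambda>x. f x - g x) = (\<lambda>x. pd is f x - pd is g x)"
proof (induction "is")
  case (Cons i "is")
  then have "pd [i] (pd is (\<lambda>x. f x - g x)) = (\<lambda>x. pd [i] (pd is f) x - pd [i] (pd is g) x)"
    by (auto simp: pd1_diff smooth_fn_pd)
  then show ?case
    by (metis pd_Cons)
qed simp


section \<open>Orders of vanishing at the origin\<close>

text \<open>The filter \<open>nhds 0\<close> sees the origin itself, so a positive order forces
  \<open>f 0 = 0\<close>, while order 0 is mere local boundedness.\<close>

definition vanish :: "nat \<Rightarrow> (real^2 \<Rightarrow> 'a::real_normed_vector) \<Rightarrow> bool" where
  "vanish k f \<longleftrightarrow> (\<exists>C. \<forall>\<^sub>F x in nhds 0. norm (f x) \<le> C * norm x ^ k)"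

lemma vanishI:
  "e > 0 \<Longrightarrow> (\<And>x. norm x < e \<Longrightarrow> norm (f x) \<le> C * norm x ^ k) \<Longrightarrow> vanish k f"
  unfolding vanish_def eventually_nhds_metric by (auto simp: dist_norm)

lemma vanishE:
  assumes "vanish k f"
  obtains C e where "C \<ge> 0" "e > 0" "\<And>x. norm x < e \<Longrightarrow> norm (f x) \<le> C * norm x ^ k"
proof -
  obtain C e where e: "e > 0" "\<And>x. norm x < e \<Longrightarrow> norm (f x) \<le> C * norm x ^ k"
    using assms unfolding vanish_def eventually_nhds_metric by (auto simp: dist_norm)
  have "norm (f x) \<le> \<bar>C\<bar> * norm x ^ k" if "norm x < e" for x
    by (rule order_trans[OF e(2)[OF that] mult_right_mono]) auto
  then show ?thesis using that[of "\<bar>C\<bar>" e] e by simp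
qed

lemma vanish_0: "vanish (Suc k) f \<Longrightarrow> f 0 = 0"
  by (erule vanishE, drule meta_spec[of _ 0]) simp

lemma vanish_zero: "vanish k (\<lambda>x. 0)"
  by (rule vanishI[of 1 _ 0]) auto

lemma vanish_mono:
  assumes "vanish k f" "j \<le> k" shows "vanish j f"
proof -
  obtain C e where C: "C \<ge> 0" "e > 0" "\<And>x. norm x < e \<Longrightarrow> norm (f x) \<le> C * norm x ^ k"
    using assms(1) by (rule vanishE) blast
  show ?thesis
  proof (rule vanishI[of "min e 1"])
    fix x :: "real^2" assume x: "norm x < min e 1"
    have "C * norm x ^ k \<le> C * norm x ^ j"
      using x assms(2) C(1) by (intro mult_left_mono power_decreasing) auto
    then show "norm (f x) \<le> C * norm x ^ j" using C(3)[of x] x by auto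
  qed (use C in auto)
qed

lemma vanish_add:
  assumes "vanish k f" "vanish k g" shows "vanish k (\<lambda>x. f x + g x)"
proof -
  obtain C e where C: "C \<ge> 0" "e > 0" "\<And>x. norm x < e \<Longrightarrow> norm (f x) \<le> C * norm x ^ k"
    using assms(1) by (rule vanishE) blast
  obtain D d where D: "D \<ge> 0" "d > 0" "\<And>x. norm x < d \<Longrightarrow> norm (g x) \<le> D * norm x ^ k"
    using assms(2) by (rule vanishE) blast
  show ?thesis
  proof (rule vanishI[of "min e d"])
    fix x :: "real^2" assume "norm x < min e d"
    then show "norm (f x + g x) \<le> (C + D) * norm x ^ k"
      using C(3)[of x] D(3)[of x] norm_triangle_ineq[of "f x" "g x"] by (simp add: distrib_right)
  qed (use C D in auto)
qed

lemma vanish_bilinear: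
  assumes "bounded_bilinear p" "vanish j f" "vanish k g" shows "vanish (j + k) (\<lambda>x. p (f x) (g x))"
proof -
  obtain K where K: "K \<ge> 0" "\<And>a b. norm (p a b) \<le> norm a * norm b * K"
    using bounded_bilinear.nonneg_bounded[OF assms(1)] by blast
  obtain C e where C: "C \<ge> 0" "e > 0" "\<And>x. norm x < e \<Longrightarrow> norm (f x) \<le> C * norm x ^ j"
    using assms(2) by (rule vanishE) blast
  obtain D d where D: "D \<ge> 0" "d > 0" "\<And>x. norm x < d \<Longrightarrow> norm (g x) \<le> D * norm x ^ k"
    using assms(3) by (rule vanishE) blast
  show ?thesis
  proof (rule vanishI[of "min e d"])
    fix x :: "real^2" assume x: "norm x < min e d"
    have "norm (p (f x) (g x)) \<le> norm (f x) * norm (g x) * K" by (rule K)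
    also have "\<dots> \<le> (C * norm x ^ j) * (D * norm x ^ k) * K"
      using C(1) D(1) C(3)[of x] D(3)[of x] x K by (intro mult_right_mono mult_mono) auto
    finally show "norm (p (f x) (g x)) \<le> (C * D * K) * norm x ^ (j + k)"
      by (simp add: power_add mult_ac)
  qed (use C D in auto)
qed

lemma vanish_linear:
  assumes "bounded_linear p" "vanish k f" shows "vanish k (\<lambda>x. p (f x))"
proof -
  obtain K where K: "K \<ge> 0" "\<And>a. norm (p a) \<le> norm a * K"
    using bounded_linear.nonneg_bounded[OF assms(1)] by blast
  obtain C e where C: "C \<ge> 0" "e > 0" "\<And>x. norm x < e \<Longrightarrow> norm (f x) \<le> C * norm x ^ k"
    using assms(2) by (rule vanishE) blast
  show ?thesis
  proof (rule vanishI[of e])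
    fix x :: "real^2" assume x: "norm x < e"
    have "norm (p (f x)) \<le> norm (f x) * K" by (rule K)
    also have "\<dots> \<le> (C * norm x ^ k) * K"
      using C(1) C(3)[of x] x K by (intro mult_right_mono mult_mono) auto
    finally show "norm (p (f x)) \<le> (C * K) * norm x ^ k"
      by (simp add: mult_ac)
  qed (use C in auto)
qed

lemma vanish_minus: "vanish k f \<Longrightarrow> vanish k (\<lambda>x. - f x)"
  by (rule vanish_linear[OF bounded_linear_minus[OF bounded_linear_ident]])

lemma vanish_diff: "vanish k f \<Longrightarrow> vanish k g \<Longrightarrow> vanish k (\<lambda>x. f x - g x)"
  using vanish_add[OF _ vanish_minus, of k f g] by simp

lemma vanish_sum: "(\<And>i. i \<in> I \<Longrightarrow> vanish k (f i)) \<Longrightarrow> vanish k (\<lambda>x. \<Sum>i\<in>I. f i x)"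
  by (induction I rule: infinite_finite_induct) (auto intro: vanish_zero vanish_add)

lemma vanish_mult:
  fixes f g :: "real^2 \<Rightarrow> 'a::real_normed_algebra"
  shows "vanish j f \<Longrightarrow> vanish k g \<Longrightarrow> vanish (j + k) (\<lambda>x. f x * g x)"
  by (rule vanish_bilinear[OF bounded_bilinear_mult])

lemma vanish_id: "vanish 1 (\<lambda>x. x)"
  by (rule vanishI[of 1 _ 1]) auto

lemma vanish_continuous: "isCont f 0 \<Longrightarrow> vanish 0 f"
proof -
  assume "isCont f 0"
  then obtain e where e: "e > 0" "\<And>x. norm x < e \<Longrightarrow> dist (f x) (f 0) < 1"
    unfolding continuous_at_eps_delta by (metis dist_0_norm dist_commute zero_less_one)
  show ?thesis
  proof (rule vanishI[of e])
    show "norm (f x) \<le> (norm (f 0) + 1) * norm x ^ 0" if "norm x < e" for x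
      using e(2)[OF that] norm_triangle_sub[of "f x" "f 0"] by (simp add: dist_norm)
  qed (rule e)
qed

lemma vanish_const: "vanish 0 (\<lambda>x. c)"
  by (rule vanish_continuous) simp

lemma vanish_compose:
  assumes "vanish k f" "vanish 1 \<tau>" shows "vanish k (\<lambda>x. f (\<tau> x))"
proof -
  obtain C e where C: "C \<ge> 0" "e > 0" "\<And>x. norm x < e \<Longrightarrow> norm (f x) \<le> C * norm x ^ k"
    using assms(1) by (rule vanishE) blast
  obtain D d where D: "D \<ge> 0" "d > 0" "\<And>x. norm x < d \<Longrightarrow> norm (\<tau> x) \<le> D * norm x"
    using assms(2) by (rule vanishE) auto
  show ?thesis
  proof (rule vanishI[of "min d (e / (D + 1))"])
    fix x :: "real^2" assume x: "norm x < min d (e / (D + 1))"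
    have "norm x * (D + 1) < e"
      using x D(1) by (simp add: less_divide_eq)
    moreover have "norm x * (D + 1) = D * norm x + norm x"
      by (simp add: algebra_simps)
    ultimately have "D * norm x < e"
      using norm_ge_zero[of x] by linarith
    then have "norm (\<tau> x) < e"
      using x D(3)[of x] by simp
    then have "norm (f (\<tau> x)) \<le> C * norm (\<tau> x) ^ k" by (rule C)
    also have "\<dots> \<le> C * (D * norm x) ^ k"
      using C(1) D(3)[of x] x by (intro mult_left_mono power_mono) auto
    finally show "norm (f (\<tau> x)) \<le> (C * D ^ k) * norm x ^ k"
      by (simp add: power_mult_distrib mult_ac)
  qed (use C D in auto)
qed

text \<open>Serves where an estimate is reached by cancelling a factor \<open>norm x\<close>, which
  says nothing at the origin; there the bound follows by passing to the limit.\<close>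

lemma vanish_punctured:
  assumes cont: "isCont f 0" and ev: "\<forall>\<^sub>F x in at 0. norm (f x) \<le> C * norm x ^ k"
  shows "vanish k f"
proof -
  have "((\<lambda>x. norm (f x)) \<longlongrightarrow> norm (f 0)) (at 0)"
    using cont by (simp add: isCont_def tendsto_norm)
  moreover have "((\<lambda>x. C * norm x ^ k) \<longlongrightarrow> C * norm (0::real^2) ^ k) (at (0::real^2))"
    by (intro tendsto_intros)
  ultimately have "norm (f 0) \<le> C * norm (0::real^2) ^ k"
    using ev tendsto_le[OF at_neq_bot, of "\<lambda>x. C * norm x ^ k" "C * norm (0::real^2) ^ k"] by blast
  then show ?thesis
    using ev unfolding vanish_def eventually_at_filter
    by (intro exI[of _ C]) (auto elim: eventually_mono)
qed

lemma vanish_component_iff: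
  fixes f :: "real^2 \<Rightarrow> ('a::euclidean_space)^'n"
  shows "vanish k f \<longleftrightarrow> (\<forall>i. vanish k (\<lambda>x. f x $ i))"
proof
  show "vanish k f \<Longrightarrow> \<forall>i. vanish k (\<lambda>x. f x $ i)"
    by (auto intro: vanish_linear[OF bounded_linear_vec_nth])
  assume a: "\<forall>i. vanish k (\<lambda>x. f x $ i)"
  have "bounded_linear (\<lambda>y. axis i y :: 'a^'n)" for i
    by (intro linear_conv_bounded_linear[THEN iffD1] linearI)
       (auto simp: vec_eq_iff axis_def)
  then have "vanish k (\<lambda>x. \<Sum>i\<in>UNIV. axis i (f x $ i))"
    using a by (intro vanish_sum vanish_linear[of "axis _"]) auto
  moreover have "(\<Sum>i\<in>UNIV. axis i (y $ i)) = y" for y :: "'a^'n"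
    by (simp add: vec_eq_iff axis_def)
  ultimately show "vanish k f" by simp
qed

lemma vanish_coord: "vanish 1 (\<lambda>x. x $ i)"
  using vanish_component_iff[of 1 "\<lambda>x. x"] vanish_id by blast

lemma vanish_power: "vanish k f \<Longrightarrow> vanish (n * k) (\<lambda>x. f x ^ n)" for f :: "real^2 \<Rightarrow> 'a::real_normed_algebra_1"
  by (induction n) (auto intro: vanish_const vanish_mult)

lemma smooth_fn_isCont: "smooth_fn f \<Longrightarrow> isCont f x"
  using smooth_fn_continuous continuous_on_eq_continuous_at by blast

lemma vanish_smooth: "smooth_fn f \<Longrightarrow> vanish 0 f"
  by (intro vanish_continuous smooth_fn_isCont)

section \<open>Taylor expansion along coordinate lines and the order of partial derivatives\<close>

lemma smooth_fn_bounded: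
  assumes "smooth_fn f"
  obtains B where "B \<ge> 0" "\<And>x. norm x \<le> 1 \<Longrightarrow> \<bar>f x\<bar> \<le> B"
proof -
  have "bounded (f ` cball 0 1)"
    by (intro compact_imp_bounded compact_continuous_image continuous_on_subset[OF smooth_fn_continuous[OF assms]])
       auto
  then show ?thesis
    unfolding bounded_pos using that by (metis imageI less_imp_le mem_cball_0 real_norm_def)
qed

lemma line_taylor:
  assumes "smooth_fn f"
  shows "\<exists>s. \<bar>s\<bar> \<le> \<bar>t\<bar> \<and> f (x + t *\<^sub>R axis i 1) =
    (\<Sum>m<n. pd (replicate m i) f x / fact m * t ^ m) +
     pd (replicate n i) f (x + s *\<^sub>R axis i 1) / fact n * t ^ n"
proof -
  have "DERIV (\<lambda>s. pd (replicate m i) f (x + s *\<^sub>R axis i 1)) s :> pd (replicate (Suc m) i) f (x + s *\<^sub>R axis i 1)"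
    for m s
    using has_partials_DERIV[OF smooth_fn_has_partials[OF smooth_fn_pd[OF assms, of "replicate m i"]]]
    by (simp flip: pd_Cons)
  then show ?thesis
    using Maclaurin_all_le[of "\<lambda>m s. pd (replicate m i) f (x + s *\<^sub>R axis i 1)"
        "\<lambda>s. f (x + s *\<^sub>R axis i 1)" t n] by simp
qed

lemma norm_axis_sum: "norm (a *\<^sub>R axis 1 1 + b *\<^sub>R axis 2 1 :: real^2) = sqrt (a\<^sup>2 + b\<^sup>2)"
  by (simp add: norm_vec_def L2_set_def UNIV_2 axis_def)

lemma norm_axis_sum_le:
  "\<bar>s\<bar> \<le> \<bar>x $ 1\<bar> \<Longrightarrow> norm (x$2 *\<^sub>R axis 2 1 + s *\<^sub>R axis 1 1 :: real^2) \<le> norm (x :: real^2)"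
proof -
  assume "\<bar>s\<bar> \<le> \<bar>x $ 1\<bar>"
  then have "s\<^sup>2 \<le> (x$1)\<^sup>2" by (simp add: abs_le_square_iff)
  then show ?thesis
    by (subst (2) vec2_decompose, subst add.commute, unfold norm_axis_sum) simp
qed

lemma norm_axis_le: "\<bar>s\<bar> \<le> \<bar>x $ i\<bar> \<Longrightarrow> norm (0 + s *\<^sub>R axis i 1 :: real^2) \<le> norm (x :: real^2)"
  using component_le_norm_cart[of x i] by (simp add: norm_axis_1)

text \<open>The base point may vary with \<open>x\<close>: one use expands parallel to the first
  axis from the foot of \<open>x\<close> on the second axis, another along the second axis from the
  origin. The hypothesis on \<open>\<beta>\<close> keeps the intermediate point within norm
  \<open>norm x\<close>, where the derivative in the remainder is bounded.\<close>

lemma vanish_line_taylor: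
  assumes f: "smooth_fn f" and \<beta>: "\<And>x s. \<bar>s\<bar> \<le> \<bar>x $ i\<bar> \<Longrightarrow> norm (\<beta> x + s *\<^sub>R axis i 1) \<le> norm x"
  shows "vanish n (\<lambda>x. f (\<beta> x + x $ i *\<^sub>R axis i 1) - (\<Sum>m<n. pd (replicate m i) f (\<beta> x) / fact m * (x $ i) ^ m))"
proof -
  obtain B where B: "B \<ge> 0" "\<And>x. norm x \<le> 1 \<Longrightarrow> \<bar>pd (replicate n i) f x\<bar> \<le> B"
    using smooth_fn_bounded[OF smooth_fn_pd[OF f]] by blast
  show ?thesis
  proof (rule vanishI[of 1])
    fix x :: "real^2" assume x: "norm x < 1"
    obtain s where s: "\<bar>s\<bar> \<le> \<bar>x $ i\<bar>" and eq: "f (\<beta> x + x $ i *\<^sub>R axis i 1) =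
      (\<Sum>m<n. pd (replicate m i) f (\<beta> x) / fact m * (x $ i) ^ m) +
      pd (replicate n i) f (\<beta> x + s *\<^sub>R axis i 1) / fact n * (x $ i) ^ n"
      using line_taylor[OF f] by blast
    have "\<bar>pd (replicate n i) f (\<beta> x + s *\<^sub>R axis i 1)\<bar> \<le> B"
      using \<beta>[OF s] x by (intro B(2)) simp
    then have "\<bar>pd (replicate n i) f (\<beta> x + s *\<^sub>R axis i 1)\<bar> / fact n * \<bar>x $ i\<bar> ^ n \<le> B / fact n * norm x ^ n"
      using B(1) by (intro mult_mono divide_right_mono power_mono component_le_norm_cart) auto
    then show "norm (f (\<beta> x + x $ i *\<^sub>R axis i 1) - (\<Sum>m<n. pd (replicate m i) f (\<beta> x) / fact m * (x $ i) ^ m))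
        \<le> B / fact n * norm x ^ n"
      unfolding eq by (simp add: abs_mult power_abs)
  qed simp
qed

text \<open>Mean value theorem on the two legs of the path that runs from the origin along the
  second axis and then parallel to the first. Both intermediate points have norm at most
  \<open>norm x\<close>, so the bounds on the partials apply there.\<close>

lemma vanish_from_partials:
  assumes f: "smooth_fn f" "f 0 = 0" and v: "\<And>i. vanish k (pd [i] f)"
  shows "vanish (Suc k) f"
proof -
  obtain C e where C: "C \<ge> 0" "e > 0" "\<And>x. norm x < e \<Longrightarrow> norm (pd [1] f x) \<le> C * norm x ^ k"
    using v[of 1] by (rule vanishE) blast
  obtain D d where D: "D \<ge> 0" "d > 0" "\<And>x. norm x < d \<Longrightarrow> norm (pd [2] f x) \<le> D * norm x ^ k"
    using v[of 2] by (rule vanishE) blast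
  show ?thesis
  proof (rule vanishI[of "min e d"])
    fix x :: "real^2" assume x: "norm x < min e d"
    let ?y = "x$2 *\<^sub>R axis 2 1 :: real^2"
    obtain s where s: "\<bar>s\<bar> \<le> \<bar>x $ 1\<bar>" "f (?y + x$1 *\<^sub>R axis 1 1) = f ?y + pd [1] f (?y + s *\<^sub>R axis 1 1) * x$1"
      using line_taylor[OF f(1), of "x$1" ?y 1 1] by auto
    obtain t where t: "\<bar>t\<bar> \<le> \<bar>x $ 2\<bar>" "f (0 + ?y) = f 0 + pd [2] f (0 + t *\<^sub>R axis 2 1) * x$2"
      using line_taylor[OF f(1), of "x$2" 0 2 1] by auto
    have ny: "norm (?y + s *\<^sub>R axis 1 1) \<le> norm x" "norm (0 + t *\<^sub>R axis 2 1 :: real^2) \<le> norm x"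
      using norm_axis_sum_le[OF s(1)] norm_axis_le[OF t(1)] by auto
    have "\<bar>pd [1] f (?y + s *\<^sub>R axis 1 1)\<bar> \<le> C * norm (?y + s *\<^sub>R axis 1 1) ^ k"
      using C(3)[of "?y + s *\<^sub>R axis 1 1"] ny x by simp
    also have "\<dots> \<le> C * norm x ^ k"
      using ny C(1) by (intro mult_left_mono power_mono) auto
    finally have 1: "\<bar>pd [1] f (?y + s *\<^sub>R axis 1 1) * x$1\<bar> \<le> C * norm x ^ k * norm x"
      using C(1) unfolding abs_mult by (intro mult_mono component_le_norm_cart) auto
    have "\<bar>pd [2] f (0 + t *\<^sub>R axis 2 1)\<bar> \<le> D * norm (0 + t *\<^sub>R axis 2 1 :: real^2) ^ k"
      using D(3)[of "0 + t *\<^sub>R axis 2 1"] ny x by simp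
    also have "\<dots> \<le> D * norm x ^ k"
      using ny D(1) by (intro mult_left_mono power_mono) auto
    finally have 2: "\<bar>pd [2] f (0 + t *\<^sub>R axis 2 1) * x$2\<bar> \<le> D * norm x ^ k * norm x"
      using D(1) unfolding abs_mult by (intro mult_mono component_le_norm_cart) auto
    have "f x = pd [1] f (?y + s *\<^sub>R axis 1 1) * x$1 + pd [2] f (0 + t *\<^sub>R axis 2 1) * x$2"
      using s(2) t(2) f(2) vec2_decompose[of x] by (simp add: add.commute)
    then have "\<bar>f x\<bar> \<le> C * norm x ^ k * norm x + D * norm x ^ k * norm x"
      using 1 2 by linarith
    then show "norm (f x) \<le> (C + D) * norm x ^ Suc k"
      by (simp add: algebra_simps)
  qed (use C D in auto)
qed

text \<open>A Markov-type inequality: on polynomials of degree at most \<open>k + 1\<close> the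
  linear coefficient is controlled by the supremum on the unit interval, with a constant depending
  on the degree alone. This uniformity is what \<open>vanish_pd1\<close> needs, since its
  polynomials vary with the base point.\<close>

lemma linear_coeff_bound:
  "\<exists>C. \<forall>(a::nat \<Rightarrow> real) M. (\<forall>s\<in>{0..1}. \<bar>\<Sum>m<Suc (Suc k). a m * s ^ m\<bar> \<le> M) \<longrightarrow> \<bar>a 1\<bar> \<le> C * M"
proof (induction k)
  case 0
  have "\<bar>a 1\<bar> \<le> 2 * M" if "\<forall>s\<in>{0..1}. \<bar>\<Sum>m<Suc (Suc 0). a m * s ^ m\<bar> \<le> M" for a :: "nat \<Rightarrow> real" and M
    using bspec[OF that, of 0] bspec[OF that, of 1] by simp
  then show ?case by blast
next
  case (Suc k)
  then obtain C where C: "\<And>(a::nat \<Rightarrow> real) M. (\<forall>s\<in>{0..1}. \<bar>\<Sum>m<Suc (Suc k). a m * s ^ m\<bar> \<le> M) \<Longrightarrow> \<bar>a 1\<bar> \<le> C * M"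
    by blast
  define d where "d = Suc (Suc k)"
  have "\<bar>a 1\<bar> \<le> (C * (2 ^ d + 1)) * M"
    if a: "\<forall>s\<in>{0..1}. \<bar>\<Sum>m<Suc d. a m * s ^ m\<bar> \<le> M" for a :: "nat \<Rightarrow> real" and M
  proof -
    \<comment> \<open>Passing from \<open>q s\<close> to \<open>2^d q (s/2) - q s\<close> kills the leading coefficient and multiplies the
      linear one by \<open>2^(d-1) - 1\<close>.\<close>
    define b where "b m = a m * (2 ^ d / 2 ^ m - 1)" for m
    have "\<bar>\<Sum>m<d. b m * s ^ m\<bar> \<le> (2 ^ d + 1) * M" if s: "s \<in> {0..1}" for s
    proof -
      have "(\<Sum>m<d. b m * s ^ m) = (\<Sum>m<Suc d. b m * s ^ m)"
        by (simp add: b_def)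
      also have "\<dots> = 2 ^ d * (\<Sum>m<Suc d. a m * (s / 2) ^ m) - (\<Sum>m<Suc d. a m * s ^ m)"
        unfolding b_def sum_distrib_left sum_subtractf[symmetric]
        by (intro sum.cong) (auto simp: field_simps)
      finally have "(\<Sum>m<d. b m * s ^ m) = 2 ^ d * (\<Sum>m<Suc d. a m * (s / 2) ^ m) - (\<Sum>m<Suc d. a m * s ^ m)" .
      moreover have "\<bar>2 ^ d * (\<Sum>m<Suc d. a m * (s / 2) ^ m)\<bar> \<le> 2 ^ d * M"
        using bspec[OF a, of "s / 2"] s unfolding abs_mult by (intro mult_mono) auto
      ultimately show ?thesis
        using bspec[OF a s] by (simp add: algebra_simps)
    qed
    then have "\<bar>b 1\<bar> \<le> C * ((2 ^ d + 1) * M)"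
      using C[of b "(2 ^ d + 1) * M"] by (simp add: d_def)
    moreover have "b 1 = a 1 * (2 * 2 ^ k - 1)"
      by (simp add: b_def d_def)
    moreover have "\<bar>a 1\<bar> * 1 \<le> \<bar>a 1\<bar> * \<bar>2 * 2 ^ k - 1\<bar>"
      using one_le_power[of "2::real" k] by (intro mult_left_mono) (simp_all only: abs_ge_zero, linarith)
    ultimately show ?thesis
      by (simp add: abs_mult mult_ac)
  qed
  then show ?case unfolding d_def by blast
qed

text \<open>A growth bound on \<open>f\<close> alone does not bound its derivative; the idea is to
  use many points near \<open>x\<close>. On the segment of length \<open>norm x\<close> starting at
  \<open>x\<close> in direction \<open>i\<close>, both \<open>f\<close> and its Taylor remainder are
  of order \<open>k + 1\<close> in \<open>norm x\<close>, hence so is the Taylor polynomial. Its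
  linear coefficient is then bounded by \<open>linear_coeff_bound\<close>, and one factor
  \<open>norm x\<close> is divided out. For \<open>k = 0\<close> that bound does not apply, but
  local boundedness suffices.\<close>

lemma vanish_pd1:
  assumes f: "smooth_fn f" and v: "vanish (Suc k) f"
  shows "vanish k (pd [i] f)"
proof (cases k)
  case 0
  then show ?thesis using vanish_smooth[OF smooth_fn_pd[OF f]] by blast
next
  case (Suc k')
  obtain C e where C: "C \<ge> 0" "e > 0" "\<And>x. norm x < e \<Longrightarrow> \<bar>f x\<bar> \<le> C * norm x ^ Suc k"
    using v by (rule vanishE) auto
  obtain B where B: "B \<ge> 0" "\<And>x. norm x \<le> 1 \<Longrightarrow> \<bar>pd (replicate (Suc k) i) f x\<bar> \<le> B"
    using smooth_fn_bounded[OF smooth_fn_pd[OF f]] by blast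
  obtain L where L: "\<And>(a::nat \<Rightarrow> real) M. (\<forall>s\<in>{0..1}. \<bar>\<Sum>m<Suc k. a m * s ^ m\<bar> \<le> M) \<Longrightarrow> \<bar>a 1\<bar> \<le> L * M"
    using linear_coeff_bound[of k'] unfolding Suc by blast
  have main: "\<bar>pd [i] f x\<bar> \<le> (L * (C * 2 ^ Suc k + B)) * norm x ^ k"
    if x: "norm x < min (e / 2) (1 / 2)" "x \<noteq> 0" for x
  proof -
    \<comment> \<open>With the parameter scaled by \<open>norm x\<close> the segment corresponds to
      the unit interval for every \<open>x\<close>, and \<open>a 1\<close> becomes
      \<open>pd [i] f x * norm x\<close>.\<close>
    define a where "a m = pd (replicate m i) f x / fact m * norm x ^ m" for m
    have "\<bar>\<Sum>m<Suc k. a m * s ^ m\<bar> \<le> (C * 2 ^ Suc k + B) * norm x ^ Suc k" if s: "s \<in> {0..1}" for s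
    proof -
      let ?t = "s * norm x"
      obtain u where u: "\<bar>u\<bar> \<le> \<bar>?t\<bar>" "f (x + ?t *\<^sub>R axis i 1) = (\<Sum>m<Suc k. pd (replicate m i) f x / fact m * ?t ^ m) +
          pd (replicate (Suc k) i) f (x + u *\<^sub>R axis i 1) / fact (Suc k) * ?t ^ Suc k"
        using line_taylor[OF f] by blast
      have t: "\<bar>?t\<bar> \<le> norm x" using s by (simp add: mult_left_le_one_le)
      have le: "norm (x + w *\<^sub>R axis i 1) \<le> 2 * norm x" if "\<bar>w\<bar> \<le> \<bar>?t\<bar>" for w
        using norm_triangle_ineq[of x "w *\<^sub>R axis i 1"] that t by (simp add: norm_axis_1)
      have "\<bar>f (x + ?t *\<^sub>R axis i 1)\<bar> \<le> C * norm (x + ?t *\<^sub>R axis i 1) ^ Suc k"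
        using le[of ?t] x by (intro C(3)) auto
      also have "\<dots> \<le> C * (2 * norm x) ^ Suc k"
        using le[of ?t] C(1) by (intro mult_left_mono power_mono) auto
      finally have 1: "\<bar>f (x + ?t *\<^sub>R axis i 1)\<bar> \<le> C * 2 ^ Suc k * norm x ^ Suc k"
        by (simp add: power_mult_distrib mult_ac)
      have "\<bar>pd (replicate (Suc k) i) f (x + u *\<^sub>R axis i 1)\<bar> \<le> B"
        using le[OF u(1)] x by (intro B(2)) auto
      then have "\<bar>pd (replicate (Suc k) i) f (x + u *\<^sub>R axis i 1)\<bar> / fact (Suc k) \<le> B / 1"
        using B(1) by (intro frac_le) (auto simp: fact_ge_1 simp del: fact_Suc)
      then have "\<bar>pd (replicate (Suc k) i) f (x + u *\<^sub>R axis i 1) / fact (Suc k) * ?t ^ Suc k\<bar> \<le> B * norm x ^ Suc k"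
        using B(1) t unfolding abs_mult power_abs by (intro mult_mono power_mono) (auto simp del: fact_Suc)
      moreover have "(\<Sum>m<Suc k. a m * s ^ m) = (\<Sum>m<Suc k. pd (replicate m i) f x / fact m * ?t ^ m)"
        unfolding a_def by (intro sum.cong) (auto simp: power_mult_distrib)
      ultimately show ?thesis
        using 1 u(2) by (simp only: distrib_right)
    qed
    then have "\<bar>a 1\<bar> \<le> L * ((C * 2 ^ Suc k + B) * norm x ^ Suc k)"
      using L by blast
    then have "\<bar>pd [i] f x\<bar> * norm x \<le> ((L * (C * 2 ^ Suc k + B)) * norm x ^ k) * norm x"
      by (simp add: a_def abs_mult mult_ac)
    then show ?thesis
      using x(2) by (simp add: mult_le_cancel_right)
  qed
  show ?thesis
  proof (rule vanish_punctured)
    show "isCont (pd [i] f) 0" by (intro smooth_fn_isCont smooth_fn_pd f)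
    have "0 < min (e / 2) (1 / 2)" using C by simp
    then show "\<forall>\<^sub>F x in at 0. norm (pd [i] f x) \<le> (L * (C * 2 ^ Suc k + B)) * norm x ^ k"
      unfolding eventually_at using main by (intro exI[of _ "min (e / 2) (1 / 2)"]) (auto simp: dist_norm)
  qed
qed

text \<open>The subtraction is truncated: after more than \<open>k\<close> derivatives only local
  boundedness is claimed.\<close>

lemma vanish_pd:
  assumes "smooth_fn f" "vanish k f" shows "vanish (k - length is) (pd is f)"
proof (induction "is")
  case (Cons i "is")
  show ?case
  proof (cases "k - length is")
    case 0
    then show ?thesis using vanish_smooth[OF smooth_fn_pd[OF assms(1)]] by simp
  next
    case (Suc n)
    then have "vanish n (pd [i] (pd is f))"
      using Cons by (intro vanish_pd1 smooth_fn_pd assms(1)) auto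
    moreover have "k - length (i # is) = n" using Suc by simp
    ultimately show ?thesis by (metis pd_Cons)
  qed
qed (use assms in simp)

text \<open>The bridge between jets and orders. The converse peels off the innermost derivative,
  which is the last list entry, so that the induction hypothesis applies to the first partials;
  \<open>vanish_from_partials\<close> then recovers the lost order.\<close>

lemma vanish_iff_pd:
  "smooth_fn f \<Longrightarrow> vanish (Suc r) f \<longleftrightarrow> (\<forall>is. length is \<le> r \<longrightarrow> pd is f 0 = 0)"
proof
  assume f: "smooth_fn f" and v: "vanish (Suc r) f"
  show "\<forall>is. length is \<le> r \<longrightarrow> pd is f 0 = 0"
    using vanish_pd[OF f v] by (metis Suc_diff_le vanish_0)
next
  show "smooth_fn f \<Longrightarrow> \<forall>is. length is \<le> r \<longrightarrow> pd is f 0 = 0 \<Longrightarrow> vanish (Suc r) f"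
  proof (induction r arbitrary: f)
    case 0
    then have "f 0 = 0" by (auto dest: spec[of _ "[]"])
    with 0 show ?case
      by (intro vanish_from_partials vanish_smooth smooth_fn_pd)
  next
    case (Suc r)
    then have "f 0 = 0" by (auto dest: spec[of _ "[]"])
    moreover have "vanish (Suc r) (pd [i] f)" for i
    proof (rule Suc.IH)
      show "\<forall>is. length is \<le> r \<longrightarrow> pd is (pd [i] f) 0 = 0"
        using Suc.prems(2) by (simp flip: pd_append)
    qed (intro smooth_fn_pd Suc.prems(1))
    ultimately show ?case
      by (rule vanish_from_partials[OF Suc.prems(1)])
  qed
qed

lemma jet_eq_iff_vanish:
  "smooth_fn f \<Longrightarrow> smooth_fn h \<Longrightarrow> jet_eq r f h \<longleftrightarrow> vanish (Suc r) (\<lambda>x. f x - h x)"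
  unfolding jet_eq_def by (simp add: vanish_iff_pd smooth_fn_diff pd_diff)


section \<open>Taylor expansion and Euler's identity\<close>

text \<open>Expand first in \<open>x$1\<close> from the foot of \<open>x\<close> on the second axis,
  then each coefficient \<open>u a\<close> in \<open>x$2\<close> from the origin. Since
  \<open>u a\<close> still vanishes to order \<open>m - a\<close>, its lower Taylor coefficients are
  zero, and a single monomial of total degree \<open>m\<close> survives for each
  \<open>a\<close>.\<close>

lemma homogeneous_part:
  assumes f: "smooth_fn f" and v: "vanish m f"
  shows "\<exists>c. vanish (Suc m) (\<lambda>x. f x - (\<Sum>a\<le>m. c a * (x$1 ^ a * x$2 ^ (m - a))))"
proof -
  define u where "u a = pd (replicate a 1) f" for a
  define c where "c a = pd (replicate (m - a) 2) (u a) 0 / (fact (m - a) * fact a)" for a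
  have u: "smooth_fn (u a)" for a unfolding u_def by (intro smooth_fn_pd f)
  have va: "vanish (Suc (m - a)) (\<lambda>x. u a (x$2 *\<^sub>R axis 2 1) - pd (replicate (m - a) 2) (u a) 0 / fact (m - a) * x$2 ^ (m - a))"
    for a
  proof -
    have "pd (replicate b 2) (u a) 0 = 0" if "b < m - a" for b
    proof -
      have "vanish (m - a) (u a)"
        using vanish_pd[OF f v, of "replicate a 1"] by (simp add: u_def)
      then have "vanish (Suc (m - a - 1)) (u a)" using that by (simp add: Suc_diff_Suc)
      then show ?thesis
        using vanish_iff_pd[OF u] that by simp
    qed
    then have "(\<Sum>b<Suc (m - a). pd (replicate b 2) (u a) 0 / fact b * x ^ b) =
        pd (replicate (m - a) 2) (u a) 0 / fact (m - a) * x ^ (m - a)" for x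
      by simp
    with vanish_line_taylor[OF u[of a] norm_axis_le[of _ _ 2], of "Suc (m - a)"]
    show ?thesis by simp
  qed
  have "vanish (Suc m) (\<lambda>x. \<Sum>a<Suc m.
      ((u a (x$2 *\<^sub>R axis 2 1) - pd (replicate (m - a) 2) (u a) 0 / fact (m - a) * x$2 ^ (m - a)) * (1 / fact a)) * x$1 ^ a)"
  proof (rule vanish_sum)
    fix a assume "a \<in> {..<Suc m}"
    then have eq: "Suc (m - a) + 0 + a * 1 = Suc m" by simp
    show "vanish (Suc m) (\<lambda>x. ((u a (x$2 *\<^sub>R axis 2 1) -
        pd (replicate (m - a) 2) (u a) 0 / fact (m - a) * x$2 ^ (m - a)) * (1 / fact a)) * x$1 ^ a)"
      using vanish_mult[OF vanish_mult[OF va[of a] vanish_const[of "1 / fact a"]] vanish_power[OF vanish_coord, of a 1]]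
      unfolding eq .
  qed
  moreover have "vanish (Suc m) (\<lambda>x. f (x$2 *\<^sub>R axis 2 1 + x $ 1 *\<^sub>R axis 1 1) -
      (\<Sum>a<Suc m. u a (x$2 *\<^sub>R axis 2 1) / fact a * (x $ 1) ^ a))"
    unfolding u_def by (intro vanish_line_taylor f norm_axis_sum_le)
  moreover have "f (x$2 *\<^sub>R axis 2 1 + x $ 1 *\<^sub>R axis 1 1) = f x" for x
    using vec2_decompose[of x] by (simp add: add.commute)
  ultimately have "vanish (Suc m) (\<lambda>x. (f x - (\<Sum>a<Suc m. u a (x$2 *\<^sub>R axis 2 1) / fact a * (x $ 1) ^ a)) +
     (\<Sum>a<Suc m. ((u a (x$2 *\<^sub>R axis 2 1) - pd (replicate (m - a) 2) (u a) 0 / fact (m - a) * x$2 ^ (m - a)) * (1 / fact a)) * x$1 ^ a))"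
    using vanish_add by fastforce
  moreover have "(f x - (\<Sum>a<Suc m. u a (x$2 *\<^sub>R axis 2 1) / fact a * (x $ 1) ^ a)) +
     (\<Sum>a<Suc m. ((u a (x$2 *\<^sub>R axis 2 1) - pd (replicate (m - a) 2) (u a) 0 / fact (m - a) * x$2 ^ (m - a)) * (1 / fact a)) * x$1 ^ a)
     = f x - (\<Sum>a\<le>m. c a * (x$1 ^ a * x$2 ^ (m - a)))" for x
  proof -
    have "(\<Sum>a<Suc m. ((u a (x$2 *\<^sub>R axis 2 1) - pd (replicate (m - a) 2) (u a) 0 / fact (m - a) * x$2 ^ (m - a)) * (1 / fact a)) * x$1 ^ a)
       = (\<Sum>a<Suc m. u a (x$2 *\<^sub>R axis 2 1) / fact a * (x $ 1) ^ a - c a * (x$1 ^ a * x$2 ^ (m - a)))"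
      by (intro sum.cong refl) (simp add: c_def field_simps)
    then show ?thesis
      unfolding sum_subtractf lessThan_Suc_atMost by simp
  qed
  ultimately show ?thesis
    by (intro exI[of _ c]) (simp only:)
qed

definition euler :: "(real^2 \<Rightarrow> real) \<Rightarrow> real^2 \<Rightarrow> real" where
  "euler f x = pd [1] f x * x$1 + pd [2] f x * x$2"

lemma euler_mult:
  "smooth_fn f \<Longrightarrow> smooth_fn g \<Longrightarrow> euler (\<lambda>x. f x * g x) x = f x * euler g x + euler f x * g x"
  by (simp add: euler_def pd1_mult algebra_simps)

lemma euler_add: "smooth_fn f \<Longrightarrow> smooth_fn g \<Longrightarrow> euler (\<lambda>x. f x + g x) x = euler f x + euler g x"
  by (simp add: euler_def pd1_add algebra_simps)

lemma euler_diff: "smooth_fn f \<Longrightarrow> smooth_fn g \<Longrightarrow> euler (\<lambda>x. f x - g x) x = euler f x - euler g x"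
  by (simp add: euler_def pd1_diff algebra_simps)

lemma euler_const: "euler (\<lambda>x. c) x = 0"
  by (simp add: euler_def pd1_const)

lemma euler_sum: "(\<And>i. i \<in> I \<Longrightarrow> smooth_fn (f i)) \<Longrightarrow> euler (\<lambda>x. \<Sum>i\<in>I. f i x) x = (\<Sum>i\<in>I. euler (f i) x)"
  by (induction I rule: infinite_finite_induct) (auto simp: euler_const euler_add smooth_fn_sum)

lemma euler_coord_power: "euler (\<lambda>x. x $ i ^ n) x = n * x $ i ^ n"
proof (induction n)
  case (Suc n)
  have "euler (\<lambda>x. x $ i) x = x $ i"
    using exhaust_2[of i] by (auto simp: euler_def pd1_coord)
  then show ?case
    by (simp add: Suc euler_mult smooth_fn_coord smooth_fn_power algebra_simps)
qed (simp add: euler_const)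

text \<open>Euler's identity is exact on the leading homogeneous part of degree \<open>m\<close>.
  The rest vanishes to order \<open>m + 1\<close>, and the Euler operator preserves that order:
  differentiation loses one, multiplication by a coordinate regains it.\<close>

lemma vanish_euler:
  assumes f: "smooth_fn f" and v: "vanish m f"
  shows "vanish (Suc m) (\<lambda>x. euler f x - m * f x)"
proof -
  obtain c where c: "vanish (Suc m) (\<lambda>x. f x - (\<Sum>a\<le>m. c a * (x$1 ^ a * x$2 ^ (m - a))))"
    using homogeneous_part[OF f v] by blast
  define p :: "real^2 \<Rightarrow> real" where "p x = (\<Sum>a\<le>m. c a * (x$1 ^ a * x$2 ^ (m - a)))" for x
  have p: "smooth_fn p" unfolding p_def by (intro smooth_intros)
  have mono: "smooth_fn (\<lambda>x. c a * (x$1 ^ a * x$2 ^ (m - a)))" for a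
    by (intro smooth_intros)
  have "euler p x = m * p x" for x
  proof -
    have "euler (\<lambda>x. c a * (x$1 ^ a * x$2 ^ (m - a))) x = m * (c a * (x$1 ^ a * x$2 ^ (m - a)))" if "a \<le> m" for a
    proof -
      have "euler (\<lambda>x. c a * (x$1 ^ a * x$2 ^ (m - a))) x =
          (real a + real (m - a)) * (c a * (x$1 ^ a * x$2 ^ (m - a)))"
        by (simp add: euler_mult smooth_fn_const smooth_fn_power smooth_fn_mult smooth_fn_coord
            euler_const euler_coord_power algebra_simps del: of_nat_diff)
      also have "real a + real (m - a) = real m" using that by simp
      finally show ?thesis .
    qed
    then have "(\<Sum>a\<le>m. euler (\<lambda>x. c a * (x$1 ^ a * x$2 ^ (m - a))) x) = (\<Sum>a\<le>m. m * (c a * (x$1 ^ a * x$2 ^ (m - a))))"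
      by (intro sum.cong) auto
    then show ?thesis
      unfolding p_def[abs_def] by (simp only: euler_sum mono sum_distrib_left)
  qed
  moreover have "vanish (Suc m) (\<lambda>x. euler (\<lambda>x. f x - p x) x - m * (f x - p x))"
  proof (rule vanish_diff)
    have d: "smooth_fn (\<lambda>x. f x - p x)" "vanish (Suc m) (\<lambda>x. f x - p x)"
      using c by (simp_all only: p_def[symmetric] smooth_fn_diff f p)
    then show "vanish (Suc m) (\<lambda>x. m * (f x - p x))"
      using vanish_mult[OF vanish_const d(2)] by simp
    show "vanish (Suc m) (\<lambda>x. euler (\<lambda>x. f x - p x) x)"
      unfolding euler_def
      using vanish_mult[OF vanish_pd1[OF d] vanish_coord] by (intro vanish_add) auto
  qed
  ultimately show ?thesis
    by (simp add: euler_diff f p algebra_simps)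
qed


section \<open>Smooth maps, matrix fields and pullbacks\<close>

definition smooth_map :: "(real^2 \<Rightarrow> real^2) \<Rightarrow> bool" where
  "smooth_map \<tau> \<longleftrightarrow> (\<forall>k. smooth_fn (\<lambda>x. \<tau> x $ k))"

definition smooth_mat :: "(real^2 \<Rightarrow> real^2^2) \<Rightarrow> bool" where
  "smooth_mat G \<longleftrightarrow> (\<forall>i j. smooth_fn (\<lambda>x. G x $ i $ j))"

definition grad :: "(real^2 \<Rightarrow> real) \<Rightarrow> real^2 \<Rightarrow> real^2" where
  "grad f x = (\<chi> i. pd [i] f x)"

lemma matrix_vector_mult_nth: "((A::real^2^2) *v x) $ i = A$i$1 * x$1 + A$i$2 * x$2"
  by (simp add: matrix_vector_mult_def sum_2)

lemma matrix_matrix_mult_nth: "((A::real^2^2) ** (B::real^2^2)) $ i $ j = A$i$1 * B$1$j + A$i$2 * B$2$j"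
  by (simp add: matrix_matrix_mult_def sum_2)

lemma transpose_nth: "transpose A $ i $ j = A $ j $ i"
  by (simp add: transpose_def)

lemma mat_1_nth: "(mat 1 :: real^2^2) $ i $ j = (if i = j then 1 else 0)"
  by (simp add: mat_def)

lemma inner_2: "(x::real^2) \<bullet> y = x$1 * y$1 + x$2 * y$2"
  by (simp add: inner_vec_def sum_2)

lemmas mat2_simps = matrix_vector_mult_nth matrix_matrix_mult_nth transpose_nth mat_1_nth inner_2

lemma smooth_map_id: "smooth_map (\<lambda>x. x)"
  by (simp add: smooth_map_def smooth_fn_coord)

lemma smooth_map_add: "smooth_map f \<Longrightarrow> smooth_map g \<Longrightarrow> smooth_map (\<lambda>x. f x + g x)"
  and smooth_map_diff: "smooth_map f \<Longrightarrow> smooth_map g \<Longrightarrow> smooth_map (\<lambda>x. f x - g x)"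
  and smooth_map_scaleR: "smooth_map f \<Longrightarrow> smooth_map (\<lambda>x. c *\<^sub>R f x)"
  by (auto simp: smooth_map_def intro: smooth_intros)

lemma smooth_map_comp: "smooth_map f \<Longrightarrow> smooth_map g \<Longrightarrow> smooth_map (\<lambda>x. f (g x))"
  unfolding smooth_map_def using smooth_fn_comp[of _ g] by blast

lemma smooth_map_grad: "smooth_fn f \<Longrightarrow> smooth_map (grad f)"
  by (auto simp: smooth_map_def grad_def intro: smooth_intros)

lemma smooth_fn_inner: "smooth_map f \<Longrightarrow> smooth_map g \<Longrightarrow> smooth_fn (\<lambda>x. f x \<bullet> g x)"
  unfolding smooth_map_def inner_2 by (intro smooth_intros) auto

lemma smooth_mat_const: "smooth_mat (\<lambda>x. A)"
  by (auto simp: smooth_mat_def intro: smooth_intros)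

lemma smooth_mat_diff: "smooth_mat F \<Longrightarrow> smooth_mat G \<Longrightarrow> smooth_mat (\<lambda>x. F x - G x)"
  by (auto simp: smooth_mat_def intro: smooth_intros)

lemma smooth_mat_mult: "smooth_mat F \<Longrightarrow> smooth_mat G \<Longrightarrow> smooth_mat (\<lambda>x. F x ** G x)"
  unfolding smooth_mat_def matrix_matrix_mult_nth by (intro allI smooth_intros) auto

lemma smooth_mat_transpose: "smooth_mat F \<Longrightarrow> smooth_mat (\<lambda>x. transpose (F x))"
  unfolding smooth_mat_def transpose_nth by auto

lemma smooth_mat_comp: "smooth_mat F \<Longrightarrow> smooth_map g \<Longrightarrow> smooth_mat (\<lambda>x. F (g x))"
  unfolding smooth_mat_def smooth_map_def using smooth_fn_comp[of _ g] by blast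

lemma smooth_map_mat: "smooth_mat F \<Longrightarrow> smooth_map g \<Longrightarrow> smooth_map (\<lambda>x. F x *v g x)"
  unfolding smooth_mat_def smooth_map_def matrix_vector_mult_nth by (intro allI smooth_intros) auto

lemma smooth_map_linear: "smooth_map (\<lambda>x. A *v x)"
  by (intro smooth_map_mat smooth_mat_const smooth_map_id)

lemma smooth_mat_jac: "smooth_map \<tau> \<Longrightarrow> smooth_mat (jac \<tau>)"
  by (auto simp: smooth_mat_def jac_def smooth_map_def intro: smooth_intros)

lemma smooth_mat_pullback: "smooth_map \<tau> \<Longrightarrow> smooth_mat G \<Longrightarrow> smooth_mat (pullback \<tau> G)"
  unfolding pullback_def[abs_def]
  by (intro smooth_mat_mult smooth_mat_transpose smooth_mat_jac smooth_mat_comp[of G \<tau>])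

lemma jac_nth: "jac \<tau> x $ k $ i = pd [i] (\<lambda>y. \<tau> y $ k) x"
  by (simp add: jac_def)

lemma smooth_map_has_derivative:
  assumes "smooth_map \<tau>" shows "(\<tau> has_derivative (\<lambda>h. jac \<tau> x *v h)) (at x)"
  unfolding has_derivative_componentwise_within[of \<tau>]
  using assms smooth_fn_has_derivative
  by (auto simp: Basis_vec_def inner_axis matrix_vector_mult_nth jac_nth smooth_map_def)

lemma jac_eq_derivative:
  assumes "smooth_map \<tau>" "(\<tau> has_derivative (\<lambda>h. A *v h)) (at x)" shows "jac \<tau> x = A"
  using has_derivative_unique[OF smooth_map_has_derivative[OF assms(1)] assms(2)]
  by (simp add: matrix_eq fun_eq_iff)

lemma jac_comp:
  assumes "smooth_map \<tau>" "smooth_map \<sigma>" shows "jac (\<lambda>x. \<tau> (\<sigma> x)) x = jac \<tau> (\<sigma> x) ** jac \<sigma> x"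
proof (rule jac_eq_derivative[OF smooth_map_comp[OF assms]])
  show "((\<lambda>x. \<tau> (\<sigma> x)) has_derivative (\<lambda>h. jac \<tau> (\<sigma> x) ** jac \<sigma> x *v h)) (at x)"
    using diff_chain_at[OF smooth_map_has_derivative[OF assms(2)] smooth_map_has_derivative[OF assms(1)]]
    by (simp add: o_def matrix_vector_mul_assoc)
qed

lemma jac_linear: "jac (\<lambda>x. A *v x) x = A"
  by (rule jac_eq_derivative[OF smooth_map_linear]) (simp add: linear_imp_has_derivative)

lemma jac_id: "jac (\<lambda>x. x) x = mat 1"
  using jac_linear[of "mat 1"] by simp

lemma jac_add: "smooth_map \<tau> \<Longrightarrow> smooth_map \<sigma> \<Longrightarrow> jac (\<lambda>x. \<tau> x + \<sigma> x) x = jac \<tau> x + jac \<sigma> x"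
  and jac_diff: "smooth_map \<tau> \<Longrightarrow> smooth_map \<sigma> \<Longrightarrow> jac (\<lambda>x. \<tau> x - \<sigma> x) x = jac \<tau> x - jac \<sigma> x"
  by (simp_all add: vec_eq_iff jac_nth smooth_map_def pd1_add pd1_diff)

lemma jac_mat: "smooth_map \<tau> \<Longrightarrow> jac (\<lambda>x. A *v \<tau> x) x = A ** jac \<tau> x"
  using jac_comp[OF smooth_map_linear] jac_linear by simp

lemma pullback_comp:
  "smooth_map \<tau> \<Longrightarrow> smooth_map \<sigma> \<Longrightarrow> pullback (\<lambda>x. \<tau> (\<sigma> x)) G x = pullback \<sigma> (pullback \<tau> G) x"
  by (simp add: pullback_def jac_comp matrix_transpose_mul matrix_mul_assoc)

lemma pullback_symmetric: "(\<And>x. transpose (G x) = G x) \<Longrightarrow> transpose (pullback \<tau> G x) = pullback \<tau> G x"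
  by (simp add: pullback_def matrix_transpose_mul matrix_mul_assoc)

lemma bounded_bilinear_matrix_vector_mult: "bounded_bilinear ((*v) :: real^2^2 \<Rightarrow> real^2 \<Rightarrow> real^2)"
  unfolding bilinear_conv_bounded_bilinear[symmetric] bilinear_def
  by (auto intro!: linearI simp: vec_eq_iff mat2_simps algebra_simps)

lemma bounded_bilinear_matrix_matrix_mult: "bounded_bilinear ((**) :: real^2^2 \<Rightarrow> real^2^2 \<Rightarrow> real^2^2)"
  unfolding bilinear_conv_bounded_bilinear[symmetric] bilinear_def
  by (auto intro!: linearI simp: vec_eq_iff mat2_simps algebra_simps)

lemma bounded_linear_transpose: "bounded_linear (transpose :: real^2^2 \<Rightarrow> real^2^2)"
  unfolding linear_conv_bounded_linear[symmetric]
  by (auto intro!: linearI simp: vec_eq_iff mat2_simps)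

lemmas vanish_matvec = vanish_bilinear[OF bounded_bilinear_matrix_vector_mult]
lemmas vanish_matmul = vanish_bilinear[OF bounded_bilinear_matrix_matrix_mult]
lemmas vanish_transpose = vanish_linear[OF bounded_linear_transpose]
lemmas vanish_inner = vanish_bilinear[OF bounded_bilinear_inner]

lemma vanish_mat_iff: "vanish k G \<longleftrightarrow> (\<forall>i j. vanish k (\<lambda>x. G x $ i $ j))"
  for G :: "real^2 \<Rightarrow> real^2^2"
  by (simp add: vanish_component_iff[of k G] vanish_component_iff[of k "\<lambda>x. G x $ _"])

lemma vanish_smooth_mat: "smooth_mat G \<Longrightarrow> vanish 0 G"
  by (simp add: vanish_mat_iff smooth_mat_def vanish_smooth)

lemma vanish_jac: "smooth_map \<tau> \<Longrightarrow> vanish (Suc k) \<tau> \<Longrightarrow> vanish k (jac \<tau>)"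
  by (simp add: vanish_mat_iff vanish_component_iff[of _ \<tau>] smooth_map_def jac_nth vanish_pd1)

lemma vanish_grad: "smooth_fn f \<Longrightarrow> vanish (Suc k) f \<Longrightarrow> vanish k (grad f)"
  by (simp add: vanish_component_iff grad_def vanish_pd1)

lemma vanish_from_jac:
  "smooth_map \<tau> \<Longrightarrow> \<tau> 0 = 0 \<Longrightarrow> vanish k (jac \<tau>) \<Longrightarrow> vanish (Suc k) \<tau>"
  by (auto simp: vanish_mat_iff vanish_component_iff[of _ \<tau>] smooth_map_def jac_nth intro: vanish_from_partials)

lemma vanish_1_map: "smooth_map \<tau> \<Longrightarrow> \<tau> 0 = 0 \<Longrightarrow> vanish 1 \<tau>"
  using vanish_from_jac[of \<tau> 0] vanish_smooth_mat[OF smooth_mat_jac] by simp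

lemma vanish_1_mat: "smooth_mat G \<Longrightarrow> G 0 = 0 \<Longrightarrow> vanish 1 G"
  using vanish_from_partials[where k = 0] vanish_smooth[OF smooth_fn_pd]
  by (auto simp: vanish_mat_iff smooth_mat_def)

section \<open>How pullbacks depend on the map and on the metric\<close>

lemma smooth_fn_lipschitz:
  assumes f: "smooth_fn f"
  obtains L where "\<And>x y. norm x \<le> 1 \<Longrightarrow> norm y \<le> 1 \<Longrightarrow> \<bar>f x - f y\<bar> \<le> L * norm (x - y)"
proof -
  obtain B where B: "B \<ge> 0" "\<And>x. norm x \<le> 1 \<Longrightarrow> \<bar>pd [1] f x\<bar> \<le> B"
    using smooth_fn_bounded[OF smooth_fn_pd[OF f]] by blast
  obtain D where D: "D \<ge> 0" "\<And>x. norm x \<le> 1 \<Longrightarrow> \<bar>pd [2] f x\<bar> \<le> D"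
    using smooth_fn_bounded[OF smooth_fn_pd[OF f]] by blast
  have "norm (f x - f y) \<le> (B + D) * norm (x - y)" if "norm x \<le> 1" "norm y \<le> 1" for x y
  proof (rule differentiable_bound[of "cball 0 1" f "\<lambda>z h. pd [1] f z * h$1 + pd [2] f z * h$2"])
    show "(f has_derivative (\<lambda>h. pd [1] f z * h$1 + pd [2] f z * h$2)) (at z within cball 0 1)" for z
      by (rule has_derivative_at_withinI[OF smooth_fn_has_derivative[OF f]])
    fix z :: "real^2" assume z: "z \<in> cball 0 1"
    show "onorm (\<lambda>h::real^2. pd [1] f z * h$1 + pd [2] f z * h$2) \<le> B + D"
    proof (rule onorm_le)
      fix h :: "real^2"
      have "\<bar>pd [1] f z * h$1\<bar> \<le> B * norm h" "\<bar>pd [2] f z * h$2\<bar> \<le> D * norm h"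
        using B D z unfolding abs_mult by (auto intro!: mult_mono component_le_norm_cart)
      then show "norm (pd [1] f z * h$1 + pd [2] f z * h$2) \<le> (B + D) * norm h"
        by (simp add: distrib_right)
    qed
  qed (use that in auto)
  then show ?thesis using that by auto
qed

lemma vanish_fn_lipschitz:
  assumes f: "smooth_fn f" and v: "vanish 1 \<sigma>" "vanish 1 \<tau>" "vanish k (\<lambda>x. \<sigma> x - \<tau> x)"
  shows "vanish k (\<lambda>x. f (\<sigma> x) - f (\<tau> x))"
proof -
  obtain L where L: "\<And>x y. norm x \<le> 1 \<Longrightarrow> norm y \<le> 1 \<Longrightarrow> \<bar>f x - f y\<bar> \<le> L * norm (x - y)"
    using smooth_fn_lipschitz[OF f] by blast
  \<comment> \<open>The Lipschitz constant is only valid on the unit ball, so both maps must first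
    be confined to it.\<close>
  have small: "\<exists>d>0. \<forall>x. norm x < d \<longrightarrow> norm (\<rho> x) \<le> 1" if \<rho>: "vanish 1 \<rho>" for \<rho> :: "real^2 \<Rightarrow> real^2"
  proof -
    obtain C e where C: "C \<ge> 0" "e > 0" "\<And>x. norm x < e \<Longrightarrow> norm (\<rho> x) \<le> C * norm x"
      using \<rho> by (rule vanishE) auto
    have "norm (\<rho> x) \<le> 1" if x: "norm x < min e (1 / (C + 1))" for x
    proof -
      have "norm x * (C + 1) < 1" using x C(1) by (simp add: less_divide_eq)
      moreover have "norm x * (C + 1) = C * norm x + norm x" by (simp add: algebra_simps)
      ultimately have "C * norm x \<le> 1" using norm_ge_zero[of x] by linarith
      then show ?thesis using C(3)[of x] x by simp
    qed
    moreover have "min e (1 / (C + 1)) > 0" using C by simp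
    ultimately show ?thesis by blast
  qed
  obtain d1 where d1: "d1 > 0" "\<And>x. norm x < d1 \<Longrightarrow> norm (\<sigma> x) \<le> 1" using small[OF v(1)] by blast
  obtain d2 where d2: "d2 > 0" "\<And>x. norm x < d2 \<Longrightarrow> norm (\<tau> x) \<le> 1" using small[OF v(2)] by blast
  obtain C e where C: "C \<ge> 0" "e > 0" "\<And>x. norm x < e \<Longrightarrow> norm (\<sigma> x - \<tau> x) \<le> C * norm x ^ k"
    using v(3) by (rule vanishE) blast
  show ?thesis
  proof (rule vanishI[of "min e (min d1 d2)"])
    fix x :: "real^2" assume x: "norm x < min e (min d1 d2)"
    have "\<bar>f (\<sigma> x) - f (\<tau> x)\<bar> \<le> L * norm (\<sigma> x - \<tau> x)"
      using L d1 d2 x by simp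
    also have "\<dots> \<le> \<bar>L\<bar> * norm (\<sigma> x - \<tau> x)"
      by (intro mult_right_mono) auto
    also have "\<dots> \<le> \<bar>L\<bar> * (C * norm x ^ k)"
      using C x by (intro mult_left_mono) auto
    finally show "norm (f (\<sigma> x) - f (\<tau> x)) \<le> (\<bar>L\<bar> * C) * norm x ^ k"
      by (simp add: mult_ac)
  qed (use C d1 d2 in auto)
qed

lemma vanish_mat_lipschitz:
  "smooth_mat G \<Longrightarrow> vanish 1 \<sigma> \<Longrightarrow> vanish 1 \<tau> \<Longrightarrow> vanish k (\<lambda>x. \<sigma> x - \<tau> x) \<Longrightarrow>
   vanish k (\<lambda>x. G (\<sigma> x) - G (\<tau> x))"
  by (auto simp: vanish_mat_iff smooth_mat_def intro!: vanish_fn_lipschitz[of "\<lambda>y. G y $ _ $ _"])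

lemma vanish_pullback_diff:
  assumes "smooth_map \<sigma>" "\<sigma> 0 = 0" "vanish k (\<lambda>x. F x - G x)"
  shows "vanish k (\<lambda>x. pullback \<sigma> F x - pullback \<sigma> G x)"
proof -
  have "pullback \<sigma> F x - pullback \<sigma> G x = transpose (jac \<sigma> x) ** (F (\<sigma> x) - G (\<sigma> x)) ** jac \<sigma> x" for x
    by (simp add: pullback_def vec_eq_iff mat2_simps algebra_simps)
  moreover have "vanish (0 + k + 0) (\<lambda>x. transpose (jac \<sigma> x) ** (F (\<sigma> x) - G (\<sigma> x)) ** jac \<sigma> x)"
    by (intro vanish_matmul vanish_transpose vanish_smooth_mat smooth_mat_jac assms
        vanish_compose[OF assms(3)] vanish_1_map)
  ultimately show ?thesis by simp
qed

text \<open>One order is lost because the pullback contains the Jacobian. The difference of the two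
  triple products telescopes, exchanging one factor at a time.\<close>

lemma vanish_pullback_close:
  assumes "smooth_map \<sigma>" "smooth_map \<tau>" "\<sigma> 0 = 0" "\<tau> 0 = 0" "smooth_mat G"
    and v: "vanish (Suc k) (\<lambda>x. \<sigma> x - \<tau> x)"
  shows "vanish k (\<lambda>x. pullback \<sigma> G x - pullback \<tau> G x)"
proof -
  have vj: "vanish k (\<lambda>x. jac \<sigma> x - jac \<tau> x)"
    using vanish_jac[OF smooth_map_diff[OF assms(1,2)] v] by (subst jac_diff[symmetric]) (auto simp: assms)
  have vG: "vanish k (\<lambda>x. G (\<sigma> x) - G (\<tau> x))"
    using v by (intro vanish_mat_lipschitz vanish_1_map assms) (rule vanish_mono, auto)
  have sj: "vanish 0 (jac \<sigma>)" "vanish 0 (jac \<tau>)" "vanish 0 (\<lambda>x. G (\<sigma> x))" "vanish 0 (\<lambda>x. G (\<tau> x))"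
    by (intro vanish_smooth_mat smooth_mat_jac smooth_mat_comp[OF assms(5,1)] smooth_mat_comp[OF assms(5,2)] assms)+
  have "vanish (k + 0 + 0) (\<lambda>x. transpose (jac \<sigma> x - jac \<tau> x) ** G (\<sigma> x) ** jac \<sigma> x)"
    by (intro vanish_matmul vanish_transpose vj sj)
  moreover have "vanish (0 + k + 0) (\<lambda>x. transpose (jac \<tau> x) ** (G (\<sigma> x) - G (\<tau> x)) ** jac \<sigma> x)"
    by (intro vanish_matmul vanish_transpose vG sj)
  moreover have "vanish (0 + 0 + k) (\<lambda>x. transpose (jac \<tau> x) ** G (\<tau> x) ** (jac \<sigma> x - jac \<tau> x))"
    by (intro vanish_matmul vanish_transpose vj sj)
  ultimately have "vanish k (\<lambda>x. transpose (jac \<sigma> x - jac \<tau> x) ** G (\<sigma> x) ** jac \<sigma> x +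
     transpose (jac \<tau> x) ** (G (\<sigma> x) - G (\<tau> x)) ** jac \<sigma> x +
     transpose (jac \<tau> x) ** G (\<tau> x) ** (jac \<sigma> x - jac \<tau> x))"
    by (simp add: vanish_add)
  moreover have "transpose (jac \<sigma> x - jac \<tau> x) ** G (\<sigma> x) ** jac \<sigma> x +
     transpose (jac \<tau> x) ** (G (\<sigma> x) - G (\<tau> x)) ** jac \<sigma> x +
     transpose (jac \<tau> x) ** G (\<tau> x) ** (jac \<sigma> x - jac \<tau> x) = pullback \<sigma> G x - pullback \<tau> G x" for x
    by (simp add: pullback_def vec_eq_iff mat2_simps algebra_simps)
  ultimately show ?thesis by simp
qed

text \<open>Linearisation of the pullback around the linear map \<open>A\<close>. In the terms
  linear in \<open>jac \<xi>\<close> the metric may be replaced by its value \<open>mat 1\<close> at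
  the origin, since the error has one order more; in the main term, moving the base point by
  \<open>\<xi>\<close> costs order \<open>k + 1\<close>.\<close>

lemma vanish_pullback_expand:
  assumes \<xi>: "smooth_map \<xi>" "vanish (Suc k) \<xi>" and k: "k \<ge> 1" and G: "smooth_mat G" "G 0 = mat 1"
  shows "vanish (Suc k) (\<lambda>x. pullback (\<lambda>x. A *v x + \<xi> x) G x -
     (transpose A ** G (A *v x) ** A + transpose A ** jac \<xi> x + transpose (jac \<xi> x) ** A))"
proof -
  let ?\<tau> = "\<lambda>x. A *v x + \<xi> x"
  have \<tau>: "smooth_map ?\<tau>" by (intro smooth_map_add smooth_map_linear \<xi>)
  have \<tau>0: "?\<tau> 0 = 0" using vanish_0[OF \<xi>(2)] by simp
  have D: "vanish k (jac \<xi>)" by (intro vanish_jac \<xi>)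
  have I: "vanish 1 (\<lambda>x. G (?\<tau> x) - mat 1)"
    by (intro vanish_1_mat smooth_mat_diff smooth_mat_const smooth_mat_comp[OF G(1) \<tau>]) (simp add: vanish_0[OF \<xi>(2)] G)
  have L: "vanish (Suc k) (\<lambda>x. G (?\<tau> x) - G (A *v x))"
    by (intro vanish_mat_lipschitz G vanish_1_map \<tau> \<tau>0 smooth_map_linear) (use \<xi> in auto)
  have c: "vanish 0 (\<lambda>x. B)" for B :: "real^2^2" by (rule vanish_const)
  have "vanish (0 + Suc k + 0) (\<lambda>x. transpose A ** (G (?\<tau> x) - G (A *v x)) ** A)"
    by (intro vanish_matmul L c)
  moreover have "vanish (0 + 1 + k) (\<lambda>x. transpose A ** (G (?\<tau> x) - mat 1) ** jac \<xi> x)"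
    by (intro vanish_matmul I D c)
  moreover have "vanish (k + 1 + 0) (\<lambda>x. transpose (jac \<xi> x) ** (G (?\<tau> x) - mat 1) ** A)"
    by (intro vanish_matmul I vanish_transpose D c)
  \<comment> \<open>The quadratic term has order \<open>2 * k\<close>, which is at least
    \<open>k + 1\<close> exactly because \<open>k \<ge> 1\<close>.\<close>
  moreover have "vanish (Suc k) (\<lambda>x. transpose (jac \<xi> x) ** G (?\<tau> x) ** jac \<xi> x)"
    by (rule vanish_mono[of "k + 0 + k"])
      (use k in \<open>auto intro!: vanish_matmul[of "k + 0", simplified] vanish_matmul[of k _ 0, simplified]
        vanish_transpose D vanish_smooth_mat smooth_mat_comp[OF G(1) \<tau>]\<close>)
  ultimately have "vanish (Suc k) (\<lambda>x. transpose A ** (G (?\<tau> x) - G (A *v x)) ** A +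
     transpose A ** (G (?\<tau> x) - mat 1) ** jac \<xi> x + transpose (jac \<xi> x) ** (G (?\<tau> x) - mat 1) ** A +
     transpose (jac \<xi> x) ** G (?\<tau> x) ** jac \<xi> x)"
    by (simp add: vanish_add)
  moreover have "jac ?\<tau> x = A + jac \<xi> x" for x
    by (simp add: jac_add jac_linear smooth_map_linear \<xi>)
  then have "transpose A ** (G (?\<tau> x) - G (A *v x)) ** A +
     transpose A ** (G (?\<tau> x) - mat 1) ** jac \<xi> x + transpose (jac \<xi> x) ** (G (?\<tau> x) - mat 1) ** A +
     transpose (jac \<xi> x) ** G (?\<tau> x) ** jac \<xi> x = pullback ?\<tau> G x -
     (transpose A ** G (A *v x) ** A + transpose A ** jac \<xi> x + transpose (jac \<xi> x) ** A)" for x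
    by (simp add: pullback_def vec_eq_iff mat2_simps algebra_simps)
  ultimately show ?thesis by simp
qed


section \<open>Normal coordinates\<close>

declare transpose_matrix_vector [simp del]

lemma grad_inner_euler: "grad f x \<bullet> x = euler f x"
  by (simp add: grad_def euler_def inner_2)

lemma pd1_inner_id:
  assumes "smooth_map \<xi>"
  shows "pd [i] (\<lambda>x. \<xi> x \<bullet> x) x = \<xi> x $ i + (transpose (jac \<xi> x) *v x) $ i"
proof -
  have "smooth_fn (\<lambda>x. \<xi> x $ k)" for k using assms by (simp add: smooth_map_def)
  then show ?thesis
    using exhaust_2[of i]
    by (auto simp: inner_2 pd1_add pd1_mult pd1_coord smooth_fn_mult smooth_fn_coord mat2_simps jac_nth
        algebra_simps)
qed

text \<open>The left operator is the first variation of the flat metric along \<open>\<xi>\<close>,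
  evaluated on the radial vector. The product rule gives \<open>transpose (jac \<xi> x) *v x\<close>
  as the gradient of \<open>\<xi> x \<bullet> x\<close> minus \<open>\<xi> x\<close>, and by Euler
  \<open>jac \<xi> x *v x\<close> is \<open>k + 1\<close> times \<open>\<xi> x\<close> up to higher
  order.\<close>

lemma vanish_killing:
  assumes "smooth_map \<xi>" "vanish (Suc k) \<xi>"
  shows "vanish (k + 2) (\<lambda>x. (jac \<xi> x + transpose (jac \<xi> x)) *v x - (real k *\<^sub>R \<xi> x + grad (\<lambda>x. \<xi> x \<bullet> x) x))"
proof -
  have "((jac \<xi> x + transpose (jac \<xi> x)) *v x - (real k *\<^sub>R \<xi> x + grad (\<lambda>x. \<xi> x \<bullet> x) x)) $ i =
      euler (\<lambda>x. \<xi> x $ i) x - Suc k * \<xi> x $ i" for x i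
    by (simp add: matrix_vector_mult_add_rdistrib grad_def pd1_inner_id assms)
       (simp add: euler_def mat2_simps jac_nth algebra_simps)
  moreover have "vanish (Suc (Suc k)) (\<lambda>x. euler (\<lambda>x. \<xi> x $ i) x - Suc k * \<xi> x $ i)" for i
    using assms by (intro vanish_euler) (auto simp: smooth_map_def vanish_component_iff)
  ultimately show ?thesis
    unfolding vanish_component_iff[of "k + 2"] by simp
qed

lemma vanish_scaleR_cancel:
  assumes "vanish k (\<lambda>x. c *\<^sub>R f x)" "c \<noteq> 0" shows "vanish k f"
  using vanish_linear[OF bounded_linear_scaleR_right[of "1 / c"] assms(1)] assms(2) by simp

text \<open>By \<open>vanish_killing\<close>, \<open>k\<close> times \<open>\<zeta>\<close> plus
  \<open>grad s\<close> vanishes to order \<open>k + 2\<close>. Pairing with \<open>x\<close> and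
  using Euler for \<open>s\<close>, of order \<open>k + 2\<close>, turns this into
  \<open>(2 * k + 2) * s\<close>, so \<open>s\<close> gains an order, then its gradient, then
  \<open>\<zeta>\<close>. For \<open>k = 0\<close> linear skew fields, the infinitesimal rotations,
  are in the kernel.\<close>

lemma killing_injective:
  assumes \<zeta>: "smooth_map \<zeta>" "vanish (Suc k) \<zeta>" and k: "k \<ge> 1"
    and v: "vanish (k + 2) (\<lambda>x. (jac \<zeta> x + transpose (jac \<zeta> x)) *v x)"
  shows "vanish (k + 2) \<zeta>"
proof -
  define s where "s x = \<zeta> x \<bullet> x" for x
  have s: "smooth_fn s" unfolding s_def by (intro smooth_fn_inner \<zeta> smooth_map_id)
  have "vanish (Suc k + 1) s" unfolding s_def by (intro vanish_inner \<zeta> vanish_id)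
  then have s': "vanish (k + 2) s" by simp
  have 1: "vanish (k + 2) (\<lambda>x. real k *\<^sub>R \<zeta> x + grad s x)"
    using vanish_diff[OF v vanish_killing[OF \<zeta>]] by (simp add: s_def[abs_def])
  have "vanish (k + 2 + 1) (\<lambda>x. (real k *\<^sub>R \<zeta> x + grad s x) \<bullet> x)"
    by (intro vanish_inner 1 vanish_id)
  then have "vanish (Suc (k + 2)) (\<lambda>x. k * s x + euler s x)"
    by (simp add: inner_add_left grad_inner_euler s_def[symmetric])
  from vanish_diff[OF this vanish_euler[OF s s']]
  have "vanish (Suc (k + 2)) (\<lambda>x. (2 * k + 2) *\<^sub>R s x)"
    by (simp add: algebra_simps)
  then have "vanish (Suc (k + 2)) s"
    by (rule vanish_scaleR_cancel) simp
  then have "vanish (k + 2) (grad s)" by (intro vanish_grad s)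
  from vanish_diff[OF 1 this] show ?thesis
    using k by (auto intro: vanish_scaleR_cancel[of _ "real k"])
qed

lemma normal_step:
  assumes G: "smooth_mat G" "G 0 = mat 1" and k: "k \<ge> 1" and v: "vanish (Suc k) (\<lambda>x. G x *v x - x)"
  obtains \<xi> where "smooth_map \<xi>" "vanish (Suc k) \<xi>" "vanish (k + 2) (\<lambda>x. pullback (\<lambda>x. x + \<xi> x) G x *v x - x)"
proof -
  define w where "w x = G x *v x - x" for x
  \<comment> \<open>The equation to solve to leading order is \<open>k\<close> times
    \<open>\<xi>\<close> plus the gradient of \<open>\<xi> x \<bullet> x\<close> equal to
    \<open>- w\<close>. Pairing it with \<open>x\<close> and using Euler forces
    \<open>\<xi> x \<bullet> x\<close> to be this \<open>s\<close>; the equation then gives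
    \<open>\<xi>\<close>.\<close>
  define s where "s x = w x \<bullet> x / (- (2 * k + 2))" for x
  define \<xi> where "\<xi> x = (- 1 / k) *\<^sub>R (w x + grad s x)" for x
  have w: "smooth_map w" unfolding w_def by (intro smooth_map_diff smooth_map_mat smooth_map_id G)
  have vw: "vanish (Suc k) w" unfolding w_def by (rule v)
  have s: "smooth_fn s" unfolding s_def by (intro smooth_fn_divide smooth_fn_inner w smooth_map_id)
  have "vanish (Suc k + 1) (\<lambda>x. w x \<bullet> x)" by (intro vanish_inner vw vanish_id)
  then have vs: "vanish (Suc (Suc k)) s"
    using vanish_mult[OF _ vanish_const, of "Suc k + 1" "\<lambda>x. w x \<bullet> x" "1 / (- (2 * k + 2))"]
    by (simp add: s_def[abs_def])
  have \<xi>: "smooth_map \<xi>" unfolding \<xi>_def by (intro smooth_map_scaleR smooth_map_add w smooth_map_grad s)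
  have v\<xi>: "vanish (Suc k) \<xi>" unfolding \<xi>_def
    by (intro vanish_linear[OF bounded_linear_scaleR_right] vanish_add vw vanish_grad s vs)
  have k0: "real k \<noteq> 0" using k by simp
  \<comment> \<open>The consistency of the ansatz: the actual \<open>\<xi> x \<bullet> x\<close>
    differs from the prescribed \<open>s\<close> only by an Euler defect, which is one order
    smaller.\<close>
  have "\<xi> x \<bullet> x - s x = (- 1 / k) * (euler s x - Suc (Suc k) * s x)" for x
  proof -
    have "w x \<bullet> x = - (2 * k + 2) * s x" by (simp add: s_def field_simps)
    moreover have "\<xi> x \<bullet> x = (- 1 / k) * (w x \<bullet> x + euler s x)"
      by (simp only: \<xi>_def inner_scaleR_left inner_add_left grad_inner_euler)
    ultimately show ?thesis
      using k0 by (simp add: field_simps)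
  qed
  then have vd: "vanish (Suc (k + 2)) (\<lambda>x. \<xi> x \<bullet> x - s x)"
    using vanish_mult[OF vanish_const[of "- 1 / real k"] vanish_euler[OF s vs]] by simp
  have sd: "smooth_fn (\<lambda>x. \<xi> x \<bullet> x)" by (intro smooth_fn_inner \<xi> smooth_map_id)
  have "grad (\<lambda>x. \<xi> x \<bullet> x - s x) = (\<lambda>x. grad (\<lambda>x. \<xi> x \<bullet> x) x - grad s x)"
    by (auto simp: grad_def vec_eq_iff pd1_diff sd s)
  then have vg: "vanish (k + 2) (\<lambda>x. grad (\<lambda>x. \<xi> x \<bullet> x) x - grad s x)"
    using vanish_grad[OF smooth_fn_diff[OF sd s] vd] by (simp only:)
  have "vanish (Suc k + 1) (\<lambda>x. (pullback (\<lambda>x. mat 1 *v x + \<xi> x) G x - (transpose (mat 1) ** G (mat 1 *v x) ** mat 1 +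
      transpose (mat 1) ** jac \<xi> x + transpose (jac \<xi> x) ** mat 1)) *v x)"
    by (intro vanish_matvec vanish_pullback_expand vanish_id \<xi> v\<xi> k G)
  then have e: "vanish (k + 2) (\<lambda>x. (pullback (\<lambda>x. x + \<xi> x) G x - (G x + jac \<xi> x + transpose (jac \<xi> x))) *v x)"
    by simp
  have "(pullback (\<lambda>x. x + \<xi> x) G x - (G x + jac \<xi> x + transpose (jac \<xi> x))) *v x
      + ((jac \<xi> x + transpose (jac \<xi> x)) *v x - (real k *\<^sub>R \<xi> x + grad (\<lambda>x. \<xi> x \<bullet> x) x))
      + (grad (\<lambda>x. \<xi> x \<bullet> x) x - grad s x) = pullback (\<lambda>x. x + \<xi> x) G x *v x - x" for x
  proof -
    have "real k *\<^sub>R \<xi> x = - (G x *v x - x) - grad s x"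
      using k0 by (simp add: \<xi>_def w_def)
    then show ?thesis
      by (simp add: algebra_simps)
  qed
  with vanish_add[OF vanish_add[OF e vanish_killing[OF \<xi> v\<xi>]] vg]
  have "vanish (k + 2) (\<lambda>x. pullback (\<lambda>x. x + \<xi> x) G x *v x - x)" by simp
  with that \<xi> v\<xi> show ?thesis by blast
qed

lemma pullback_linear: "pullback (\<lambda>x. A *v x) G x = transpose A ** G (A *v x) ** A"
  by (simp add: pullback_def jac_linear)

text \<open>The linear frame \<open>P\<close> already has a defect of order 2. Each later stage
  applies \<open>normal_step\<close> to the metric pulled back so far; the corrections have order at
  least 2 and therefore leave the Jacobian \<open>P\<close> at the origin unchanged.\<close>

lemma normal_form:
  assumes G: "smooth_mat G" and P: "transpose P ** G 0 ** P = mat 1"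
  obtains \<phi> where "smooth_map \<phi>" "\<phi> 0 = 0" "jac \<phi> 0 = P" "vanish (r + 2) (\<lambda>x. pullback \<phi> G x *v x - x)"
proof -
  have "\<exists>\<phi>. smooth_map \<phi> \<and> \<phi> 0 = 0 \<and> jac \<phi> 0 = P \<and> vanish (r + 2) (\<lambda>x. pullback \<phi> G x *v x - x)"
  proof (induction r)
    case 0
    let ?\<phi> = "\<lambda>x. P *v x"
    have "vanish 1 (\<lambda>x. pullback ?\<phi> G x - mat 1)"
      by (intro vanish_1_mat smooth_mat_diff smooth_mat_const smooth_mat_pullback smooth_map_linear G)
         (simp add: pullback_linear P)
    then have "vanish (1 + 1) (\<lambda>x. (pullback ?\<phi> G x - mat 1) *v x)"
      by (intro vanish_matvec vanish_id)
    then have "vanish (0 + 2) (\<lambda>x. pullback ?\<phi> G x *v x - x)"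
      by (simp add: matrix_vector_mult_diff_rdistrib numeral_2_eq_2)
    then show ?case
      using smooth_map_linear[of P] by (intro exI[of _ ?\<phi>]) (simp add: jac_linear)
  next
    case (Suc r)
    then obtain \<phi> where \<phi>: "smooth_map \<phi>" "\<phi> 0 = 0" "jac \<phi> 0 = P"
      "vanish (r + 2) (\<lambda>x. pullback \<phi> G x *v x - x)" by blast
    have F: "smooth_mat (pullback \<phi> G)" by (intro smooth_mat_pullback \<phi> G)
    have F0: "pullback \<phi> G 0 = mat 1" using \<phi> P by (simp add: pullback_def)
    from \<phi>(4) have v: "vanish (Suc (Suc r)) (\<lambda>x. pullback \<phi> G x *v x - x)" by simp
    obtain \<xi> where \<xi>: "smooth_map \<xi>" "vanish (Suc (Suc r)) \<xi>"
      "vanish (Suc r + 2) (\<lambda>x. pullback (\<lambda>x. x + \<xi> x) (pullback \<phi> G) x *v x - x)"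
      by (rule normal_step[OF F F0 _ v]) simp
    have id\<xi>: "smooth_map (\<lambda>x. x + \<xi> x)" by (intro smooth_map_add smooth_map_id \<xi>)
    have "jac \<xi> 0 = 0" using vanish_0[OF vanish_jac[OF \<xi>(1,2)]] .
    then have "jac (\<lambda>x. \<phi> (x + \<xi> x)) 0 = P"
      using vanish_0[OF \<xi>(2)] \<phi> by (simp add: jac_comp[OF \<phi>(1) id\<xi>] jac_add smooth_map_id \<xi> jac_id)
    moreover have "vanish (Suc r + 2) (\<lambda>x. pullback (\<lambda>x. \<phi> (x + \<xi> x)) G x *v x - x)"
      using \<xi>(3) by (simp add: pullback_comp[OF \<phi>(1) id\<xi>])
    moreover have "smooth_map (\<lambda>x. \<phi> (x + \<xi> x))" by (rule smooth_map_comp[OF \<phi>(1) id\<xi>])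
    ultimately show ?case
      using vanish_0[OF \<xi>(2)] \<phi>(2) by (intro exI[of _ "\<lambda>x. \<phi> (x + \<xi> x)"]) simp
  qed
  with that show ?thesis by blast
qed

text \<open>A germ of inverse need not be defined on the whole plane, so a globally smooth inverse
  to finite order is built by Newton's iteration with the constant slope \<open>Q\<close>: the error
  \<open>e\<close> of \<open>\<psi>\<close> is corrected by subtracting \<open>Q *v e x\<close>,
  which gains one order per step.\<close>

lemma jet_inverse:
  assumes \<phi>: "smooth_map \<phi>" "\<phi> 0 = 0" "jac \<phi> 0 = P" and PQ: "P ** Q = mat 1"
  obtains \<psi> where "smooth_map \<psi>" "\<psi> 0 = 0" "jac \<psi> 0 = Q" "vanish (n + 2) (\<lambda>x. \<phi> (\<psi> x) - x)"
proof -
  have "\<exists>\<psi>. smooth_map \<psi> \<and> \<psi> 0 = 0 \<and> jac \<psi> 0 = Q \<and> vanish (n + 2) (\<lambda>x. \<phi> (\<psi> x) - x)"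
  proof (induction n)
    case 0
    have s: "smooth_map (\<lambda>x. \<phi> (Q *v x) - x)"
      by (intro smooth_map_diff smooth_map_id smooth_map_comp[OF \<phi>(1) smooth_map_linear])
    have "jac (\<lambda>x. \<phi> (Q *v x) - x) 0 = 0"
      using \<phi> PQ
      by (simp add: jac_diff smooth_map_id smooth_map_comp[OF \<phi>(1) smooth_map_linear] jac_id
          jac_comp[OF \<phi>(1) smooth_map_linear] jac_linear)
    then have "vanish (Suc 1) (\<lambda>x. \<phi> (Q *v x) - x)"
      using \<phi>(2) by (intro vanish_from_jac s vanish_1_mat smooth_mat_jac) auto
    then show ?case
      using smooth_map_linear[of Q] by (intro exI[of _ "\<lambda>x. Q *v x"]) (simp add: jac_linear numeral_2_eq_2)
  next
    case (Suc n)
    then obtain \<psi> where \<psi>: "smooth_map \<psi>" "\<psi> 0 = 0" "jac \<psi> 0 = Q" "vanish (n + 2) (\<lambda>x. \<phi> (\<psi> x) - x)"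
      by blast
    define e where "e x = \<phi> (\<psi> x) - x" for x
    define \<kappa> where "\<kappa> x = \<psi> x - Q *v e x" for x
    have \<phi>\<psi>: "smooth_map (\<lambda>x. \<phi> (\<psi> x))" by (rule smooth_map_comp[OF \<phi>(1) \<psi>(1)])
    have e: "smooth_map e" unfolding e_def by (intro smooth_map_diff smooth_map_id \<phi>\<psi>)
    have ve: "vanish (Suc (Suc n)) e" using \<psi>(4) by (simp add: e_def[abs_def])
    have Qe: "smooth_map (\<lambda>x. Q *v e x)" by (intro smooth_map_mat smooth_mat_const e)
    have \<kappa>: "smooth_map \<kappa>" unfolding \<kappa>_def by (intro smooth_map_diff \<psi> Qe)
    have \<kappa>0: "\<kappa> 0 = 0" using \<psi>(2) vanish_0[OF ve] by (simp add: \<kappa>_def)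
    have De: "vanish (Suc n) (jac e)" by (intro vanish_jac e ve)
    have jac\<kappa>: "jac \<kappa> x = jac \<psi> x - Q ** jac e x" for x
      unfolding \<kappa>_def[abs_def] by (simp add: jac_diff \<psi> Qe jac_mat e)
    have jace: "jac e x = jac \<phi> (\<psi> x) ** jac \<psi> x - mat 1" for x
      unfolding e_def[abs_def] by (simp add: jac_diff \<phi>\<psi> smooth_map_id jac_id jac_comp[OF \<phi>(1) \<psi>(1)])
    have "vanish (0 + Suc (Suc n)) (\<lambda>x. Q *v e x)" by (intro vanish_matvec vanish_const ve)
    then have "vanish (Suc (Suc n)) (\<lambda>x. \<kappa> x - \<psi> x)" using vanish_minus by (fastforce simp: \<kappa>_def)
    then have 1: "vanish (Suc (Suc n)) (\<lambda>x. jac \<phi> (\<kappa> x) - jac \<phi> (\<psi> x))"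
      by (intro vanish_mat_lipschitz smooth_mat_jac \<phi> vanish_1_map \<kappa> \<kappa>0 \<psi>)
    have "vanish (Suc (Suc n) + 0) (\<lambda>x. (jac \<phi> (\<kappa> x) - jac \<phi> (\<psi> x)) ** jac \<kappa> x)"
      by (intro vanish_matmul 1 vanish_smooth_mat smooth_mat_jac \<kappa>)
    moreover have "smooth_mat (\<lambda>x. mat 1 - jac \<phi> (\<psi> x) ** Q)"
      by (intro smooth_mat_diff smooth_mat_mult smooth_mat_const
          smooth_mat_comp[OF smooth_mat_jac[OF \<phi>(1)] \<psi>(1)])
    then have "vanish (1 + Suc n) (\<lambda>x. (mat 1 - jac \<phi> (\<psi> x) ** Q) ** jac e x)"
      using \<phi>(3) \<psi>(2) PQ by (intro vanish_matmul De vanish_1_mat) auto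
    ultimately have "vanish (Suc (Suc n)) (\<lambda>x. (jac \<phi> (\<kappa> x) - jac \<phi> (\<psi> x)) ** jac \<kappa> x +
        (mat 1 - jac \<phi> (\<psi> x) ** Q) ** jac e x)"
      by (simp add: vanish_add)
    \<comment> \<open>The derivative of the new error. Its first term is small because
      \<open>\<kappa>\<close> and \<open>\<psi>\<close> differ by \<open>Q *v e x\<close>, its
      second because \<open>Q\<close> inverts \<open>jac \<phi>\<close> at the origin; integrating
      it gives the remaining order.\<close>
    moreover have "(jac \<phi> (\<kappa> x) - jac \<phi> (\<psi> x)) ** jac \<kappa> x + (mat 1 - jac \<phi> (\<psi> x) ** Q) ** jac e x =
        jac (\<lambda>x. \<phi> (\<kappa> x) - x) x" for x
    proof -
      have "jac (\<lambda>x. \<phi> (\<kappa> x) - x) x = jac \<phi> (\<kappa> x) ** jac \<kappa> x - mat 1"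
        by (simp add: jac_diff smooth_map_comp[OF \<phi>(1) \<kappa>] smooth_map_id jac_id jac_comp[OF \<phi>(1) \<kappa>])
      moreover have "jac \<phi> (\<psi> x) ** jac \<psi> x = jac e x + mat 1" by (simp add: jace)
      ultimately show ?thesis
        by (simp add: jac\<kappa> bounded_bilinear.diff_left[OF bounded_bilinear_matrix_matrix_mult]
            bounded_bilinear.diff_right[OF bounded_bilinear_matrix_matrix_mult] matrix_mul_assoc)
    qed
    ultimately have "vanish (Suc (Suc n)) (jac (\<lambda>x. \<phi> (\<kappa> x) - x))" by simp
    then have "vanish (Suc (Suc (Suc n))) (\<lambda>x. \<phi> (\<kappa> x) - x)"
      using \<kappa>0 \<phi>(2) by (intro vanish_from_jac smooth_map_diff smooth_map_comp[OF \<phi>(1) \<kappa>] smooth_map_id) auto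
    moreover have "jac \<kappa> 0 = Q"
      using vanish_0[OF De] \<psi>(3) by (simp add: jac\<kappa>)
    ultimately show ?case
      using \<kappa> \<kappa>0 by (intro exI[of _ \<kappa>]) simp
  qed
  with that show ?thesis by blast
qed

section \<open>Automorphisms of jets\<close>

lemma metric_jet_eq_iff_vanish:
  "smooth_mat F \<Longrightarrow> smooth_mat G \<Longrightarrow> metric_jet_eq r F G \<longleftrightarrow> vanish (Suc r) (\<lambda>x. F x - G x)"
  by (simp add: metric_jet_eq_def vanish_mat_iff jet_eq_iff_vanish smooth_mat_def)

definition jet_aut :: "nat \<Rightarrow> (real^2 \<Rightarrow> real^2^2) \<Rightarrow> (real^2 \<Rightarrow> real^2) \<Rightarrow> bool" where
  "jet_aut r G \<tau> \<longleftrightarrow> smooth_map \<tau> \<and> \<tau> 0 = 0 \<and> invertible (jac \<tau> 0) \<and>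
     vanish (Suc r) (\<lambda>x. pullback \<tau> G x - G x)"

lemma Aut_eq: "smooth_mat G \<Longrightarrow> Aut r G = {jac \<tau> 0 | \<tau>. jet_aut r G \<tau>}"
  unfolding Aut_def diff0_def jet_aut_def smooth_map_def[symmetric]
  using metric_jet_eq_iff_vanish smooth_mat_pullback by blast

lemma vanish_diff_trans:
  "vanish k (\<lambda>x. F x - G x) \<Longrightarrow> vanish k (\<lambda>x. G x - H x) \<Longrightarrow> vanish k (\<lambda>x. F x - H x)"
  using vanish_add[of k "\<lambda>x. F x - G x" "\<lambda>x. G x - H x"] by simp

lemma pullback_id: "pullback (\<lambda>x. x) G = G"
  by (simp add: pullback_def[abs_def] jac_id)

text \<open>Automorphisms are carried back and forth by conjugation with \<open>\<phi>\<close> and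
  its approximate inverse \<open>\<psi>\<close>. Agreement of \<open>\<phi> (\<psi> x)\<close> with
  \<open>x\<close> to order \<open>r + 2\<close> is enough, because a pullback costs one order and
  jets are compared to order \<open>r + 1\<close>.\<close>

lemma Aut_pullback:
  assumes G: "smooth_mat G" and \<phi>: "smooth_map \<phi>" "\<phi> 0 = 0" "jac \<phi> 0 = P"
    and PQ: "P ** Q = mat 1" "Q ** P = mat 1"
  shows "Aut r (pullback \<phi> G) = (\<lambda>A. Q ** A ** P) ` Aut r G"
proof -
  let ?F = "pullback \<phi> G"
  have F: "smooth_mat ?F" by (intro smooth_mat_pullback \<phi> G)
  obtain \<psi> where \<psi>: "smooth_map \<psi>" "\<psi> 0 = 0" "jac \<psi> 0 = Q" "vanish (r + 2) (\<lambda>x. \<phi> (\<psi> x) - x)"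
    using jet_inverse[OF \<phi> PQ(1)] by blast
  have \<phi>\<psi>: "smooth_map (\<lambda>x. \<phi> (\<psi> x))" by (rule smooth_map_comp[OF \<phi>(1) \<psi>(1)])
  have "vanish (Suc r) (\<lambda>x. pullback (\<lambda>x. \<phi> (\<psi> x)) G x - pullback (\<lambda>x. x) G x)"
    using \<psi> \<phi> by (intro vanish_pullback_close \<phi>\<psi> smooth_map_id G) auto
  then have bk: "vanish (Suc r) (\<lambda>x. pullback \<psi> ?F x - G x)"
    by (simp add: pullback_comp[OF \<phi>(1) \<psi>(1)] pullback_id)
  have inv: "invertible P" "invertible Q" using PQ invertible_def by blast+
  show ?thesis
    unfolding Aut_eq[OF F] Aut_eq[OF G]
  proof safe
    fix \<sigma> assume "jet_aut r ?F \<sigma>"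
    then have \<sigma>: "smooth_map \<sigma>" "\<sigma> 0 = 0" "invertible (jac \<sigma> 0)" "vanish (Suc r) (\<lambda>x. pullback \<sigma> ?F x - ?F x)"
      by (auto simp: jet_aut_def)
    let ?\<tau> = "\<lambda>x. \<phi> (\<sigma> (\<psi> x))"
    have \<sigma>\<psi>: "smooth_map (\<lambda>x. \<sigma> (\<psi> x))" by (rule smooth_map_comp[OF \<sigma>(1) \<psi>(1)])
    have \<tau>: "smooth_map ?\<tau>" by (rule smooth_map_comp[OF \<phi>(1) \<sigma>\<psi>])
    have j: "jac ?\<tau> 0 = P ** jac \<sigma> 0 ** Q"
      using \<phi> \<psi> \<sigma> by (simp add: jac_comp[OF \<phi>(1) \<sigma>\<psi>] jac_comp[OF \<sigma>(1) \<psi>(1)] matrix_mul_assoc)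
    have pe: "pullback ?\<tau> G x = pullback \<psi> (pullback \<sigma> ?F) x" for x
    proof -
      have "pullback ?\<tau> G x = pullback (\<lambda>x. \<sigma> (\<psi> x)) ?F x"
        by (rule pullback_comp[OF \<phi>(1) \<sigma>\<psi>])
      also have "\<dots> = pullback \<psi> (pullback \<sigma> ?F) x"
        by (rule pullback_comp[OF \<sigma>(1) \<psi>(1)])
      finally show ?thesis .
    qed
    have "vanish (Suc r) (\<lambda>x. pullback ?\<tau> G x - G x)"
      unfolding pe using vanish_diff_trans[OF vanish_pullback_diff[OF \<psi>(1,2) \<sigma>(4)] bk] .
    then have "jet_aut r G ?\<tau>"
      using \<tau> \<phi> \<psi> \<sigma> inv by (simp add: jet_aut_def j invertible_mult)
    then have "jac ?\<tau> 0 \<in> {jac \<tau> 0 |\<tau>. jet_aut r G \<tau>}" by blast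
    moreover have "jac \<sigma> 0 = Q ** (P ** jac \<sigma> 0 ** Q) ** P"
    proof -
      have "Q ** (P ** jac \<sigma> 0 ** Q) ** P = (Q ** P) ** jac \<sigma> 0 ** (Q ** P)"
        by (simp only: matrix_mul_assoc)
      then show ?thesis using PQ by simp
    qed
    ultimately show "jac \<sigma> 0 \<in> (\<lambda>A. Q ** A ** P) ` {jac \<tau> 0 |\<tau>. jet_aut r G \<tau>}"
      using j by (metis (no_types, lifting) image_eqI)
  next
    fix \<tau> assume "jet_aut r G \<tau>"
    then have \<tau>: "smooth_map \<tau>" "\<tau> 0 = 0" "invertible (jac \<tau> 0)" "vanish (Suc r) (\<lambda>x. pullback \<tau> G x - G x)"
      by (auto simp: jet_aut_def)
    let ?\<sigma> = "\<lambda>x. \<psi> (\<tau> (\<phi> x))"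
    have \<tau>\<phi>: "smooth_map (\<lambda>x. \<tau> (\<phi> x))" by (rule smooth_map_comp[OF \<tau>(1) \<phi>(1)])
    have \<sigma>: "smooth_map ?\<sigma>" by (rule smooth_map_comp[OF \<psi>(1) \<tau>\<phi>])
    have j: "jac ?\<sigma> 0 = Q ** jac \<tau> 0 ** P"
      using \<phi> \<psi> \<tau> by (simp add: jac_comp[OF \<psi>(1) \<tau>\<phi>] jac_comp[OF \<tau>(1) \<phi>(1)] matrix_mul_assoc)
    have pe: "pullback ?\<sigma> ?F x = pullback \<phi> (pullback \<tau> (pullback \<psi> ?F)) x" for x
    proof -
      have "pullback ?\<sigma> ?F x = pullback (\<lambda>x. \<tau> (\<phi> x)) (pullback \<psi> ?F) x"
        by (rule pullback_comp[OF \<psi>(1) \<tau>\<phi>])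
      also have "\<dots> = pullback \<phi> (pullback \<tau> (pullback \<psi> ?F)) x"
        by (rule pullback_comp[OF \<tau>(1) \<phi>(1)])
      finally show ?thesis .
    qed
    have "vanish (Suc r) (\<lambda>x. pullback \<tau> (pullback \<psi> ?F) x - G x)"
      using vanish_diff_trans[OF vanish_pullback_diff[OF \<tau>(1,2) bk] \<tau>(4)] .
    then have "vanish (Suc r) (\<lambda>x. pullback ?\<sigma> ?F x - ?F x)"
      unfolding pe by (intro vanish_pullback_diff \<phi>)
    then have "jet_aut r ?F ?\<sigma>"
      using \<tau> \<phi> \<psi> \<sigma> inv by (simp add: jet_aut_def j invertible_mult)
    then show "\<exists>\<sigma>. Q ** jac \<tau> 0 ** P = jac \<sigma> 0 \<and> jet_aut r ?F \<sigma>"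
      using j by metis
  qed
qed

lemma O2_iff: "A \<in> O2 \<longleftrightarrow> transpose A ** A = mat 1" "A \<in> O2 \<longleftrightarrow> A ** transpose A = mat 1"
  by (auto simp: O2_def matrix_left_right_inverse)

text \<open>The jet version of the fact that isometries are linear in normal coordinates. The
  nonlinear part \<open>\<xi>\<close> gains one order at a time: linearise the pullback, evaluate on
  \<open>x\<close>, and apply \<open>killing_injective\<close> to
  \<open>transpose A *v \<xi> x\<close>.\<close>

lemma jet_aut_rigid:
  assumes G: "smooth_mat G" "G 0 = mat 1" "vanish (r + 2) (\<lambda>x. G x *v x - x)"
    and \<tau>: "jet_aut r G \<tau>"
  shows "jac \<tau> 0 \<in> O2" "vanish (r + 2) (\<lambda>x. \<tau> x - jac \<tau> 0 *v x)"
proof -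
  define A where "A = jac \<tau> 0"
  have \<tau>': "smooth_map \<tau>" "\<tau> 0 = 0" "vanish (Suc r) (\<lambda>x. pullback \<tau> G x - G x)"
    using \<tau> by (auto simp: jet_aut_def)
  have A: "transpose A ** A = mat 1"
    using vanish_0[OF \<tau>'(3)] G \<tau>' by (simp add: pullback_def A_def)
  then show O: "jac \<tau> 0 \<in> O2" by (simp add: O2_def A_def)
  have A': "A ** transpose A = mat 1" using A by (simp add: matrix_left_right_inverse)
  define \<xi> where "\<xi> x = \<tau> x - A *v x" for x
  have \<xi>: "smooth_map \<xi>" unfolding \<xi>_def by (intro smooth_map_diff \<tau>' smooth_map_linear)
  have "vanish (k + 2) \<xi>" if "k \<le> r" for k
    using that
  proof (induction k)
    case 0
    have "jac \<xi> 0 = 0"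
      unfolding \<xi>_def[abs_def] by (simp add: jac_diff \<tau>' smooth_map_linear jac_linear A_def)
    then have "vanish (Suc 1) \<xi>"
      using \<tau>'(2) by (intro vanish_from_jac \<xi> vanish_1_mat smooth_mat_jac) (auto simp: \<xi>_def)
    then show ?case by (simp add: numeral_2_eq_2)
  next
    case (Suc j)
    let ?k = "Suc j"
    have v\<xi>: "vanish (Suc ?k) \<xi>" using Suc by simp
    let ?E = "\<lambda>x. transpose A ** G (A *v x) ** A + transpose A ** jac \<xi> x + transpose (jac \<xi> x) ** A"
    have \<tau>eq: "(\<lambda>x. A *v x + \<xi> x) = \<tau>" by (simp add: \<xi>_def)
    have "vanish (Suc ?k) (\<lambda>x. pullback \<tau> G x - ?E x)"
      using vanish_pullback_expand[OF \<xi> v\<xi> _ G(1,2), of A] by (simp add: \<tau>eq)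
    moreover have "vanish (Suc ?k) (\<lambda>x. pullback \<tau> G x - G x)"
      by (rule vanish_mono[OF \<tau>'(3)]) (use Suc.prems in simp)
    ultimately have "vanish (Suc ?k) (\<lambda>x. (pullback \<tau> G x - G x) - (pullback \<tau> G x - ?E x))"
      by (rule vanish_diff[rotated])
    then have "vanish (Suc ?k) (\<lambda>x. ?E x - G x)" by (simp add: algebra_simps)
    then have "vanish (Suc ?k + 1) (\<lambda>x. (?E x - G x) *v x)" by (intro vanish_matvec vanish_id)
    then have 1: "vanish (?k + 2) (\<lambda>x. (?E x - G x) *v x)" by simp
    have 2: "vanish (?k + 2) (\<lambda>x. G x *v x - x)"
      by (rule vanish_mono[OF G(3)]) (use Suc.prems in simp)
    have 3: "vanish (?k + 2) (\<lambda>x. transpose A *v (G (A *v x) *v (A *v x) - A *v x))"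
      using vanish_matvec[OF vanish_const vanish_compose[OF 2 vanish_1_map[OF smooth_map_linear]], of A "transpose A"]
      by simp
    have "vanish (?k + 2) (\<lambda>x. (?E x - G x) *v x + (G x *v x - x) - transpose A *v (G (A *v x) *v (A *v x) - A *v x))"
      by (intro vanish_diff vanish_add 1 2 3)
    \<comment> \<open>The Gauss lemma at \<open>x\<close> and at \<open>A *v x\<close> removes every
      term containing \<open>G\<close>; only the flat first variation along
      \<open>transpose A *v \<xi> x\<close> remains.\<close>
    moreover have "(?E x - G x) *v x + (G x *v x - x) - transpose A *v (G (A *v x) *v (A *v x) - A *v x)
       = (transpose A ** jac \<xi> x + transpose (transpose A ** jac \<xi> x)) *v x" for x
    proof -
      have "transpose A *v (A *v x) = x" using A by (simp add: matrix_vector_mul_assoc)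
      then show ?thesis
        by (simp add: algebra_simps matrix_transpose_mul matrix_vector_mul_assoc[symmetric] transpose_transpose)
    qed
    ultimately have "vanish (?k + 2) (\<lambda>x. (jac (\<lambda>x. transpose A *v \<xi> x) x + transpose (jac (\<lambda>x. transpose A *v \<xi> x) x)) *v x)"
      by (simp add: jac_mat \<xi>)
    moreover have "vanish (0 + Suc ?k) (\<lambda>x. transpose A *v \<xi> x)" by (intro vanish_matvec vanish_const v\<xi>)
    moreover have "smooth_map (\<lambda>x. transpose A *v \<xi> x)" by (intro smooth_map_mat smooth_mat_const \<xi>)
    ultimately have "vanish (?k + 2) (\<lambda>x. transpose A *v \<xi> x)"
      using killing_injective[of "\<lambda>x. transpose A *v \<xi> x" ?k] by simp
    then have "vanish (0 + (?k + 2)) (\<lambda>x. A *v (transpose A *v \<xi> x))"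
      by (rule vanish_matvec[OF vanish_const])
    then show ?case using A' by (simp add: matrix_vector_mul_assoc)
  qed
  then show "vanish (r + 2) (\<lambda>x. \<tau> x - jac \<tau> 0 *v x)"
    by (simp add: \<xi>_def[abs_def] A_def)
qed

text \<open>The hypothesis on the product carries no information at the origin, so the value there
  is supplied separately.\<close>

lemma vanish_norm_div:
  assumes "vanish (k + 2) (\<lambda>x. (x \<bullet> x) * f x)" "f 0 = (0::real)" shows "vanish k f"
proof -
  obtain C e where C: "C \<ge> 0" "e > 0" "\<And>x. norm x < e \<Longrightarrow> \<bar>(x \<bullet> x) * f x\<bar> \<le> C * norm x ^ (k + 2)"
    using assms(1) by (rule vanishE) auto
  show ?thesis
  proof (rule vanishI[OF C(2)])
    fix x :: "real^2" assume x: "norm x < e"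
    have "norm x ^ (k + 2) = (norm x)\<^sup>2 * norm x ^ k"
      by (simp add: power_add power2_eq_square)
    then have "(norm x)\<^sup>2 * \<bar>f x\<bar> \<le> (norm x)\<^sup>2 * (C * norm x ^ k)"
      using C(3)[OF x] by (simp only: abs_mult power2_norm_eq_inner[symmetric] abs_power2 mult_ac)
    then show "norm (f x) \<le> C * norm x ^ k"
      using C(1) assms(2) by (cases "x = 0") (auto simp: mult_le_cancel_left)
  qed
qed

text \<open>This is where dimension two enters. For a symmetric matrix of size 2,
  \<open>x \<bullet> x\<close> times each of the entries \<open>M x $ 1 $ 1\<close> and
  \<open>M x $ 1 $ 2\<close> is a combination of products of coordinates with
  \<open>M x *v x\<close> and of quadratic monomials times the trace; the orders of both are
  \<open>r + 3\<close>, and division by \<open>x \<bullet> x\<close> leaves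
  \<open>r + 1\<close>.\<close>

lemma vanish_symmetric_trace:
  assumes sym: "\<And>x. transpose (M x) = M x" and M0: "M 0 = 0"
    and vx: "vanish (r + 2) (\<lambda>x. M x *v x)" and vt: "vanish (Suc r) (\<lambda>x. M x $ 1 $ 1 + M x $ 2 $ 2)"
  shows "vanish (Suc r) M"
proof -
  have s: "M x $ 2 $ 1 = M x $ 1 $ 2" for x using sym[of x] by (metis transpose_nth)
  let ?p = "\<lambda>i x. (M x *v x) $ i" and ?t = "\<lambda>x. M x $ 1 $ 1 + M x $ 2 $ 2"
  have p: "vanish (1 + (r + 2)) (\<lambda>x. x $ j * ?p i x)" for i j
    using vx by (intro vanish_mult vanish_coord) (simp only: vanish_component_iff)
  have t: "vanish (1 + 1 + Suc r) (\<lambda>x. x $ i * x $ j * ?t x)" for i j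
    by (intro vanish_mult vanish_coord vt)
  have "vanish (Suc r + 2) (\<lambda>x. x$1 * ?p 1 x - x$2 * ?p 2 x + x$2 * x$2 * ?t x)"
    using p t by (intro vanish_add vanish_diff) auto
  then have 11: "vanish (Suc r) (\<lambda>x. M x $ 1 $ 1)"
    by - (rule vanish_norm_div, simp_all add: inner_2 matrix_vector_mult_nth s algebra_simps M0)
  have "vanish (Suc r + 2) (\<lambda>x. x$2 * ?p 1 x + x$1 * ?p 2 x - x$1 * x$2 * ?t x)"
    using p t by (intro vanish_add vanish_diff) auto
  then have 12: "vanish (Suc r) (\<lambda>x. M x $ 1 $ 2)"
    by - (rule vanish_norm_div, simp_all add: inner_2 matrix_vector_mult_nth s algebra_simps M0)
  have 22: "vanish (Suc r) (\<lambda>x. M x $ 2 $ 2)"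
    using vanish_diff[OF vt 11] by simp
  show ?thesis
    using 11 12 22 by (auto simp: vanish_mat_iff forall_2 s)
qed

lemma trace_orthogonal_conj:
  assumes "A \<in> O2"
  shows "(transpose A ** M ** A) $ 1 $ 1 + (transpose A ** M ** A) $ 2 $ 2 = M $ 1 $ 1 + M $ 2 $ (2::2)"
proof -
  have "A ** transpose A = mat 1" using assms O2_iff by blast
  then have e: "(A ** transpose A) $ i $ j = (mat 1 :: real^2^2) $ i $ j" for i j by simp
  have "(transpose A ** M ** A) $ 1 $ 1 + (transpose A ** M ** A) $ 2 $ 2 =
     M$1$1 * (A ** transpose A)$1$1 + M$1$2 * (A ** transpose A)$1$2 +
     M$2$1 * (A ** transpose A)$2$1 + M$2$2 * (A ** transpose A)$2$2"
    by (simp add: mat2_simps algebra_simps)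
  then show ?thesis unfolding e by (simp add: mat_1_nth)
qed

text \<open>One inclusion replaces an automorphism by its linear part, allowed by rigidity, and
  takes traces. For the other, the change of \<open>G\<close> under the linear map \<open>A\<close>
  is symmetric and nearly annihilates \<open>x\<close> by the Gauss lemma, so
  \<open>vanish_symmetric_trace\<close> reduces everything to the trace.\<close>

lemma Aut_normal:
  assumes G: "smooth_mat G" "\<And>x. transpose (G x) = G x" "G 0 = mat 1" "vanish (r + 2) (\<lambda>x. G x *v x - x)"
  defines "t \<equiv> \<lambda>x. G x $ 1 $ 1 + G x $ 2 $ 2"
  shows "Aut r G = {A \<in> O2. vanish (Suc r) (\<lambda>x. t (A *v x) - t x)}"
proof safe
  fix A assume "A \<in> Aut r G"
  then obtain \<tau> where \<tau>: "jet_aut r G \<tau>" "A = jac \<tau> 0" unfolding Aut_eq[OF G(1)] by blast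
  note rigid = jet_aut_rigid[OF G(1,3,4) \<tau>(1), folded \<tau>(2)]
  show A: "A \<in> O2" by (rule rigid)
  have \<tau>': "smooth_map \<tau>" "\<tau> 0 = 0" "vanish (Suc r) (\<lambda>x. pullback \<tau> G x - G x)"
    using \<tau> by (auto simp: jet_aut_def)
  have "vanish (Suc r) (\<lambda>x. pullback \<tau> G x - pullback (\<lambda>x. A *v x) G x)"
    using rigid(2) by (intro vanish_pullback_close \<tau>' smooth_map_linear G) auto
  from vanish_diff[OF \<tau>'(3) this]
  have "vanish (Suc r) (\<lambda>x. transpose A ** G (A *v x) ** A - G x)"
    by (simp add: pullback_linear)
  then have "vanish (Suc r) (\<lambda>x. (transpose A ** G (A *v x) ** A - G x) $ i $ i)" for i
    by (simp only: vanish_mat_iff)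
  from vanish_add[OF this[of 1] this[of 2]]
  have "vanish (Suc r) (\<lambda>x. ((transpose A ** G (A *v x) ** A) $ 1 $ 1 + (transpose A ** G (A *v x) ** A) $ 2 $ 2) - t x)"
    by (simp add: t_def algebra_simps)
  then show "vanish (Suc r) (\<lambda>x. t (A *v x) - t x)"
    unfolding trace_orthogonal_conj[OF A] by (simp add: t_def)
next
  fix A assume A: "A \<in> O2" and v: "vanish (Suc r) (\<lambda>x. t (A *v x) - t x)"
  have A1: "transpose A ** A = mat 1" using A O2_iff by blast
  define M where "M x = transpose A ** G (A *v x) ** A - G x" for x
  have "vanish (Suc r) M"
  proof (rule vanish_symmetric_trace)
    show "transpose (M x) = M x" for x
      using G(2) by (simp add: M_def matrix_transpose_mul matrix_mul_assoc linear_diff[OF bounded_linear.linear[OF bounded_linear_transpose]] transpose_transpose)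
    show "M 0 = 0" using A1 G(3) by (simp add: M_def)
    have "M x $ 1 $ 1 + M x $ 2 $ 2 = t (A *v x) - t x" for x
      using trace_orthogonal_conj[OF A, of "G (A *v x)"] by (simp add: M_def t_def)
    then show "vanish (Suc r) (\<lambda>x. M x $ 1 $ 1 + M x $ 2 $ 2)" using v by simp
    have "vanish (r + 2) (\<lambda>x. transpose A *v (G (A *v x) *v (A *v x) - A *v x))"
      using vanish_matvec[OF vanish_const vanish_compose[OF G(4) vanish_1_map[OF smooth_map_linear]], of A "transpose A"]
      by simp
    from vanish_diff[OF this G(4)]
    have "vanish (r + 2) (\<lambda>x. transpose A *v (G (A *v x) *v (A *v x) - A *v x) - (G x *v x - x))" .
    moreover have "transpose A *v (G (A *v x) *v (A *v x) - A *v x) - (G x *v x - x) = M x *v x" for x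
    proof -
      have "transpose A *v (A *v x) = x" using A1 by (simp add: matrix_vector_mul_assoc)
      then show ?thesis
        by (simp add: M_def algebra_simps matrix_vector_mul_assoc[symmetric])
    qed
    ultimately show "vanish (r + 2) (\<lambda>x. M x *v x)" by simp
  qed
  then have "jet_aut r G (\<lambda>x. A *v x)"
    using A1 by (auto simp: jet_aut_def smooth_map_linear jac_linear pullback_linear M_def[abs_def] invertible_left_inverse)
  then show "A \<in> Aut r G"
    unfolding Aut_eq[OF G(1)] using jac_linear[of A 0] by (metis (mono_tags, lifting) mem_Collect_eq)
qed


section \<open>Taylor polynomials in complex coordinates\<close>

definition cz :: "real^2 \<Rightarrow> complex" where
  "cz x = Complex (x$1) (x$2)"

text \<open>Coefficients outside the triangle \<open>a + b \<le> n\<close> are ignored, so an array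
  is determined by its polynomial only inside the triangle.\<close>

definition cpoly :: "nat \<Rightarrow> (nat \<Rightarrow> nat \<Rightarrow> complex) \<Rightarrow> real^2 \<Rightarrow> complex" where
  "cpoly n c x = (\<Sum>(a, b)\<in>{(a, b). a + b \<le> n}. c a b * (cz x ^ a * cnj (cz x) ^ b))"

lemma finite_triangle: "finite {(a, b). a + b \<le> (n::nat)}"
  by (rule finite_subset[of _ "{..n} \<times> {..n}"]) auto

lemma norm_cz: "norm (cz x) = norm x"
  by (simp add: cz_def complex_norm norm_vec_def L2_set_def UNIV_2)

lemma vanish_cz: "vanish 1 cz"
  by (rule vanishI[of 1 _ 1]) (auto simp: norm_cz)

lemma vanish_of_real_iff: "vanish k (\<lambda>x. complex_of_real (f x)) \<longleftrightarrow> vanish k f"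
  by (simp add: vanish_def)

lemma vanish_cnj_iff: "vanish k (\<lambda>x. cnj (f x)) \<longleftrightarrow> vanish k f"
  by (simp add: vanish_def)

lemma cpoly_add: "cpoly n (\<lambda>a b. c a b + d a b) x = cpoly n c x + cpoly n d x"
  by (simp add: cpoly_def case_prod_unfold algebra_simps sum.distrib)

lemma cpoly_diff: "cpoly n (\<lambda>a b. c a b - d a b) x = cpoly n c x - cpoly n d x"
  by (simp add: cpoly_def case_prod_unfold algebra_simps sum_subtractf)

lemma cpoly_scale: "cpoly n (\<lambda>a b. k * c a b) x = k * cpoly n c x"
  by (simp add: cpoly_def case_prod_unfold sum_distrib_left mult_ac)

lemma cpoly_cong: "(\<And>a b. a + b \<le> n \<Longrightarrow> c a b = d a b) \<Longrightarrow> cpoly n c x = cpoly n d x"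
  unfolding cpoly_def by (rule sum.cong) auto

lemma sum_triangle_swap:
  "(\<Sum>(a, b)\<in>{(a, b). a + b \<le> (n::nat)}. f a b) = (\<Sum>(a, b)\<in>{(a, b). a + b \<le> n}. f b a)"
  by (rule sum.reindex_bij_witness[of _ prod.swap prod.swap]) auto

lemma cnj_cpoly: "cnj (cpoly n c x) = cpoly n (\<lambda>a b. cnj (c b a)) x"
  unfolding cpoly_def by (subst sum_triangle_swap) (simp add: case_prod_unfold mult_ac)

lemma cpoly_mult_z: "cz x * cpoly n c x = cpoly (Suc n) (\<lambda>a b. if a = 0 then 0 else c (a - 1) b) x"
proof -
  have "cpoly (Suc n) (\<lambda>a b. if a = 0 then 0 else c (a - 1) b) x =
      (\<Sum>(a, b)\<in>(\<lambda>(a, b). (Suc a, b)) ` {(a, b). a + b \<le> n}.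
        (if a = 0 then 0 else c (a - 1) b) * (cz x ^ a * cnj (cz x) ^ b))"
    unfolding cpoly_def
  proof (rule sum.mono_neutral_right[OF finite_triangle])
    show "\<forall>i\<in>{(a, b). a + b \<le> Suc n} - (\<lambda>(a, b). (Suc a, b)) ` {(a, b). a + b \<le> n}.
       (case i of (a, b) \<Rightarrow> (if a = 0 then 0 else c (a - 1) b) * (cz x ^ a * cnj (cz x) ^ b)) = 0"
    proof safe
      fix a b assume a: "a + b \<le> Suc n" "(a, b) \<notin> (\<lambda>(a, b). (Suc a, b)) ` {(a, b). a + b \<le> n}"
      have "a = 0"
        using a by (cases a) (auto simp: image_iff)
      then show "(if a = 0 then 0 else c (a - 1) b) * (cz x ^ a * cnj (cz x) ^ b) = 0" by simp
    qed
  qed auto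
  also have "\<dots> = (\<Sum>(a, b)\<in>{(a, b). a + b \<le> n}. cz x * (c a b * (cz x ^ a * cnj (cz x) ^ b)))"
    by (subst sum.reindex) (auto simp: inj_on_def case_prod_unfold mult_ac intro!: sum.cong)
  finally show ?thesis
    by (simp add: cpoly_def sum_distrib_left case_prod_unfold)
qed

lemma cpoly_mult_cnj_z: "cnj (cz x) * cpoly n c x = cpoly (Suc n) (\<lambda>a b. if b = 0 then 0 else c a (b - 1)) x"
proof -
  have "cnj (cz x) * cpoly n c x = cnj (cz x * cpoly n (\<lambda>a b. cnj (c b a)) x)"
    by (simp add: cnj_cpoly)
  then show ?thesis
    unfolding cpoly_mult_z cnj_cpoly by (simp add: if_distrib[of cnj] cong: if_cong)
qed

definition is_cpoly :: "nat \<Rightarrow> (real^2 \<Rightarrow> complex) \<Rightarrow> bool" where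
  "is_cpoly n f \<longleftrightarrow> (\<exists>c. f = cpoly n c)"

lemma is_cpoly_add: "is_cpoly n f \<Longrightarrow> is_cpoly n g \<Longrightarrow> is_cpoly n (\<lambda>x. f x + g x)"
  unfolding is_cpoly_def by (auto simp: cpoly_add[symmetric, abs_def])

lemma is_cpoly_scale: "is_cpoly n f \<Longrightarrow> is_cpoly n (\<lambda>x. k * f x)"
  unfolding is_cpoly_def by (auto simp: cpoly_scale[symmetric, abs_def])

lemma is_cpoly_zero: "is_cpoly n (\<lambda>x. 0)"
  unfolding is_cpoly_def by (rule exI[of _ "\<lambda>a b. 0"]) (simp add: cpoly_def fun_eq_iff case_prod_unfold)

lemma is_cpoly_sum: "(\<And>i. i \<in> I \<Longrightarrow> is_cpoly n (f i)) \<Longrightarrow> is_cpoly n (\<lambda>x. \<Sum>i\<in>I. f i x)"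
  by (induction I rule: infinite_finite_induct) (auto intro: is_cpoly_zero is_cpoly_add)

lemma is_cpoly_one: "is_cpoly 0 (\<lambda>x. 1)"
proof -
  have "{(a, b). a + b \<le> (0::nat)} = {(0, 0)}" by auto
  then show ?thesis
    unfolding is_cpoly_def by (intro exI[of _ "\<lambda>a b. 1"]) (simp add: cpoly_def fun_eq_iff)
qed

lemma is_cpoly_Suc: "is_cpoly n f \<Longrightarrow> is_cpoly (Suc n) f"
proof -
  assume "is_cpoly n f"
  then obtain c where c: "f = cpoly n c" unfolding is_cpoly_def by blast
  have "cpoly (Suc n) (\<lambda>a b. if a + b \<le> n then c a b else 0) x = cpoly n c x" for x
    unfolding cpoly_def
    by (rule sum.mono_neutral_cong_right[OF finite_triangle]) (auto split: if_splits)
  then have "f = cpoly (Suc n) (\<lambda>a b. if a + b \<le> n then c a b else 0)"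
    unfolding c by (simp add: fun_eq_iff)
  then show ?thesis unfolding is_cpoly_def by blast
qed

lemma is_cpoly_mult_coord: "is_cpoly n f \<Longrightarrow> is_cpoly (Suc n) (\<lambda>x. complex_of_real (x $ i) * f x)"
proof -
  assume "is_cpoly n f"
  then obtain c where c: "f = cpoly n c" unfolding is_cpoly_def by blast
  have z: "is_cpoly (Suc n) (\<lambda>x. cz x * f x)" "is_cpoly (Suc n) (\<lambda>x. cnj (cz x) * f x)"
    unfolding is_cpoly_def c using cpoly_mult_z[where n = n and c = c] cpoly_mult_cnj_z[where n = n and c = c]
    by (auto simp: fun_eq_iff)
  have "\<exists>p q. \<forall>x::real^2. complex_of_real (x $ i) = p * cz x + q * cnj (cz x)"
  proof (cases "i = 1")
    case True
    then show ?thesis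
      by (intro exI[of _ "1/2"]) (auto simp: complex_eq_iff cz_def)
  next
    case False
    then have "i = 2" using exhaust_2 by blast
    then show ?thesis
      by (intro exI[of _ "- \<i> / 2"] exI[of _ "\<i> / 2"]) (auto simp: complex_eq_iff cz_def)
  qed
  then obtain p q where "\<And>x::real^2. complex_of_real (x $ i) = p * cz x + q * cnj (cz x)" by blast
  then show ?thesis
    using is_cpoly_add[OF is_cpoly_scale[OF z(1), of p] is_cpoly_scale[OF z(2), of q]]
    by (simp add: algebra_simps)
qed

lemma is_cpoly_monomial: "is_cpoly (a + b) (\<lambda>x. complex_of_real (x$1 ^ a * x$2 ^ b))"
proof (induction a)
  case 0
  show ?case
  proof (induction b)
    case (Suc b)
    then show ?case using is_cpoly_mult_coord[OF Suc, of 2] by simp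
  qed (simp add: is_cpoly_one)
next
  case (Suc a)
  then show ?case using is_cpoly_mult_coord[OF Suc, of 1] by (simp add: mult_ac)
qed

text \<open>One homogeneous part is added per degree. The induction carries a real smooth polynomial
  next to its complex form, because \<open>homogeneous_part\<close> applies to real
  functions.\<close>

lemma taylor_cpoly:
  assumes f: "smooth_fn f"
  shows "\<exists>c. vanish (Suc n) (\<lambda>x. of_real (f x) - cpoly n c x)"
proof -
  have "\<exists>p. smooth_fn p \<and> is_cpoly n (\<lambda>x. of_real (p x)) \<and> vanish (Suc n) (\<lambda>x. f x - p x)"
  proof (induction n)
    case 0
    obtain c where "vanish (Suc 0) (\<lambda>x. f x - (\<Sum>a\<le>0. c a * (x$1 ^ a * x$2 ^ (0 - a))))"
      using homogeneous_part[OF f vanish_smooth[OF f]] by blast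
    then show ?case
      using is_cpoly_scale[OF is_cpoly_one, of "of_real (c 0)"]
      by (intro exI[of _ "\<lambda>x. c 0"]) (simp add: smooth_fn_const)
  next
    case (Suc n)
    then obtain p where p: "smooth_fn p" "is_cpoly n (\<lambda>x. of_real (p x))" "vanish (Suc n) (\<lambda>x. f x - p x)"
      by blast
    obtain c where c: "vanish (Suc (Suc n)) (\<lambda>x. f x - p x - (\<Sum>a\<le>Suc n. c a * (x$1 ^ a * x$2 ^ (Suc n - a))))"
      using homogeneous_part[OF smooth_fn_diff[OF f p(1)] p(3)] by blast
    define q :: "real^2 \<Rightarrow> real" where "q x = (\<Sum>a\<le>Suc n. c a * (x$1 ^ a * x$2 ^ (Suc n - a)))" for x
    have "smooth_fn q" unfolding q_def by (intro smooth_intros)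
    moreover have "is_cpoly (Suc n) (\<lambda>x. of_real (q x))"
    proof -
      have "is_cpoly (Suc n) (\<lambda>x. \<Sum>a\<le>Suc n. of_real (c a) * of_real (x$1 ^ a * x$2 ^ (Suc n - a)))"
      proof (intro is_cpoly_sum is_cpoly_scale)
        fix a assume "a \<in> {..Suc n}"
        then show "is_cpoly (Suc n) (\<lambda>x. complex_of_real (x$1 ^ a * x$2 ^ (Suc n - a)))"
          using is_cpoly_monomial[of a "Suc n - a"] by simp
      qed
      then show ?thesis by (simp only: q_def of_real_sum of_real_mult)
    qed
    moreover have "vanish (Suc (Suc n)) (\<lambda>x. f x - p x - q x)" using c by (simp only: q_def)
    ultimately show ?case
      using p is_cpoly_add[OF is_cpoly_Suc[OF p(2)], of "\<lambda>x. of_real (q x)"]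
      by (intro exI[of _ "\<lambda>x. p x + q x"]) (auto simp: smooth_fn_add diff_diff_eq)
  qed
  then obtain p c where "vanish (Suc n) (\<lambda>x. f x - p x)" "(\<lambda>x. of_real (p x)) = cpoly n c"
    unfolding is_cpoly_def by blast
  then have "vanish (Suc n) (\<lambda>x. complex_of_real (f x - p x))" "\<And>x. of_real (p x) = cpoly n c x"
    by (simp_all only: vanish_of_real_iff fun_eq_iff)
  then show ?thesis by auto
qed

text \<open>Letting \<open>t\<close> tend to 0 from the right kills the constant coefficient;
  dividing by \<open>t\<close> lowers the degree and the exponent of the bound together.\<close>

lemma small_polynomial_zero:
  fixes q :: "nat \<Rightarrow> complex"
  assumes "e > 0" "\<And>t. 0 < t \<Longrightarrow> t < e \<Longrightarrow> norm (\<Sum>j\<le>n. q j * of_real t ^ j) \<le> C * t ^ Suc n"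
  shows "j \<le> n \<Longrightarrow> q j = 0"
  using assms(2)
proof (induction n arbitrary: q j)
  case (0 q)
  have "((\<lambda>t. norm (q 0)) \<longlongrightarrow> norm (q 0)) (at_right (0::real))" by simp
  moreover have "((\<lambda>t. C * t) \<longlongrightarrow> C * 0) (at_right (0::real))" by (intro tendsto_intros)
  moreover have "\<forall>\<^sub>F t in at_right 0. norm (q 0) \<le> C * t"
    using 0(2) assms(1) by (auto simp: eventually_at_right_field intro!: exI[of _ e])
  ultimately have "norm (q 0) \<le> C * 0"
    by (intro tendsto_le[OF trivial_limit_at_right_real])
  then show ?case using 0 by simp
next
  case (Suc n q)
  let ?f = "\<lambda>t::real. \<Sum>j\<le>Suc n. q j * of_real t ^ j"
  have "isCont ?f 0" by (intro continuous_intros)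
  then have "(?f \<longlongrightarrow> ?f 0) (at_right 0)"
    by (simp add: isCont_def filterlim_at_split del: sum.atMost_Suc)
  moreover have "?f 0 = q 0" by (simp add: sum.atMost_Suc_shift del: sum.atMost_Suc)
  ultimately have "((\<lambda>t. norm (?f t)) \<longlongrightarrow> norm (q 0)) (at_right 0)"
    using tendsto_norm by fastforce
  moreover have "((\<lambda>t. C * t ^ Suc (Suc n)) \<longlongrightarrow> C * 0 ^ Suc (Suc n)) (at_right (0::real))"
    by (intro tendsto_intros)
  moreover have "\<forall>\<^sub>F t in at_right 0. norm (?f t) \<le> C * t ^ Suc (Suc n)"
    using Suc.prems(2) assms(1)
    by (auto simp: eventually_at_right_field simp del: sum.atMost_Suc intro!: exI[of _ e])
  ultimately have "norm (q 0) \<le> C * 0 ^ Suc (Suc n)"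
    by (intro tendsto_le[OF trivial_limit_at_right_real])
  then have q0: "q 0 = 0" by simp
  have "norm (\<Sum>j\<le>n. q (Suc j) * of_real t ^ j) \<le> C * t ^ Suc n" if t: "0 < t" "t < e" for t
  proof -
    have "?f t = of_real t * (\<Sum>j\<le>n. q (Suc j) * of_real t ^ j)"
      by (simp add: sum.atMost_Suc_shift q0 sum_distrib_left mult_ac del: sum.atMost_Suc)
    then have "t * norm (\<Sum>j\<le>n. q (Suc j) * of_real t ^ j) \<le> t * (C * t ^ Suc n)"
      using Suc.prems(2)[OF t] t by (simp add: norm_mult mult_ac del: sum.atMost_Suc)
    then show ?thesis using t by simp
  qed
  then have "q (Suc j) = 0" if "j \<le> n" for j
    using Suc.IH[of j "\<lambda>j. q (Suc j)"] that by blast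
  then show ?case using Suc.prems(1) q0 by (cases j) auto
qed

text \<open>Along the ray through a unit complex number \<open>w\<close> the polynomial becomes one
  in the radius, so each homogeneous part vanishes on the unit circle. Multiplied by
  \<open>w ^ j\<close>, the part of degree \<open>j\<close> is an ordinary polynomial of degree at
  most \<open>j\<close> in the square of \<open>w\<close>.\<close>

lemma cpoly_unique:
  assumes v: "vanish (Suc n) (cpoly n c)" and ab: "a + b \<le> n"
  shows "c a b = 0"
proof -
  define j where "j = a + b"
  have q: "(\<Sum>k\<le>j. c k (j - k) * (w ^ k * cnj w ^ (j - k))) = 0" if w: "norm w = 1" for w
  proof -
    obtain C e where C: "C \<ge> 0" "e > 0" "\<And>x. norm x < e \<Longrightarrow> norm (cpoly n c x) \<le> C * norm x ^ Suc n"
      using v by (rule vanishE) blast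
    show ?thesis
    proof (rule small_polynomial_zero[where e = e and n = n and C = C and j = j
          and q = "\<lambda>j. \<Sum>k\<le>j. c k (j - k) * (w ^ k * cnj w ^ (j - k))"])
      fix t :: real assume t: "0 < t" "t < e"
      define x :: "real^2" where "x = (\<chi> i. t * (if i = 1 then Re w else Im w))"
      have x: "cz x = of_real t * w"
        by (simp add: cz_def x_def complex_eq_iff)
      then have nx: "norm x = t"
        using norm_cz[of x] w t by (simp add: norm_mult)
      have "cpoly n c x = (\<Sum>j\<le>n. \<Sum>k\<le>j. c k (j - k) * (cz x ^ k * cnj (cz x) ^ (j - k)))"
        unfolding cpoly_def by (rule sum.triangle_reindex_eq)
      also have "\<dots> = (\<Sum>j\<le>n. (\<Sum>k\<le>j. c k (j - k) * (w ^ k * cnj w ^ (j - k))) * of_real t ^ j)"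
      proof (rule sum.cong[OF refl])
        fix j
        have "cz x ^ k * cnj (cz x) ^ (j - k) = w ^ k * cnj w ^ (j - k) * of_real t ^ j" if "k \<le> j" for k
        proof -
          have "(of_real t :: complex) ^ j = of_real t ^ k * of_real t ^ (j - k)"
            using that by (simp flip: power_add)
          then show ?thesis by (simp add: x power_mult_distrib mult_ac)
        qed
        then show "(\<Sum>k\<le>j. c k (j - k) * (cz x ^ k * cnj (cz x) ^ (j - k))) =
          (\<Sum>k\<le>j. c k (j - k) * (w ^ k * cnj w ^ (j - k))) * of_real t ^ j"
          unfolding sum_distrib_right by (intro sum.cong) (auto simp: mult_ac)
      qed
      finally show "norm (\<Sum>j\<le>n. (\<Sum>k\<le>j. c k (j - k) * (w ^ k * cnj w ^ (j - k))) * of_real t ^ j) \<le> C * t ^ Suc n"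
        using C(3)[of x] nx t by simp
    qed (use C ab in \<open>auto simp: j_def\<close>)
  qed
  \<comment> \<open>The roots of unity of order \<open>Suc j\<close> are one root more than a
    nonzero polynomial of degree \<open>j\<close> can have.\<close>
  have "{u::complex. u ^ Suc j = 1} \<subseteq> {u. (\<Sum>k\<le>j. c k (j - k) * u ^ k) = 0}"
  proof safe
    fix u :: complex assume "u ^ Suc j = 1"
    then have u: "norm u = 1"
      by (metis norm_one norm_power norm_ge_zero power_eq_1_iff nat.distinct(1))
    define w where "w = csqrt u"
    have w: "norm w = 1" "w\<^sup>2 = u" using u by (simp_all add: w_def norm_csqrt)
    have "w * cnj w = 1" using w(1) by (simp add: complex_norm_square[symmetric])
    then have "w ^ k * cnj w ^ (j - k) * w ^ j = u ^ k" if "k \<le> j" for k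
    proof -
      have "w ^ k * cnj w ^ (j - k) * w ^ j = w ^ k * w ^ k * (w * cnj w) ^ (j - k)"
        using that by (simp add: power_mult_distrib mult_ac flip: power_add)
      also have "\<dots> = u ^ k"
        using \<open>w * cnj w = 1\<close> w(2) by (simp add: power2_eq_square flip: power_mult_distrib)
      finally show ?thesis .
    qed
    then have "(\<Sum>k\<le>j. c k (j - k) * u ^ k) = (\<Sum>k\<le>j. c k (j - k) * (w ^ k * cnj w ^ (j - k))) * w ^ j"
      unfolding sum_distrib_right by (intro sum.cong) (auto simp: mult_ac)
    then show "(\<Sum>k\<le>j. c k (j - k) * u ^ k) = 0" by (simp add: q[OF w(1)])
  qed
  moreover have "card {u::complex. u ^ Suc j = 1} = Suc j" by (rule card_roots_unity_eq) simp
  ultimately have "\<not> (\<exists>k\<le>j. c k (j - k) \<noteq> 0)"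
    using polyfun_rootbound[of j "\<lambda>k. c k (j - k)"] card_mono[of "{u. (\<Sum>k\<le>j. c k (j - k) * u ^ k) = 0}" "{u::complex. u ^ Suc j = 1}"]
    by fastforce
  then show ?thesis unfolding j_def by (metis diff_add_inverse le_add1)
qed


section \<open>Types of jets as stabilisers of coefficient arrays\<close>

text \<open>The real matrix of multiplication by \<open>u\<close>; with a complex parameter instead
  of an angle, the symmetry conditions become equations between powers of \<open>u\<close>.\<close>

definition rotc :: "complex \<Rightarrow> real^2^2" where
  "rotc u = (\<chi> i j. if i = 1 then (if j = 1 then Re u else - Im u) else (if j = 1 then Im u else Re u))"

lemma rot_eq_rotc: "rot \<theta> = rotc (cis \<theta>)"
  by (simp add: vec_eq_iff rot_def rotc_def)

lemma rotc_nth: "rotc u $ 1 $ 1 = Re u" "rotc u $ 1 $ 2 = - Im u" "rotc u $ 2 $ 1 = Im u" "rotc u $ 2 $ 2 = Re u"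
  by (simp_all add: rotc_def)

lemma refl0_nth: "refl0 $ 1 $ 1 = 1" "refl0 $ 1 $ 2 = 0" "refl0 $ 2 $ 1 = 0" "refl0 $ 2 $ 2 = - 1"
  by (simp_all add: refl0_def)

lemmas rotc_simps = vec_eq_iff forall_2 matrix_vector_mult_nth matrix_matrix_mult_nth transpose_nth mat_1_nth
  rotc_nth refl0_nth

lemma O2_rotc_cases:
  "A \<in> O2 \<longleftrightarrow> (\<exists>u. norm u = 1 \<and> (A = rotc u \<or> A = rotc u ** refl0))"
proof
  assume "A \<in> O2"
  then have e: "A$1$1 * A$1$1 + A$2$1 * A$2$1 = 1" "A$1$1 * A$1$2 + A$2$1 * A$2$2 = 0"
     "A$1$2 * A$1$2 + A$2$2 * A$2$2 = 1"
    by (auto simp: O2_def rotc_simps)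
  \<comment> \<open>The determinant: orthogonality makes the second column \<open>D\<close> times
    the first one turned by a right angle, and \<open>D\<close> is a sign.\<close>
  define D where "D = A$1$1 * A$2$2 - A$1$2 * A$2$1"
  have d: "A$2$2 = A$1$1 * D" "A$1$2 = - A$2$1 * D"
    using e(1,2) unfolding D_def by algebra+
  have "D * D = 1" using e(1,3) unfolding d by algebra
  then have D: "D = 1 \<or> D = - 1" by (simp add: square_eq_1_iff)
  let ?u = "Complex (A$1$1) (A$2$1)"
  have "norm ?u = 1" using e(1) by (simp add: complex_norm power2_eq_square)
  moreover have "A = rotc ?u \<or> A = rotc ?u ** refl0"
    using D d by (auto simp: rotc_simps)
  ultimately show "\<exists>u. norm u = 1 \<and> (A = rotc u \<or> A = rotc u ** refl0)" by blast
next
  assume "\<exists>u. norm u = 1 \<and> (A = rotc u \<or> A = rotc u ** refl0)"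
  then obtain u where u: "norm u = 1" "A = rotc u \<or> A = rotc u ** refl0" by blast
  have "Re u * Re u + Im u * Im u = 1"
    using u(1) by (simp add: norm_complex_def power2_eq_square)
  then show "A \<in> O2" using u(2) by (auto simp: O2_def rotc_simps)
qed

lemma cz_rotc: "cz (rotc u *v x) = u * cz x"
  by (simp add: cz_def complex_eq_iff rotc_simps)

lemma cz_refl0: "cz (refl0 *v x) = cnj (cz x)"
  by (simp add: cz_def complex_eq_iff rotc_simps)

lemma cpoly_rotc: "cpoly n c (rotc u *v x) = cpoly n (\<lambda>a b. c a b * (u ^ a * cnj u ^ b)) x"
  by (simp add: cpoly_def cz_rotc power_mult_distrib mult_ac)

lemma cpoly_refl0: "cpoly n c (refl0 *v x) = cpoly n (\<lambda>a b. c b a) x"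
  unfolding cpoly_def by (subst sum_triangle_swap) (simp add: cz_refl0 mult_ac)

lemma vanish_cpoly_diff_iff:
  "vanish (Suc n) (\<lambda>x. cpoly n c x - cpoly n d x) \<longleftrightarrow> (\<forall>a b. a + b \<le> n \<longrightarrow> c a b = d a b)"
proof
  assume "vanish (Suc n) (\<lambda>x. cpoly n c x - cpoly n d x)"
  then have "vanish (Suc n) (cpoly n (\<lambda>a b. c a b - d a b))"
    by (simp add: cpoly_diff[abs_def])
  then show "\<forall>a b. a + b \<le> n \<longrightarrow> c a b = d a b"
    using cpoly_unique by fastforce
next
  assume "\<forall>a b. a + b \<le> n \<longrightarrow> c a b = d a b"
  then have "cpoly n c x = cpoly n d x" for x by (intro cpoly_cong) auto
  then show "vanish (Suc n) (\<lambda>x. cpoly n c x - cpoly n d x)" by (simp add: vanish_zero)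
qed

text \<open>In normal coordinates the trace of the metric is \<open>2 + \<Sum> c a b z^a cnj z^b\<close>. It is real, and the
  Gauss lemma makes the sum divisible by \<open>\<bar>z\<bar>^2\<close>.\<close>

definition admissible :: "nat \<Rightarrow> (nat \<Rightarrow> nat \<Rightarrow> complex) \<Rightarrow> bool" where
  "admissible r c \<longleftrightarrow> (\<forall>a b. c b a = cnj (c a b)) \<and> (\<forall>a. c a 0 = 0) \<and> (\<forall>a b. r < a + b \<longrightarrow> c a b = 0)"

text \<open>The two families substitute \<open>u * z\<close> and \<open>u * cnj z\<close> for
  \<open>z\<close>, and compare coefficients. Factors \<open>cnj u\<close> are cleared by powers of
  \<open>u\<close>, as \<open>u\<close> has norm 1, so that both conditions concern powers of
  \<open>u\<close> only.\<close>

definition Stab :: "(nat \<Rightarrow> nat \<Rightarrow> complex) \<Rightarrow> (real^2^2) set" where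
  "Stab c = {rotc u | u. norm u = 1 \<and> (\<forall>a b. c a b * u ^ a = c a b * u ^ b)} \<union>
     {rotc u ** refl0 | u. norm u = 1 \<and> (\<forall>a b. c a b * u ^ a = cnj (c a b) * u ^ b)}"

lemma unit_power_cancel:
  assumes "norm u = 1"
  shows "p * (u ^ a * cnj u ^ b) = q \<longleftrightarrow> p * u ^ a = q * u ^ b"
proof -
  have u: "u \<noteq> 0" "u * cnj u = 1" using assms by (auto simp: complex_norm_square[symmetric])
  have "p * (u ^ a * cnj u ^ b) = q \<longleftrightarrow> p * (u ^ a * cnj u ^ b) * u ^ b = q * u ^ b"
    using u(1) by simp
  also have "p * (u ^ a * cnj u ^ b) * u ^ b = p * u ^ a * (u * cnj u) ^ b"
    by (simp add: power_mult_distrib mult_ac)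
  finally show ?thesis using u(2) by simp
qed

lemma invariant_iff_Stab:
  assumes c: "admissible r c" and A: "A \<in> O2"
  shows "vanish (Suc r) (\<lambda>x. cpoly r c (A *v x) - cpoly r c x) \<longleftrightarrow> A \<in> Stab c"
proof -
  have herm: "c b a = cnj (c a b)" and supp: "r < a + b \<Longrightarrow> c a b = 0" for a b
    using c unfolding admissible_def by blast+
  have rot: "vanish (Suc r) (\<lambda>x. cpoly r c (rotc u *v x) - cpoly r c x) \<longleftrightarrow>
      (\<forall>a b. c a b * u ^ a = c a b * u ^ b)" if u: "norm u = 1" for u
  proof -
    have "(\<forall>a b. a + b \<le> r \<longrightarrow> c a b * u ^ a = c a b * u ^ b) \<longleftrightarrow> (\<forall>a b. c a b * u ^ a = c a b * u ^ b)"
      using supp by (metis mult_zero_left not_le)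
    then show ?thesis
      unfolding cpoly_rotc vanish_cpoly_diff_iff unit_power_cancel[OF u] .
  qed
  have ref: "vanish (Suc r) (\<lambda>x. cpoly r c ((rotc u ** refl0) *v x) - cpoly r c x) \<longleftrightarrow>
      (\<forall>a b. c a b * u ^ a = cnj (c a b) * u ^ b)" if u: "norm u = 1" for u
  proof -
    have "(\<forall>a b. a + b \<le> r \<longrightarrow> c b a * u ^ b = c a b * u ^ a) \<longleftrightarrow> (\<forall>a b. c a b * u ^ a = cnj (c a b) * u ^ b)"
      using supp herm by (metis complex_cnj_zero mult_zero_left not_le)
    then show ?thesis
      unfolding matrix_vector_mul_assoc[symmetric] cpoly_rotc cpoly_refl0 vanish_cpoly_diff_iff
        unit_power_cancel[OF u] .
  qed
  \<comment> \<open>Rotations and reflections are disjoint and each is parametrised injectively, so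
    membership in the union \<open>Stab c\<close> can be read off from the single parameter of
    \<open>A\<close>.\<close>
  have det: "rotc u \<noteq> rotc v ** refl0" if "norm u = 1" for u v
  proof
    assume "rotc u = rotc v ** refl0"
    then have "Re u = 0" "Im u = 0" by (auto simp: rotc_simps)
    with that show False by (simp add: norm_complex_def)
  qed
  have inj: "rotc u = rotc v \<longleftrightarrow> u = v" "rotc u ** refl0 = rotc v ** refl0 \<longleftrightarrow> u = v" for u v
    by (auto simp: rotc_simps complex_eq_iff)
  obtain u where u: "norm u = 1" "A = rotc u \<or> A = rotc u ** refl0"
    using A O2_rotc_cases by blast
  from u(2) show ?thesis
  proof
    assume [simp]: "A = rotc u"
    have "rotc u \<in> Stab c \<longleftrightarrow> (\<forall>a b. c a b * u ^ a = c a b * u ^ b)"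
      using det[OF u(1)] inj u(1) unfolding Stab_def by auto
    then show ?thesis using rot[OF u(1)] by simp
  next
    assume [simp]: "A = rotc u ** refl0"
    have "rotc u ** refl0 \<in> Stab c \<longleftrightarrow> (\<forall>a b. c a b * u ^ a = cnj (c a b) * u ^ b)"
      using det[symmetric] inj u(1) unfolding Stab_def by auto
    then show ?thesis using ref[OF u(1)] by simp
  qed
qed

lemma Stab_subset_O2: "Stab c \<subseteq> O2"
  unfolding Stab_def using O2_rotc_cases by blast

lemma vanish_cong_diff:
  assumes "vanish k (\<lambda>x. f x - g x)" shows "vanish k f \<longleftrightarrow> vanish k g"
  using vanish_diff[OF _ assms, of f] vanish_add[OF _ assms, of g] by auto

lemma Aut_eq_Stab:
  assumes G: "smooth_mat G" "\<And>x. transpose (G x) = G x" "G 0 = mat 1" "vanish (r + 2) (\<lambda>x. G x *v x - x)"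
    and c: "admissible r c"
    and t: "vanish (Suc r) (\<lambda>x. of_real (G x $ 1 $ 1 + G x $ 2 $ 2) - (2 + cpoly r c x))"
  shows "Aut r G = Stab c"
proof -
  let ?t = "\<lambda>x. G x $ 1 $ 1 + G x $ 2 $ 2"
  have "vanish (Suc r) (\<lambda>x. ?t (A *v x) - ?t x) \<longleftrightarrow> A \<in> Stab c" if A: "A \<in> O2" for A
  proof -
    have "vanish (Suc r) (\<lambda>x. (complex_of_real (?t (A *v x)) - (2 + cpoly r c (A *v x))) -
        (of_real (?t x) - (2 + cpoly r c x)))"
      by (rule vanish_diff[OF vanish_compose[OF t vanish_1_map[OF smooth_map_linear]] t]) simp
    then have "vanish (Suc r) (\<lambda>x. complex_of_real (?t (A *v x) - ?t x) - (cpoly r c (A *v x) - cpoly r c x))"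
      by (simp add: algebra_simps)
    from vanish_cong_diff[OF this] show ?thesis
      unfolding vanish_of_real_iff invariant_iff_Stab[OF c A] .
  qed
  then show ?thesis
    unfolding Aut_normal[OF G] using Stab_subset_O2 by auto
qed

text \<open>The trace is real, so its Taylor array equals its conjugate transpose by uniqueness.
  That the pure powers of \<open>z\<close> are absent comes from the Gauss lemma, read as a complex
  equation of degree \<open>r + 1\<close>.\<close>

lemma admissible_exists:
  assumes G: "smooth_mat G" "\<And>x. transpose (G x) = G x" "vanish (r + 2) (\<lambda>x. G x *v x - x)"
  shows "\<exists>c. admissible r c \<and> vanish (Suc r) (\<lambda>x. of_real (G x $ 1 $ 1 + G x $ 2 $ 2) - (2 + cpoly r c x))"
proof -
  define t where "t x = G x $ 1 $ 1 + G x $ 2 $ 2 - 2" for x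
  have sG: "smooth_fn (\<lambda>x. G x $ i $ j)" for i j using G(1) by (simp add: smooth_mat_def)
  have s: "G x $ 2 $ 1 = G x $ 1 $ 2" for x using G(2)[of x] by (metis transpose_nth)
  have "smooth_fn t" unfolding t_def by (intro smooth_fn_diff smooth_fn_add smooth_fn_const sG)
  then obtain c0 where c0: "vanish (Suc r) (\<lambda>x. of_real (t x) - cpoly r c0 x)"
    using taylor_cpoly by blast
  obtain d1 where d1: "vanish (Suc r) (\<lambda>x. of_real (G x $ 1 $ 1 - G x $ 2 $ 2) - cpoly r d1 x)"
    using taylor_cpoly[OF smooth_fn_diff[OF sG sG]] by blast
  obtain d2 where d2: "vanish (Suc r) (\<lambda>x. of_real (G x $ 1 $ 2) - cpoly r d2 x)"
    using taylor_cpoly[OF sG] by blast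
  define c where "c a b = (if a + b \<le> r then c0 a b else 0)" for a b
  have ct: "vanish (Suc r) (\<lambda>x. of_real (t x) - cpoly r c x)"
  proof -
    have "cpoly r c x = cpoly r c0 x" for x by (rule cpoly_cong) (simp add: c_def)
    then show ?thesis using c0 by simp
  qed
  have supp: "r < a + b \<Longrightarrow> c a b = 0" for a b by (simp add: c_def)
  have herm: "c b a = cnj (c a b)" for a b
  proof -
    have "vanish (Suc r) (\<lambda>x. cnj (of_real (t x) - cpoly r c x))"
      using ct by (simp only: vanish_cnj_iff)
    then have "vanish (Suc r) (\<lambda>x. of_real (t x) - cpoly r (\<lambda>a b. cnj (c b a)) x)"
      by (simp add: cnj_cpoly)
    from vanish_diff[OF this ct]
    have "vanish (Suc r) (\<lambda>x. cpoly r c x - cpoly r (\<lambda>a b. cnj (c b a)) x)" by simp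
    then show ?thesis
      unfolding vanish_cpoly_diff_iff using supp
      by (metis add.commute complex_cnj_zero not_le)
  qed
  have c0: "c a 0 = 0" for a
  proof (cases "a \<le> r")
    case True
    \<comment> \<open>The array of \<open>2 * cz (G x *v x - x)\<close>, which is \<open>t\<close>
      times \<open>z\<close> plus a complex combination of the other entries of \<open>G\<close>
      times \<open>cnj z\<close>. Without a factor \<open>cnj z\<close> only the first summand
      contributes, so the column \<open>b = 0\<close> of \<open>e\<close> is the column
      \<open>b = 0\<close> of \<open>c\<close>, shifted by one.\<close>
    define e where "e a b = (if a = 0 then 0 else c (a - 1) b) + (if b = 0 then 0 else d1 a (b - 1) + 2 * \<i> * d2 a (b - 1))" for a b
    let ?R = "\<lambda>x. (of_real (t x) - cpoly r c x)"
    let ?S = "\<lambda>x. (of_real (G x $ 1 $ 1 - G x $ 2 $ 2) - cpoly r d1 x) + 2 * \<i> * (of_real (G x $ 1 $ 2) - cpoly r d2 x)"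
    have "vanish (0 + Suc r) (\<lambda>x. 2 * \<i> * (of_real (G x $ 1 $ 2) - cpoly r d2 x))"
      by (intro vanish_mult vanish_const d2)
    then have S: "vanish (Suc r) ?S" using d1 by (intro vanish_add) simp_all
    have v1: "vanish (Suc r + 1) (\<lambda>x. ?R x * cz x)" by (intro vanish_mult ct vanish_cz)
    have v2: "vanish (Suc r + 1) (\<lambda>x. ?S x * cnj (cz x))"
      using vanish_cz by (intro vanish_mult S) (simp only: vanish_cnj_iff)
    have "norm (cz (G x *v x - x)) = norm (G x *v x - x)" for x by (rule norm_cz)
    then have "vanish (r + 2) (\<lambda>x. cz (G x *v x - x))"
      using G(3) by (simp add: vanish_def)
    then have v3: "vanish (0 + (r + 2)) (\<lambda>x. 2 * cz (G x *v x - x))"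
      by (rule vanish_mult[OF vanish_const])
    have "2 * cz (G x *v x - x) - ?R x * cz x - ?S x * cnj (cz x) = cpoly (Suc r) e x" for x
    proof -
      have "2 * cz (G x *v x - x) = of_real (t x) * cz x +
          (of_real (G x $ 1 $ 1 - G x $ 2 $ 2) + 2 * \<i> * of_real (G x $ 1 $ 2)) * cnj (cz x)"
        by (simp add: cz_def complex_eq_iff matrix_vector_mult_nth s t_def algebra_simps)
      then have "2 * cz (G x *v x - x) - ?R x * cz x - ?S x * cnj (cz x) =
          cz x * cpoly r c x + cnj (cz x) * (cpoly r d1 x + 2 * \<i> * cpoly r d2 x)"
        by (simp add: algebra_simps)
      also have "\<dots> = cz x * cpoly r c x + cnj (cz x) * cpoly r (\<lambda>a b. d1 a b + 2 * \<i> * d2 a b) x"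
        by (simp only: cpoly_add cpoly_scale)
      also have "\<dots> = cpoly (Suc r) e x"
        unfolding cpoly_mult_z cpoly_mult_cnj_z e_def by (simp only: cpoly_add)
      finally show ?thesis .
    qed
    moreover have "vanish (Suc (Suc r)) (\<lambda>x. 2 * cz (G x *v x - x) - ?R x * cz x - ?S x * cnj (cz x))"
      using v1 v2 v3 by (intro vanish_diff) auto
    ultimately have "vanish (Suc (Suc r)) (cpoly (Suc r) e)" by simp
    then have "e (Suc a) 0 = 0" by (rule cpoly_unique) (use True in simp)
    then show ?thesis by (simp add: e_def)
  qed (simp add: supp)
  have "vanish (Suc r) (\<lambda>x. of_real (G x $ 1 $ 1 + G x $ 2 $ 2) - (2 + cpoly r c x))"
    using ct by (simp add: t_def algebra_simps)
  moreover have "admissible r c"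
    unfolding admissible_def using herm c0 supp by blast
  ultimately show ?thesis by blast
qed

section \<open>Realising every admissible array by a metric\<close>

definition csmooth :: "(real^2 \<Rightarrow> complex) \<Rightarrow> bool" where
  "csmooth f \<longleftrightarrow> smooth_fn (\<lambda>x. Re (f x)) \<and> smooth_fn (\<lambda>x. Im (f x))"

lemma csmooth_const: "csmooth (\<lambda>x. k)"
  and csmooth_cz: "csmooth cz"
  and csmooth_cnj: "csmooth f \<Longrightarrow> csmooth (\<lambda>x. cnj (f x))"
  and csmooth_mult: "csmooth f \<Longrightarrow> csmooth g \<Longrightarrow> csmooth (\<lambda>x. f x * g x)"
  and csmooth_sum: "(\<And>i. i \<in> I \<Longrightarrow> csmooth (h i)) \<Longrightarrow> csmooth (\<lambda>x. \<Sum>i\<in>I. h i x)"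
  by (auto simp: csmooth_def cz_def intro!: smooth_intros)

lemma csmooth_power: "csmooth f \<Longrightarrow> csmooth (\<lambda>x. f x ^ n)"
  by (induction n) (auto intro: csmooth_const csmooth_mult)

text \<open>The metric \<open>I + h u u\<^sup>T\<close>, where \<open>u = (- x\<^sub>2, x\<^sub>1)\<close>.\<close>

definition radial_metric :: "(real^2 \<Rightarrow> real) \<Rightarrow> real^2 \<Rightarrow> real^2^2" where
  "radial_metric h x = (\<chi> i j. if i = 1 then (if j = 1 then 1 + h x * (x$2 * x$2) else - h x * (x$1 * x$2))
                    else (if j = 1 then - h x * (x$1 * x$2) else 1 + h x * (x$1 * x$1)))"

text \<open>The vector \<open>u\<close> is orthogonal to \<open>x\<close>, so the Gauss lemma holds
  exactly. By Lagrange's identity the perturbation of \<open>v \<bullet> v\<close> is at most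
  \<open>B * (x \<bullet> x)\<close> times \<open>v \<bullet> v\<close>, and the radius
  \<open>1 / (B + 1)\<close> makes the factor smaller than 1.\<close>

lemma riem_metric_radial:
  assumes h: "smooth_fn h"
  defines "G \<equiv> radial_metric h"
  shows "riem_metric G" "smooth_mat G" "\<And>x. transpose (G x) = G x" "G 0 = mat 1" "\<And>x. G x *v x = x"
    "\<And>x. G x $ 1 $ 1 + G x $ 2 $ 2 = 2 + h x * (x \<bullet> x)"
proof -
  have G: "G x $ 1 $ 1 = 1 + h x * (x$2 * x$2)" "G x $ 1 $ 2 = - h x * (x$1 * x$2)"
    "G x $ 2 $ 1 = - h x * (x$1 * x$2)" "G x $ 2 $ 2 = 1 + h x * (x$1 * x$1)" for x
    by (simp_all add: G_def radial_metric_def)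
  show s: "smooth_mat G"
    unfolding smooth_mat_def forall_2 G by (intro conjI smooth_intros h)
  show sym: "transpose (G x) = G x" for x
    by (simp add: vec_eq_iff forall_2 transpose_nth G)
  show "G 0 = mat 1" by (simp add: vec_eq_iff forall_2 mat_1_nth G)
  show "G x *v x = x" for x by (simp add: vec_eq_iff forall_2 matrix_vector_mult_nth G algebra_simps)
  show "G x $ 1 $ 1 + G x $ 2 $ 2 = 2 + h x * (x \<bullet> x)" for x
    by (simp add: G inner_2 algebra_simps)
  obtain B where B: "B \<ge> 0" "\<And>x. norm x \<le> 1 \<Longrightarrow> \<bar>h x\<bar> \<le> B" using smooth_fn_bounded[OF h] by blast
  have "v \<bullet> (G x *v v) > 0" if x: "x \<in> ball 0 (1 / (B + 1))" and v: "v \<noteq> 0" for x v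
  proof -
    have x1: "norm x * (B + 1) < 1" using x B by (simp add: less_divide_eq)
    moreover have "norm x * 1 \<le> norm x * (B + 1)" using B by (intro mult_left_mono) auto
    ultimately have nx: "norm x \<le> 1" by linarith
    have "x \<bullet> x \<le> norm x" using nx by (simp add: power2_norm_eq_inner[symmetric] power2_eq_square mult_left_le)
    then have "B * (x \<bullet> x) \<le> B * norm x" using B by (intro mult_left_mono)
    also have "\<dots> < 1" using x1 norm_ge_zero[of x] by (simp only: distrib_left mult.commute[of B])
    finally have Bx: "B * (x \<bullet> x) < 1" .
    let ?s = "x$2 * v$1 - x$1 * v$2"
    have eq: "v \<bullet> (G x *v v) = v \<bullet> v + h x * ?s\<^sup>2"
      by (simp add: inner_2 matrix_vector_mult_nth G power2_eq_square algebra_simps)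
    have "(x \<bullet> x) * (v \<bullet> v) = ?s\<^sup>2 + (x \<bullet> v)\<^sup>2"
      by (simp add: inner_2 power2_eq_square algebra_simps)
    then have s2: "?s\<^sup>2 \<le> (x \<bullet> x) * (v \<bullet> v)" by simp
    have "- (h x * ?s\<^sup>2) \<le> \<bar>h x\<bar> * ?s\<^sup>2"
      using abs_ge_minus_self[of "h x * ?s\<^sup>2"] by (simp add: abs_mult)
    also have "\<dots> \<le> B * ((x \<bullet> x) * (v \<bullet> v))"
      using B(1) B(2)[OF nx] s2 by (intro mult_mono) auto
    also have "\<dots> = (B * (x \<bullet> x)) * (v \<bullet> v)" by simp
    also have "\<dots> < 1 * (v \<bullet> v)" using Bx v by (intro mult_strict_right_mono) auto
    finally show ?thesis using eq by simp
  qed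
  moreover have "1 / (B + 1) > 0" using B by simp
  ultimately show "riem_metric G"
    using s sym unfolding riem_metric_def smooth_mat_def by blast
qed

text \<open>The trace of a radial metric exceeds 2 by \<open>h x * (x \<bullet> x)\<close>, so
  \<open>h\<close> has to be the polynomial divided by \<open>z * cnj z\<close>. The division is
  possible because row 0 and column 0 of an admissible array are zero, and the hermitian symmetry
  ensures that taking the real part loses nothing.\<close>

lemma metric_with_coefficients:
  assumes c: "admissible r c"
  obtains G where "riem_metric G" "smooth_mat G" "G 0 = mat 1" "Aut r G = Stab c"
proof -
  define h where "h x = Re (\<Sum>(a, b)\<in>{(a, b). a + b \<le> r}. if a = 0 \<or> b = 0 then 0 else
      c a b * (cz x ^ (a - 1) * cnj (cz x) ^ (b - 1)))" for x
  have "csmooth (\<lambda>x. \<Sum>(a, b)\<in>{(a, b). a + b \<le> r}. if a = 0 \<or> b = 0 then 0 else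
      c a b * (cz x ^ (a - 1) * cnj (cz x) ^ (b - 1)))"
    unfolding case_prod_unfold
  proof (rule csmooth_sum)
    fix p
    show "csmooth (\<lambda>x. if fst p = 0 \<or> snd p = 0 then 0 else
      c (fst p) (snd p) * (cz x ^ (fst p - 1) * cnj (cz x) ^ (snd p - 1)))"
    proof (cases "fst p = 0 \<or> snd p = 0")
      case False
      have "csmooth (\<lambda>x. c (fst p) (snd p) * (cz x ^ (fst p - 1) * cnj (cz x) ^ (snd p - 1)))"
        by (intro csmooth_mult csmooth_const csmooth_power csmooth_cnj csmooth_cz)
      with False show ?thesis by simp
    qed (simp add: csmooth_const)
  qed
  then have h: "smooth_fn h" unfolding h_def[abs_def] csmooth_def by blast
  have herm: "c b a = cnj (c a b)" and zero: "c a 0 = 0" for a b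
    using c unfolding admissible_def by blast+
  have zero': "c 0 b = 0" for b using herm[of 0 b] zero[of b] by simp
  have real: "of_real (h x * (x \<bullet> x)) = cpoly r c x" for x
  proof -
    have "cnj (cpoly r c x) = cpoly r c x"
      unfolding cnj_cpoly by (rule cpoly_cong) (metis herm)
    then have im: "Im (cpoly r c x) = 0" by (simp add: complex_eq_iff)
    have xx: "cz x * cnj (cz x) = of_real (x \<bullet> x)"
      by (simp add: complex_norm_square[symmetric] norm_cz power2_norm_eq_inner)
    have eq: "(\<Sum>(a, b)\<in>{(a, b). a + b \<le> r}. if a = 0 \<or> b = 0 then 0 else
      c a b * (cz x ^ (a - 1) * cnj (cz x) ^ (b - 1))) * of_real (x \<bullet> x) = cpoly r c x"
      unfolding cpoly_def xx[symmetric] sum_distrib_right case_prod_unfold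
    proof (rule sum.cong[OF refl])
      fix p :: "nat \<times> nat"
      obtain a b where p: "p = (a, b)" by (cases p)
      show "(if fst p = 0 \<or> snd p = 0 then 0 else
          c (fst p) (snd p) * (cz x ^ (fst p - 1) * cnj (cz x) ^ (snd p - 1))) * (cz x * cnj (cz x)) =
          c (fst p) (snd p) * (cz x ^ fst p * cnj (cz x) ^ snd p)"
        by (cases a; cases b) (auto simp: p zero zero')
    qed
    have "Re (S * of_real y) = Re S * y" for S y by simp
    then have "Re (cpoly r c x) = h x * (x \<bullet> x)"
      by (simp only: h_def eq[symmetric])
    with im show ?thesis by (simp add: complex_eq_iff)
  qed
  note G = riem_metric_radial[OF h]
  show ?thesis
  proof (rule that[OF G(1,2,4)], rule Aut_eq_Stab[OF G(2,3,4) _ c])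
    show "vanish (r + 2) (\<lambda>x. radial_metric h x *v x - x)"
      unfolding G(5) by (simp add: vanish_zero)
    show "vanish (Suc r) (\<lambda>x. of_real (radial_metric h x $ 1 $ 1 + radial_metric h x $ 2 $ 2) - (2 + cpoly r c x))"
      unfolding G(6) of_real_add real by (simp add: vanish_zero)
  qed
qed

lemma matrix_inv_eq:
  fixes A B :: "real^2^2"
  assumes "A ** B = mat 1" shows "matrix_inv A = B"
proof -
  have BA: "B ** A = mat 1" using assms by (simp add: matrix_left_right_inverse)
  have "A ** matrix_inv A = mat 1 \<and> matrix_inv A ** A = mat 1"
    unfolding matrix_inv_def by (rule someI[of _ B]) (simp add: assms BA)
  then have "B ** (A ** matrix_inv A) = B" by simp
  then show ?thesis by (simp add: matrix_mul_assoc BA)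
qed

text \<open>Reduces the geometry to coefficient arrays. A given frame \<open>P\<close> is absorbed
  into the normal coordinates, so no conjugation remains; conversely, a conjugating \<open>Q\<close>
  is realised by the frame \<open>transpose Q\<close>, whose inverse is \<open>Q\<close>.\<close>

lemma stratum_nonempty_iff:
  "stratum_nonempty r H \<longleftrightarrow> (\<exists>c. admissible r c \<and> conj_O2 (Stab c) H)"
proof
  assume "stratum_nonempty r H"
  then obtain g P where g: "riem_metric g" and P: "transpose P ** g 0 ** P = mat 1"
    and H: "(\<lambda>A. matrix_inv P ** A ** P) ` Aut r g = H"
    unfolding stratum_nonempty_def has_type_def by blast
  have sg: "smooth_mat g" and sym: "\<And>x. transpose (g x) = g x"
    using g by (auto simp: riem_metric_def smooth_mat_def)
  have PR: "P ** (transpose P ** g 0) = mat 1" using P by (simp add: matrix_left_right_inverse)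
  have inv: "P ** matrix_inv P = mat 1" "matrix_inv P ** P = mat 1"
    unfolding matrix_inv_eq[OF PR] by (rule PR, rule P)
  obtain \<phi> where \<phi>: "smooth_map \<phi>" "\<phi> 0 = 0" "jac \<phi> 0 = P" "vanish (r + 2) (\<lambda>x. pullback \<phi> g x *v x - x)"
    using normal_form[OF sg P] by blast
  let ?G = "pullback \<phi> g"
  have G: "smooth_mat ?G" "\<And>x. transpose (?G x) = ?G x" "?G 0 = mat 1"
    using smooth_mat_pullback[OF \<phi>(1) sg] pullback_symmetric[OF sym] P \<phi> by (auto simp: pullback_def[of \<phi> g 0])
  obtain c where c: "admissible r c" "vanish (Suc r) (\<lambda>x. of_real (?G x $ 1 $ 1 + ?G x $ 2 $ 2) - (2 + cpoly r c x))"
    using admissible_exists[OF G(1,2) \<phi>(4)] by blast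
  have "Stab c = Aut r ?G" using Aut_eq_Stab[OF G \<phi>(4) c] by simp
  also have "\<dots> = H" using Aut_pullback[OF sg \<phi>(1-3) inv] H by simp
  finally have "conj_O2 (Stab c) H"
    unfolding conj_O2_def by (intro bexI[of _ "mat 1"]) (auto simp: O2_def)
  with c show "\<exists>c. admissible r c \<and> conj_O2 (Stab c) H" by blast
next
  assume "\<exists>c. admissible r c \<and> conj_O2 (Stab c) H"
  then obtain c Q where c: "admissible r c" and Q: "Q \<in> O2" and H: "H = (\<lambda>A. Q ** A ** transpose Q) ` Stab c"
    unfolding conj_O2_def by blast
  obtain G where G: "riem_metric G" "smooth_mat G" "G 0 = mat 1" "Aut r G = Stab c"
    using metric_with_coefficients[OF c] by blast
  have Q': "Q ** transpose Q = mat 1" "transpose Q ** Q = mat 1" using Q O2_iff by auto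
  have inv: "matrix_inv (transpose Q) = Q" by (rule matrix_inv_eq[OF Q'(2)])
  have "has_type r G H"
    unfolding has_type_def
    by (intro exI[of _ "transpose Q"]) (simp add: G H inv Q' transpose_transpose)
  then show "stratum_nonempty r H" unfolding stratum_nonempty_def using G(1) by blast
qed


section \<open>Classification of the stabilisers\<close>

lemma rotc_mult: "rotc u ** rotc v = rotc (u * v)"
  by (simp add: rotc_simps algebra_simps)

lemma refl0_rotc: "refl0 ** rotc u = rotc (cnj u) ** refl0"
  by (simp add: rotc_simps)

lemma transpose_rotc: "transpose (rotc u) = rotc (cnj u)"
  by (simp add: rotc_simps)

lemma Kgrp_eq: "m \<ge> 1 \<Longrightarrow> Kgrp m = rotc ` {u. u ^ m = 1}"
proof -
  assume m: "m \<ge> 1"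
  have "(\<lambda>k. cis (2 * pi * real k / real m)) ` {..<m} = {u. u ^ m = 1}"
    using Complex.bij_betw_roots_unity[of m] m by (simp add: bij_betw_def)
  moreover have "Kgrp m = rotc ` (\<lambda>k. cis (2 * pi * real k / real m)) ` {..<m}"
    unfolding Kgrp_def rot_eq_rotc by auto
  ultimately show ?thesis by simp
qed

text \<open>\<open>Dgrp\<close> multiplies by the reflection on the left and \<open>Stab\<close> on
  the right; the two agree because conjugation permutes the roots of unity.\<close>

lemma Dgrp_eq: "m \<ge> 1 \<Longrightarrow> Dgrp m = rotc ` {u. u ^ m = 1} \<union> (\<lambda>u. rotc u ** refl0) ` {u. u ^ m = 1}"
proof -
  assume m: "m \<ge> 1"
  have "cnj ` {u. u ^ m = 1} = {u. u ^ m = 1}"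
  proof safe
    fix u :: complex assume "u ^ m = 1"
    then show "cnj u ^ m = 1" by (metis complex_cnj_one complex_cnj_power)
    then show "u \<in> cnj ` {u. u ^ m = 1}" by (intro image_eqI[of _ _ "cnj u"]) auto
  qed
  then have "(\<lambda>A. refl0 ** A) ` rotc ` {u. u ^ m = 1} = (\<lambda>u. rotc u ** refl0) ` {u. u ^ m = 1}"
    by (simp only: image_image refl0_rotc flip: image_image[of "\<lambda>u. rotc u ** refl0" cnj])
  then show ?thesis by (simp add: Dgrp_def Kgrp_eq[OF m])
qed

definition Rot :: "(nat \<Rightarrow> nat \<Rightarrow> complex) \<Rightarrow> complex set" where
  "Rot c = {u. norm u = 1 \<and> (\<forall>a b. c a b * u ^ a = c a b * u ^ b)}"

definition Ref :: "(nat \<Rightarrow> nat \<Rightarrow> complex) \<Rightarrow> complex set" where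
  "Ref c = {u. norm u = 1 \<and> (\<forall>a b. c a b * u ^ a = cnj (c a b) * u ^ b)}"

lemma Stab_eq: "Stab c = rotc ` Rot c \<union> (\<lambda>u. rotc u ** refl0) ` Ref c"
  unfolding Stab_def Rot_def Ref_def by auto

lemma conj_O2_refl: "conj_O2 H H"
  unfolding conj_O2_def by (intro bexI[of _ "mat 1"]) (auto simp: O2_def)

lemma conj_O2_trans: "conj_O2 H K \<Longrightarrow> conj_O2 K L \<Longrightarrow> conj_O2 H L"
proof -
  assume "conj_O2 H K" "conj_O2 K L"
  then obtain P Q where P: "P \<in> O2" "K = (\<lambda>A. P ** A ** transpose P) ` H"
    and Q: "Q \<in> O2" "L = (\<lambda>A. Q ** A ** transpose Q) ` K"
    unfolding conj_O2_def by blast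
  have "transpose (Q ** P) ** (Q ** P) = transpose P ** (transpose Q ** Q) ** P"
    by (simp add: matrix_transpose_mul matrix_mul_assoc)
  then have "Q ** P \<in> O2"
    using P(1) Q(1) by (simp add: O2_def)
  moreover have "L = (\<lambda>A. (Q ** P) ** A ** transpose (Q ** P)) ` H"
    unfolding P Q image_image by (simp add: matrix_transpose_mul matrix_mul_assoc)
  ultimately show ?thesis unfolding conj_O2_def by blast
qed

lemma norm_root_unity: "(u::complex) ^ m = 1 \<Longrightarrow> m \<ge> 1 \<Longrightarrow> norm u = 1"
  by (metis norm_ge_zero norm_one norm_power not_one_le_zero power_eq_1_iff)

lemma power_eq_iff_root_unity:
  fixes u :: complex assumes "u \<noteq> 0" "b \<le> a" shows "u ^ a = u ^ b \<longleftrightarrow> u ^ (a - b) = 1"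
proof -
  have "u ^ a = u ^ (a - b) * u ^ b" using assms(2) by (simp flip: power_add)
  then show ?thesis using assms(1) by simp
qed

lemma admissible_cases: "admissible r c \<Longrightarrow> c a b \<noteq> 0 \<Longrightarrow> c b a = cnj (c a b) \<and> a \<ge> 1 \<and> b \<ge> 1 \<and> a + b \<le> r"
  unfolding admissible_def
  by (metis complex_cnj_zero not_le less_one)

lemma admissible_diag: "admissible r c \<Longrightarrow> cnj (c a a) = c a a"
  unfolding admissible_def by metis

text \<open>The order \<open>m\<close> is in effect the greatest common divisor of the differences
  \<open>a - b\<close> over the nonzero coefficients, obtained as the least positive exponent of
  \<open>Rot c\<close>: division with remainder shows that it divides every other exponent. The
  bound on \<open>m\<close> holds since \<open>m \<le> a - b\<close> for one such pair with
  \<open>b \<ge> 1\<close> and \<open>a + b \<le> r\<close>.\<close>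

lemma Rot_roots_of_unity:
  assumes c: "admissible r c" and p: "c p q \<noteq> 0" "p \<noteq> q"
  obtains m where "m \<ge> 1" "m + 2 \<le> r" "Rot c = {u. u ^ m = 1}"
    "\<And>a b. c a b \<noteq> 0 \<Longrightarrow> b \<le> a \<Longrightarrow> m dvd a - b"
proof -
  define N where "N n \<longleftrightarrow> (\<forall>u\<in>Rot c. u ^ n = 1)" for n
  have nz: "u \<noteq> 0" if "u \<in> Rot c" for u using that by (auto simp: Rot_def)
  have N: "N (a - b)" if "c a b \<noteq> 0" "b \<le> a" for a b
    unfolding N_def
  proof
    fix u assume u: "u \<in> Rot c"
    then have "u ^ a = u ^ b" using that by (auto simp: Rot_def)
    then show "u ^ (a - b) = 1" using power_eq_iff_root_unity[OF nz[OF u] that(2)] by simp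
  qed
  obtain a b where ab: "c a b \<noteq> 0" "b < a"
    using p admissible_cases[OF c p(1)] by (metis complex_cnj_zero_iff linorder_neqE_nat)
  define m where "m = (LEAST n. n \<ge> 1 \<and> N n)"
  have ex: "a - b \<ge> 1 \<and> N (a - b)" using N[of a b] ab by simp
  have m: "m \<ge> 1" "N m" using LeastI[of "\<lambda>n. n \<ge> 1 \<and> N n", OF ex] by (auto simp: m_def)
  have least: "m \<le> n" if "n \<ge> 1" "N n" for n
    unfolding m_def using that by (intro Least_le) simp
  have "m \<le> a - b" using least ex by blast
  then have mr: "m + 2 \<le> r" using admissible_cases[OF c ab(1)] ab(2) by linarith
  have dvd: "m dvd n" if n: "N n" for n
  proof (rule ccontr)
    assume "\<not> m dvd n"
    then have k: "n mod m \<ge> 1" by (simp add: Suc_le_eq mod_greater_zero_iff_not_dvd)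
    have "N (n mod m)"
      unfolding N_def
    proof
      fix u assume u: "u \<in> Rot c"
      have "u ^ n = (u ^ m) ^ (n div m) * u ^ (n mod m)"
        by (metis div_mult_mod_eq mult.commute power_add power_mult)
      then show "u ^ (n mod m) = 1" using n m(2) u by (simp add: N_def)
    qed
    then have "m \<le> n mod m" using least[OF k] by blast
    moreover have "n mod m < m" using m(1) by (intro mod_less_divisor) simp
    ultimately show False by simp
  qed
  have sub: "c a b * u ^ a = c a b * u ^ b" if u: "u ^ m = 1" and ba: "b \<le> a" for u a b
  proof (cases "c a b = 0")
    case False
    then obtain k where k: "a - b = m * k" using dvd[OF N] ba by blast
    have "u \<noteq> 0" using u m(1) by (auto simp: power_0_left)
    moreover have "u ^ (a - b) = 1" unfolding k by (simp add: power_mult u)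
    ultimately show ?thesis using power_eq_iff_root_unity ba by simp
  qed simp
  have "Rot c = {u. u ^ m = 1}"
  proof safe
    fix u assume "u \<in> Rot c" then show "u ^ m = 1" using m(2) by (simp add: N_def)
  next
    fix u :: complex assume u: "u ^ m = 1"
    have "c a b * u ^ a = c a b * u ^ b" for a b
    proof (cases "b \<le> a")
      case False
      then have "c b a * u ^ b = c b a * u ^ a" using sub[OF u] by simp
      moreover have "c a b = 0 \<longleftrightarrow> c b a = 0"
        using admissible_cases[OF c] by (metis complex_cnj_zero_iff)
      ultimately show ?thesis by auto
    qed (use sub[OF u] in simp)
    then show "u \<in> Rot c" using norm_root_unity[OF u m(1)] by (simp add: Rot_def)
  qed
  with that[OF m(1) mr] dvd[OF N] show ?thesis by blast
qed

text \<open>The quotient of two reflection parameters is a rotation parameter: multiply the two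
  conditions crosswise and cancel the coefficient and its conjugate.\<close>

lemma Ref_coset:
  assumes v: "v \<in> Ref c" shows "Ref c = (\<lambda>u. u * v) ` Rot c"
proof safe
  fix u assume u: "u \<in> Ref c"
  have n: "norm u = 1" "norm v = 1" "u \<noteq> 0" "v \<noteq> 0" using u v by (auto simp: Ref_def)
  have "c a b * (u / v) ^ a = c a b * (u / v) ^ b" for a b
  proof (cases "c a b = 0")
    case False
    have "c a b * u ^ a = cnj (c a b) * u ^ b" "c a b * v ^ a = cnj (c a b) * v ^ b"
      using u v by (auto simp: Ref_def)
    then have "(c a b * u ^ a) * (cnj (c a b) * v ^ b) = (cnj (c a b) * u ^ b) * (c a b * v ^ a)" by simp
    then have "u ^ a * v ^ b = u ^ b * v ^ a" using False by simp
    then show ?thesis using n by (simp add: power_divide field_simps)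
  qed simp
  then have "u / v \<in> Rot c" using n by (simp add: Rot_def norm_divide)
  then show "u \<in> (\<lambda>u. u * v) ` Rot c" using n by (intro image_eqI[of _ _ "u / v"]) auto
next
  fix u assume u: "u \<in> Rot c"
  have "c a b * (u * v) ^ a = cnj (c a b) * (u * v) ^ b" for a b
  proof (cases "c a b = 0")
    case False
    then have "u ^ a = u ^ b" using u by (auto simp: Rot_def)
    moreover have "c a b * v ^ a = cnj (c a b) * v ^ b" using v by (auto simp: Ref_def)
    ultimately show ?thesis by (simp add: power_mult_distrib mult_ac)
  qed simp
  then show "u * v \<in> Ref c" using u v by (simp add: Ref_def Rot_def norm_mult)
qed

text \<open>Turning the axis of a reflection by conjugation with the rotation \<open>s\<close>
  multiplies its parameter by the square of \<open>s\<close>, while rotations stay fixed. A square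
  root of one element \<open>v\<close> of \<open>Ref c\<close> thus moves \<open>refl0\<close> to
  the reflection given by \<open>v\<close>.\<close>

lemma conj_Dgrp_Stab:
  assumes v: "v \<in> Ref c" and m: "m \<ge> 1" and R: "Rot c = {u. u ^ m = 1}"
  shows "conj_O2 (Dgrp m) (Stab c)"
proof -
  define s where "s = csqrt v"
  have "norm v = 1" using v by (simp add: Ref_def)
  then have s: "norm s = 1" "s * s = v"
    by (simp_all add: s_def norm_csqrt flip: power2_eq_square)
  have ss: "s * cnj s = 1" using s(1) by (simp add: complex_norm_square[symmetric])
  have Q: "rotc s \<in> O2" using s(1) O2_rotc_cases by blast
  have rot: "rotc s ** rotc u ** transpose (rotc s) = rotc u" for u
  proof -
    have "s * u * cnj s = (s * cnj s) * u" by (simp add: mult_ac)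
    then show ?thesis by (simp only: transpose_rotc rotc_mult ss mult_1_left)
  qed
  have ref: "rotc s ** (rotc u ** refl0) ** transpose (rotc s) = rotc (u * v) ** refl0" for u
  proof -
    have "rotc s ** (rotc u ** refl0) ** transpose (rotc s) = rotc s ** rotc u ** (refl0 ** rotc (cnj s))"
      by (simp add: transpose_rotc matrix_mul_assoc)
    also have "\<dots> = rotc s ** rotc u ** (rotc s ** refl0)" by (simp add: refl0_rotc)
    also have "\<dots> = (rotc s ** rotc u ** rotc s) ** refl0" by (simp add: matrix_mul_assoc)
    also have "rotc s ** rotc u ** rotc s = rotc (u * (s * s))" by (simp only: rotc_mult mult_ac)
    finally show ?thesis unfolding s(2) .
  qed
  have "Stab c = (\<lambda>A. rotc s ** A ** transpose (rotc s)) ` Dgrp m"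
    unfolding Stab_eq Ref_coset[OF v] Dgrp_eq[OF m] R image_Un image_image rot ref ..
  with Q show ?thesis unfolding conj_O2_def by blast
qed

text \<open>Diagonal coefficients are real by hermitian symmetry, so the polynomial is a real
  function of the norm alone, invariant under rotations and reflections alike.\<close>

lemma Stab_diagonal:
  assumes c: "admissible r c" and d: "\<And>a b. c a b \<noteq> 0 \<Longrightarrow> a = b"
  shows "Stab c = O2"
proof -
  have "c a b * u ^ a = c a b * u ^ b" "c a b * u ^ a = cnj (c a b) * u ^ b" for a b u
    using d[of a b] admissible_diag[OF c, of a] by (cases "c a b = 0"; force)+
  then have "Rot c = {u. norm u = 1}" "Ref c = {u. norm u = 1}"
    by (auto simp: Rot_def Ref_def)
  then show ?thesis
    unfolding Stab_eq using O2_rotc_cases by auto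
qed

text \<open>Diagonal terms impose no condition, and the one pair left asks for a unit
  \<open>u\<close> with \<open>k * u ^ m = cnj k\<close>. Such a \<open>u\<close> is an
  \<open>m\<close>-th root of \<open>cnj k / k\<close>, which has norm 1.\<close>

lemma Ref_nonempty_single_harmonic:
  assumes c: "admissible r c" and m: "m \<ge> 1"
    and d: "\<And>a b. c a b \<noteq> 0 \<Longrightarrow> b < a \<Longrightarrow> a = m + 1 \<and> b = 1"
  shows "Ref c \<noteq> {}"
proof -
  define k where "k = c (m + 1) 1"
  have "\<exists>u. norm u = 1 \<and> k * u ^ m = cnj k"
  proof (cases "k = 0")
    case True then show ?thesis by (intro exI[of _ 1]) simp
  next
    case False
    have n: "norm (cnj k / k) = 1" using False by (simp add: norm_divide)
    define u where "u = cis (Arg (cnj k / k) / m)"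
    have "u ^ m = cis (Arg (cnj k / k))" using m by (simp add: u_def Complex.DeMoivre)
    also have "\<dots> = cnj k / k"
      using n cis_Arg[of "cnj k / k"] by (simp add: sgn_eq False)
    finally have "k * u ^ m = cnj k" using False by simp
    then show ?thesis by (intro exI[of _ u]) (simp add: u_def)
  qed
  then obtain u where u: "norm u = 1" "k * u ^ m = cnj k" by blast
  have lt: "c a b * u ^ a = cnj (c a b) * u ^ b" if "b < a" for a b
  proof (cases "c a b = 0")
    case False
    with d[OF _ that] have "a = m + 1" "b = 1" by blast+
    then show ?thesis using u(2) by (simp add: k_def mult_ac)
  qed simp
  have "c a b * u ^ a = cnj (c a b) * u ^ b" for a b
  proof (cases a b rule: linorder_cases)
    case less
    have "c a b = cnj (c b a)" using c unfolding admissible_def by blast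
    then show ?thesis using lt[OF less] by simp
  next
    case equal
    then show ?thesis using admissible_diag[OF c, of a] by simp
  qed (use lt in simp)
  then show ?thesis using u(1) by (auto simp: Ref_def)
qed

lemma Stab_classification:
  assumes c: "admissible r c"
  shows "conj_O2 O2 (Stab c)
     \<or> (\<exists>m. 1 \<le> m \<and> m + 2 \<le> r \<and> conj_O2 (Dgrp m) (Stab c))
     \<or> (4 \<le> r \<and> conj_O2 (Kgrp 1) (Stab c))
     \<or> (\<exists>m. 2 \<le> m \<and> m + 4 \<le> r \<and> conj_O2 (Kgrp m) (Stab c))"
proof (cases "\<forall>a b. c a b \<noteq> 0 \<longrightarrow> a = b")
  case True
  then show ?thesis using Stab_diagonal[OF c] conj_O2_refl by metis
next
  case False
  then obtain p q where "c p q \<noteq> 0" "p \<noteq> q" by blast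
  then obtain m where m: "m \<ge> 1" "m + 2 \<le> r" "Rot c = {u. u ^ m = 1}"
    "\<And>a b. c a b \<noteq> 0 \<Longrightarrow> b \<le> a \<Longrightarrow> m dvd a - b"
    using Rot_roots_of_unity[OF c] by metis
  show ?thesis
  proof (cases "Ref c = {}")
    case False
    then show ?thesis using conj_Dgrp_Stab[OF _ m(1,3)] m(1,2) by blast
  next
    case True
    then have K: "conj_O2 (Kgrp m) (Stab c)"
      using conj_O2_refl by (simp add: Stab_eq Kgrp_eq[OF m(1)] m(3))
    \<comment> \<open>If both bounds fail, \<open>(m + 1, 1)\<close> is the only possible place of a
      nonzero coefficient with \<open>b < a\<close>: a difference of at least \<open>2 * m\<close>
      needs degree \<open>2 * m + 2\<close>, and the difference \<open>m\<close> with
      \<open>b \<ge> 2\<close> needs degree \<open>m + 4\<close>. Then a reflection exists.\<close>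
    have "(m = 1 \<and> 4 \<le> r) \<or> (m \<ge> 2 \<and> m + 4 \<le> r)"
    proof (rule ccontr)
      assume neg: "\<not> ?thesis"
      have "a = m + 1 \<and> b = 1" if ab: "c a b \<noteq> 0" "b < a" for a b
      proof -
        have abr: "a \<ge> 1" "b \<ge> 1" "a + b \<le> r" using admissible_cases[OF c ab(1)] by auto
        obtain k where k: "a - b = m * k" using m(4)[OF ab(1)] ab(2) by auto
        have "k \<noteq> 0" using k ab(2) by (intro notI) simp
        moreover have "\<not> k \<ge> 2"
        proof
          assume "k \<ge> 2"
          then have "m * 2 \<le> a - b" unfolding k by (intro mult_le_mono2)
          then show False using abr neg m(1) ab(2) by linarith
        qed
        ultimately have "k = 1" by linarith
        then show ?thesis using k abr neg m(1) ab(2) by simp linarith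
      qed
      then show False using Ref_nonempty_single_harmonic[OF c m(1)] True by blast
    qed
    then show ?thesis using K by auto
  qed
qed

text \<open>The witness is the array of \<open>2 * Re (z ^ m)\<close> times the squared norm of
  \<open>z\<close>. Its coefficients are real, so rotations and reflections satisfy the same
  equations.\<close>

lemma admissible_Dgrp:
  assumes m: "m \<ge> 1" "m + 2 \<le> r"
  shows "\<exists>c. admissible r c \<and> Stab c = Dgrp m"
proof -
  define c :: "nat \<Rightarrow> nat \<Rightarrow> complex"
    where "c a b = (if (a = m + 1 \<and> b = 1) \<or> (a = 1 \<and> b = m + 1) then 1 else 0)" for a b
  have "admissible r c" using m by (auto simp: admissible_def c_def)
  have rot: "(\<forall>a b. c a b * u ^ a = c a b * u ^ b) \<longleftrightarrow> u ^ m = 1" if "norm u = 1" for u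
  proof
    assume "\<forall>a b. c a b * u ^ a = c a b * u ^ b"
    from this[rule_format, of "m + 1" 1] show "u ^ m = 1" using that by (auto simp: c_def)
  next
    assume "u ^ m = 1" then show "\<forall>a b. c a b * u ^ a = c a b * u ^ b" by (auto simp: c_def)
  qed
  have "cnj (c a b) = c a b" for a b by (simp add: c_def)
  then have "Ref c = Rot c" by (simp add: Ref_def Rot_def)
  moreover have "Rot c = {u. u ^ m = 1}"
    unfolding Rot_def using norm_root_unity[OF _ m(1)] rot by blast
  ultimately show ?thesis using \<open>admissible r c\<close>
    by (intro exI[of _ c]) (simp add: Stab_eq Dgrp_eq[OF m(1)])
qed

text \<open>The pair \<open>(m + 1, 1)\<close> fixes the rotation group, and the pair
  \<open>(q, s)\<close> with coefficient \<open>\<i>\<close> leaves it unchanged as \<open>m\<close>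
  divides \<open>q - s\<close>. The phases are incompatible for reflections: the first pair forces
  \<open>u ^ m = 1\<close>, hence \<open>u ^ q = u ^ s\<close>, and the second pair would then give
  \<open>\<i> = cnj \<i>\<close>.\<close>

lemma admissible_Kgrp:
  assumes m: "m \<ge> 1" "m + 2 \<le> r" and q: "s \<ge> 1" "s < q" "q + s \<le> r" "m dvd q - s" "(q, s) \<noteq> (m + 1, 1)"
  shows "\<exists>c. admissible r c \<and> Stab c = Kgrp m"
proof -
  define c :: "nat \<Rightarrow> nat \<Rightarrow> complex"
    where "c a b = (if (a = m + 1 \<and> b = 1) \<or> (a = 1 \<and> b = m + 1) then 1
      else if a = q \<and> b = s then \<i> else if a = s \<and> b = q then - \<i> else 0)" for a b
  have "c b a = cnj (c a b)" for a b using m q by (auto simp: c_def)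
  moreover have "c a 0 = 0" for a using m q by (auto simp: c_def)
  moreover have "c a b = 0" if "r < a + b" for a b using m q that by (auto simp: c_def)
  ultimately have adm: "admissible r c" unfolding admissible_def by blast
  have c1: "c (m + 1) 1 = 1" "c q s = \<i>" using q m by (auto simp: c_def)
  have rot: "(\<forall>a b. c a b * u ^ a = c a b * u ^ b) \<longleftrightarrow> u ^ m = 1" if u: "u \<noteq> 0" for u
  proof
    assume "\<forall>a b. c a b * u ^ a = c a b * u ^ b"
    from this[rule_format, of "m + 1" 1] show "u ^ m = 1" using u c1 by simp
  next
    assume um: "u ^ m = 1"
    obtain k where "q - s = m * k" using q(4) by blast
    then have "u ^ (q - s) = 1" by (simp add: power_mult um)
    then have qs: "u ^ q = u ^ s" using power_eq_iff_root_unity[OF u] q(2) by simp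
    have "u ^ a = u ^ b" if "c a b \<noteq> 0" for a b
    proof -
      have "(a = m + 1 \<and> b = 1) \<or> (a = 1 \<and> b = m + 1) \<or> (a = q \<and> b = s) \<or> (a = s \<and> b = q)"
      proof (rule ccontr)
        assume "\<not> ?thesis"
        then have n: "\<not> ((a = m + 1 \<and> b = 1) \<or> (a = 1 \<and> b = m + 1))" "\<not> (a = q \<and> b = s)" "\<not> (a = s \<and> b = q)"
          by blast+
        have "c a b = 0" unfolding c_def if_not_P[OF n(1)] if_not_P[OF n(2)] if_not_P[OF n(3)] ..
        with that show False by simp
      qed
      then show ?thesis by (elim disjE conjE) (simp_all only: qs power_add um power_one_right mult_1_left)
    qed
    then show "\<forall>a b. c a b * u ^ a = c a b * u ^ b" by (metis mult_zero_left)
  qed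
  have R: "Rot c = {u. u ^ m = 1}"
  proof safe
    fix u assume "u \<in> Rot c"
    then show "u ^ m = 1" using rot[of u] unfolding Rot_def by force
  next
    fix u :: complex assume u: "u ^ m = 1"
    then have n: "norm u = 1" by (rule norm_root_unity[OF _ m(1)])
    then have "u \<noteq> 0" by auto
    then show "u \<in> Rot c" using rot u n unfolding Rot_def by blast
  qed
  have "Ref c = {}"
  proof (rule ccontr)
    assume "Ref c \<noteq> {}"
    then obtain u where u: "norm u = 1" "\<And>a b. c a b * u ^ a = cnj (c a b) * u ^ b" by (auto simp: Ref_def)
    have u0: "u \<noteq> 0" using u(1) by auto
    have um: "u ^ m = 1" using u(2)[of "m + 1" 1] u0 c1 by simp
    have "c q s * u ^ q = c q s * u ^ s" using rot[OF u0] um by blast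
    moreover have "c q s * u ^ q = cnj (c q s) * u ^ s" by (rule u(2))
    ultimately have "\<i> * u ^ s = cnj \<i> * u ^ s" unfolding c1(2) by simp
    then have "\<i> = cnj \<i>" using u0 by simp
    then show False by (simp add: complex_eq_iff)
  qed
  with adm R show ?thesis
    by (intro exI[of _ c]) (simp add: Stab_eq Kgrp_eq[OF m(1)])
qed

section \<open>Separating SO(2) from the other types\<close>

lemma det_conj_O2: "Q \<in> O2 \<Longrightarrow> det (Q ** A ** transpose Q) = det A"
proof -
  assume "Q \<in> O2"
  then have "det Q * det Q = 1"
    by (metis O2_iff(2) det_I det_mul det_transpose)
  then show ?thesis by (simp add: det_mul mult.assoc mult.left_commute[of _ "det A"])
qed

text \<open>If the unit circle were finite, the roots of unity of order one more than its
  cardinality would not fit into it.\<close>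

lemma infinite_SO2: "infinite SO2"
proof
  assume "finite SO2"
  moreover have "rotc ` {u. norm u = 1} \<subseteq> SO2"
  proof safe
    fix u :: complex assume u: "norm u = 1"
    then have "rotc u \<in> O2" using O2_rotc_cases by blast
    moreover have "det (rotc u) = 1"
      using u by (simp add: det_2 rotc_nth norm_complex_def power2_eq_square)
    ultimately show "rotc u \<in> SO2" by (simp add: SO2_def)
  qed
  moreover have "inj rotc" by (auto simp: inj_def rotc_simps complex_eq_iff)
  ultimately have fin: "finite {u::complex. norm u = 1}"
    using finite_subset finite_imageD inj_on_subset subset_UNIV by metis
  define n where "n = Suc (card {u::complex. norm u = 1})"
  have n: "n \<ge> 1" by (simp add: n_def)
  have "{u::complex. u ^ n = 1} \<subseteq> {u. norm u = 1}" using norm_root_unity[OF _ n] by blast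
  from card_mono[OF fin this] have "n \<le> card {u::complex. norm u = 1}"
    using card_roots_unity_eq[of n] n by simp
  then show False by (simp add: n_def)
qed

lemma finite_Kgrp: "m \<ge> 1 \<Longrightarrow> finite (Kgrp m)"
  unfolding Kgrp_def by (simp add: setcompr_eq_image)

lemma finite_Dgrp: "m \<ge> 1 \<Longrightarrow> finite (Dgrp m)"
  unfolding Dgrp_def using finite_Kgrp by simp

lemma not_conj_SO2_finite:
  assumes "conj_O2 SO2 H" "conj_O2 F H" shows "infinite F"
proof
  assume "finite F"
  then have "finite H" using assms(2) unfolding conj_O2_def by auto
  obtain Q where Q: "Q \<in> O2" "H = (\<lambda>A. Q ** A ** transpose Q) ` SO2" using assms(1) unfolding conj_O2_def by blast
  have "inj (\<lambda>A. Q ** A ** transpose Q)"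
  proof (rule inj_on_inverseI[of _ "\<lambda>B. transpose Q ** B ** Q"])
    fix A
    have "transpose Q ** (Q ** A ** transpose Q) ** Q = (transpose Q ** Q) ** A ** (transpose Q ** Q)"
      by (simp add: matrix_mul_assoc)
    then show "transpose Q ** (Q ** A ** transpose Q) ** Q = A" using Q(1) by (simp add: O2_def)
  qed
  then show False
    using \<open>finite H\<close> infinite_SO2 Q(2) by (metis finite_imageD inj_on_subset subset_UNIV)
qed

text \<open>The determinant is invariant under conjugation and takes the value -1 on any conjugate
  of \<open>refl0\<close>.\<close>

lemma not_conj_SO2_O2: "conj_O2 SO2 H \<Longrightarrow> \<not> conj_O2 O2 H"
proof
  assume "conj_O2 SO2 H" "conj_O2 O2 H"
  then obtain P Q where P: "P \<in> O2" "H = (\<lambda>A. P ** A ** transpose P) ` SO2"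
    and Q: "Q \<in> O2" "H = (\<lambda>A. Q ** A ** transpose Q) ` O2" unfolding conj_O2_def by blast
  have "refl0 \<in> O2" by (simp add: O2_def rotc_simps)
  then have "Q ** refl0 ** transpose Q \<in> H" using Q(2) by blast
  then obtain A where "A \<in> SO2" "Q ** refl0 ** transpose Q = P ** A ** transpose P" using P(2) by blast
  then have "det refl0 = det A" "det A = 1"
    using det_conj_O2[OF Q(1), of refl0] det_conj_O2[OF P(1), of A] by (simp_all add: SO2_def)
  then show False by (simp add: det_2 refl0_nth)
qed

theorem mainTheorem13:
  fixes r :: nat
  shows "(\<forall>H. closed_subgroup_O2 H \<longrightarrow>
           (stratum_nonempty r H \<longleftrightarrow>
              (conj_O2 O2 H
               \<or> (\<exists>m. 1 \<le> m \<and> m + 2 \<le> r \<and> conj_O2 (Dgrp m) H)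
               \<or> (4 \<le> r \<and> conj_O2 (Kgrp 1) H)
               \<or> (\<exists>m. 2 \<le> m \<and> m + 4 \<le> r \<and> conj_O2 (Kgrp m) H))))
         \<and> (\<forall>H. conj_O2 SO2 H \<longrightarrow> \<not> stratum_nonempty r H)"
proof (intro conjI allI impI)
  \<comment> \<open>Stated for every \<open>H\<close>, since it serves both the equivalence and the
    exclusion of \<open>SO2\<close>.\<close>
  have types: "conj_O2 O2 H
      \<or> (\<exists>m. 1 \<le> m \<and> m + 2 \<le> r \<and> conj_O2 (Dgrp m) H)
      \<or> (4 \<le> r \<and> conj_O2 (Kgrp 1) H)
      \<or> (\<exists>m. 2 \<le> m \<and> m + 4 \<le> r \<and> conj_O2 (Kgrp m) H)"
    if ne: "stratum_nonempty r H" for H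
  proof -
    obtain c where "admissible r c" and H: "conj_O2 (Stab c) H"
      using ne unfolding stratum_nonempty_iff by blast
    note trans = conj_O2_trans[OF _ H]
    from Stab_classification[OF \<open>admissible r c\<close>] show ?thesis
      by (elim disjE exE conjE) (auto dest: trans)
  qed
  fix H
  show "stratum_nonempty r H \<longleftrightarrow>
     (conj_O2 O2 H
      \<or> (\<exists>m. 1 \<le> m \<and> m + 2 \<le> r \<and> conj_O2 (Dgrp m) H)
      \<or> (4 \<le> r \<and> conj_O2 (Kgrp 1) H)
      \<or> (\<exists>m. 2 \<le> m \<and> m + 4 \<le> r \<and> conj_O2 (Kgrp m) H))" (is "_ \<longleftrightarrow> ?types")
  proof
    show "stratum_nonempty r H \<Longrightarrow> ?types" by (rule types)
    have zero: "admissible r (\<lambda>a b. 0)" by (simp add: admissible_def)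
    have "Stab (\<lambda>a b. 0) = O2" by (rule Stab_diagonal[OF zero]) simp
    then have O: "\<exists>c. admissible r c \<and> Stab c = O2" using zero by blast
    \<comment> \<open>The second pair is the cheapest one for each order: \<open>(3, 1)\<close> of
      degree 4 for \<open>m = 1\<close>, and below \<open>(m + 2, 2)\<close> of degree
      \<open>m + 4\<close> for \<open>m \<ge> 2\<close>.\<close>
    have K1: "\<exists>c. admissible r c \<and> Stab c = Kgrp 1" if "4 \<le> r"
      using admissible_Kgrp[of 1 r 1 3] that by simp
    have Km: "\<exists>c. admissible r c \<and> Stab c = Kgrp m" if "2 \<le> m" "m + 4 \<le> r" for m
      using admissible_Kgrp[of m r 2 "m + 2"] that by simp
    assume ?types
    then have "\<exists>c. admissible r c \<and> conj_O2 (Stab c) H"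
    proof (elim disjE exE conjE)
      fix m assume "1 \<le> m" "m + 2 \<le> r" "conj_O2 (Dgrp m) H"
      then show ?thesis using admissible_Dgrp[of m r] by metis
    next
      assume "4 \<le> r" "conj_O2 (Kgrp 1) H"
      then show ?thesis using K1 by metis
    next
      fix m assume "2 \<le> m" "m + 4 \<le> r" "conj_O2 (Kgrp m) H"
      then show ?thesis using Km[of m] by metis
    qed (use O in metis)
    then show "stratum_nonempty r H" by (simp only: stratum_nonempty_iff)
  qed
  assume SO2: "conj_O2 SO2 H"
  show "\<not> stratum_nonempty r H"
  proof
    assume "stratum_nonempty r H"
    from types[OF this] show False
    proof (elim disjE exE conjE)
      fix m assume "1 \<le> m" "conj_O2 (Dgrp m) H"
      then show False using not_conj_SO2_finite[OF SO2] finite_Dgrp by blast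
    next
      assume "conj_O2 (Kgrp 1) H"
      then show False using not_conj_SO2_finite[OF SO2] finite_Kgrp[of 1] by simp
    next
      fix m :: nat assume "2 \<le> m" "conj_O2 (Kgrp m) H"
      then show False using not_conj_SO2_finite[OF SO2] finite_Kgrp[of m] by simp
    qed (use not_conj_SO2_O2[OF SO2] in blast)
  qed
qed

end
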